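(* Let $p$ be an odd prime. Then $$\sum_{k=0}^{p-1}A_k\equiv c(p)\pmod p,$$ where $c(p)=4x^2-2p$ if $p\equiv1,3\pmod8$ and $p=x^2+2y^2$ with $x,y\in\mathbb Z$, and $c(p)=0$ if $\left(\frac{-2}p\right)=-1$, i.e., $p\equiv5,7\pmod8$. Also, if $p\equiv1\pmod3$ and $p=x^2+3y^2$ with $x,y\in\mathbb Z$, then $$\sum_{k=0}^{p-1}(-1)^kA_k\equiv\left(\frac{-1}p\right)\sum_{k=0}^{p-1}(-1)^kA_k\left(\frac1{16}\right)\equiv4x^2-2p\pmod p,$$ and if $p\equiv2\pmod3$, then $$\sum_{k=0}^{p-1}(-1)^kA_k\equiv\left(\frac{-1}p\right)\sum_{k=0}^{p-1}(-1)^kA_k\left(\frac1{16}\right)\equiv0\pmod{p^2}.$$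
   Context: For $n\in\{0,1,2,\ldots\}$, $A_n(x)=\sum_{k=0}^n\binom nk^2\binom{n+k}k^2x^k$ and $A_n=A_n(1)$. The symbol $\left(\frac{\cdot}p\right)$ is the Legendre symbol. For rational numbers $a,b$ and $m\ge1$, $a\equiv b\pmod{p^m}$ means that $(a-b)/p^m$ has denominator prime to $p$. *)

theory Defs
  imports "HOL-Number_Theory.Number_Theory"
begin

definition apery_poly :: "nat \<Rightarrow> rat \<Rightarrow> rat" where
  "apery_poly n x = (\<Sum>k=0..n. of_nat (n choose k) ^ 2 * of_nat ((n + k) choose k) ^ 2 * x ^ k)"

definition apery_number :: "nat \<Rightarrow> rat" where
  "apery_number n = apery_poly n 1"

(* quotient_of returns the reduced fraction (numerator, positive denominator). *)
definition rat_cong_prime_power :: "nat \<Rightarrow> nat \<Rightarrow> rat \<Rightarrow> rat \<Rightarrow> bool" where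
  "rat_cong_prime_power p m a b \<longleftrightarrow>
     coprime (snd (quotient_of ((a - b) / of_nat (p ^ m)))) (int p)"

end

theory Submission
  imports Defs Complex_Main "HOL-Computational_Algebra.Polynomial"
begin

text \<open>
  Write \<open>m = (p - 1) / 2\<close>, let \<open>\<chi>\<close> be the Legendre symbol, and put
  \<open>F_n(y) = (\<Sum>k\<le>n. C(2k,k)^2 C(n+k,2k) y^k)\<close> (\<open>clausen_sum\<close>).  Everything rests on three facts.

  First, both families of Apery sums collapse.  In the alternating sum of \<open>A_n(x)\<close> the coefficient of
  \<open>x^k\<close> is \<open>C(2k,k)^2\<close> times an alternating sum of \<open>C(n+k,2k)^2\<close>; a telescoping identity in \<open>n\<close>
  gives the latter a first order recurrence in \<open>k\<close> modulo \<open>p^2\<close>, with solution \<open>(-1)^k C(m+k,2k)\<close>.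
  Hence the alternating sum is \<open>F_m(-x)\<close> modulo \<open>p^2\<close> (\<open>alternating_apery_sum_cong\<close>).  For the sum
  without signs, Vandermonde's identity for \<open>(\<Sum>l. C(2j,l)^2)\<close> turns the inner sum for \<open>k = m - j\<close> into
  \<open>C(4j,2j)\<close> modulo \<open>p\<close>, and the result is \<open>F_n(-1/4)\<close> with \<open>n = p div 4\<close> (\<open>apery_sum_cong\<close>).

  Second, Clausen's identity: \<open>F_n(y)\<close> is the square of the Legendre polynomial \<open>P_n\<close> at a square root
  of \<open>s = 1 + 4 y\<close>.  As \<open>P_n\<close> is even or odd, this is \<open>s^(n mod 2)\<close> times the square of a
  rational number (\<open>clausen_sum_eq_square\<close>).  Two consequences: for \<open>y = -1/4\<close> only the constant term
  of \<open>P_n\<close> survives, so the sum of the \<open>A_n\<close> is zero for \<open>p \<equiv> 5, 7\<close> modulo 8 and otherwise a squared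
  binomial coefficient \<open>C(m, p div 8)^2\<close>; and when \<open>s\<close> is prime to \<open>p\<close>, divisibility of \<open>F_m(y)\<close> by
  \<open>p\<close> already forces divisibility by \<open>p^2\<close>, which is where the modulus \<open>p^2\<close> comes from.

  Third, the remaining quantities are character sums of curves with complex multiplication.
  At \<open>s = -3\<close> the Legendre value is, up to units, the sum of \<open>\<chi>((x+1)(3x^2+1))\<close>, and completing the cube
  turns it into the sum \<open>S\<close> of \<open>\<chi>(x^3 + 1)\<close>.  If \<open>p \<equiv> 2\<close> modulo 3, cubing is a permutation and \<open>S = 0\<close>.
  If \<open>p \<equiv> 1\<close> modulo 3, averaging over the twists \<open>x^3 + D\<close> gives \<open>S = 2u\<close> with \<open>p = u^2 + 3 v^2\<close>.
  The value at \<open>s = 3/4\<close> is linked to the one at \<open>s = -3\<close> by reversing the order of summation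
  in a sum of cubes of binomial coefficients.  Likewise \<open>C(m, p div 8)\<close> comes from the sums of
  \<open>\<chi>(x (x^4 + D))\<close> when \<open>p \<equiv> 1\<close> modulo 8, and from an analogue of these over the Gaussian integers
  modulo \<open>p\<close> (the field with \<open>p^2\<close> elements) when \<open>p \<equiv> 3\<close> modulo 8; averaging over the
  twists yields \<open>p = u^2 + 2 v^2\<close> with \<open>u = \<plusminus>C(m, p div 8) / 2\<close> modulo \<open>p\<close>.  A prime has at most one
  representation by such a form up to signs, so \<open>u^2\<close> is the given \<open>x^2\<close>.
\<close>

section \<open>Clausen's identity for Legendre polynomials\<close>

text \<open>
  The hypergeometric sum on the other side of Clausen's identity; its coefficients equal
  \<open>C(2k,k) C(n,k) C(n+k,k)\<close>.
\<close>

definition clausen_sum :: "nat \<Rightarrow> 'a::field_char_0 \<Rightarrow> 'a" where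
  "clausen_sum n y = (\<Sum>k\<le>n. of_nat ((2 * k) choose k) ^ 2 * of_nat ((n + k) choose (2 * k)) * y ^ k)"

text \<open>
  If \<open>P_n\<close> is the Legendre polynomial, then \<open>2^n P_n(t) = t^(n mod 2) Q(t^2)\<close> and this is \<open>Q(s)\<close>.
  Keeping the power of two outside makes the coefficients integers.
\<close>

definition legendre_even_part :: "nat \<Rightarrow> 'a::field_char_0 \<Rightarrow> 'a" where
  "legendre_even_part n s =
     (\<Sum>k\<le>n div 2. (-1) ^ k * of_nat (n choose k) * of_nat ((2 * n - 2 * k) choose n) * s ^ (n div 2 - k))"

text \<open>
  The Legendre polynomial multiplied by \<open>2^n\<close>.
\<close>

definition legendre_poly :: "nat \<Rightarrow> complex poly" where
  "legendre_poly n =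
     (\<Sum>k\<le>n div 2. monom ((-1) ^ k * of_nat (n choose k) * of_nat ((2 * n - 2 * k) choose n)) (n - 2 * k))"

lemma central_binomial_step:
  "Suc k * ((2 * Suc k) choose (Suc k)) = 2 * (2 * k + 1) * ((2 * k) choose k)"
proof -
  have a: "Suc k * (Suc (Suc (2*k)) choose Suc k) = Suc (Suc (2*k)) * (Suc (2*k) choose k)"
    by (rule Suc_times_binomial)
  have b: "Suc (2*k) choose k = Suc (2*k) choose (Suc k)"
    by (subst binomial_symmetric) auto
  have c: "Suc k * (Suc (2*k) choose Suc k) = Suc (2*k) * ((2*k) choose k)"
    by (rule Suc_times_binomial)
  have "Suc k * (Suc k * (Suc (Suc (2*k)) choose Suc k)) = Suc (Suc (2*k)) * (Suc k * (Suc (2*k) choose Suc k))"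
    using a b by (metis mult.left_commute)
  also have "\<dots> = Suc k * (2 * (2 * k + 1) * ((2 * k) choose k))"
    unfolding c by (simp add: algebra_simps)
  finally have "Suc k * (Suc (Suc (2*k)) choose Suc k) = 2 * (2 * k + 1) * ((2 * k) choose k)"
    unfolding mult_left_cancel[OF zero_less_Suc[THEN neq0_conv[THEN iffD2]]] by simp
  thus ?thesis by (simp del: binomial_Suc_Suc)
qed

lemma binomial_step_right:
  "Suc k * (n choose Suc k) = (n - k) * (n choose k)"
  by (metis binomial_absorb_comp binomial_absorption)

lemma binomial_pair_step:
  "(2 * k + 1) * (2 * k + 2) * ((n + Suc k) choose (2 * Suc k)) = (n + k + 1) * (n - k) * ((n + k) choose (2 * k))"
proof -
  have a: "Suc (2*k+1) * (Suc (n+k) choose Suc (2*k+1)) = Suc (n+k) * ((n+k) choose (2*k+1))"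
    by (rule Suc_times_binomial)
  have b: "Suc (2*k) * ((n+k) choose Suc (2*k)) = (n - k) * ((n+k) choose (2*k))"
    using binomial_step_right[of "2*k" "n+k"] by (simp del: binomial_Suc_Suc)
  have "(2 * k + 1) * (2 * k + 2) * ((n + Suc k) choose (2 * Suc k))
      = (2 * k + 1) * (Suc (2*k+1) * (Suc (n+k) choose Suc (2*k+1)))"
  proof -
    have "n + Suc k = Suc (n + k)" "2 * Suc k = Suc (2 * k + 1)" "2 * k + 2 = Suc (2 * k + 1)" by simp_all
    thus ?thesis by (simp only: mult.assoc)
  qed
  also have "\<dots> = Suc (n+k) * (Suc (2*k) * ((n+k) choose Suc (2*k)))"
    unfolding a by (simp only: Suc_eq_plus1 mult.left_commute)
  also have "\<dots> = (n + k + 1) * (n - k) * ((n + k) choose (2 * k))"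
    unfolding b by (simp only: Suc_eq_plus1 mult.assoc)
  finally show ?thesis .
qed

lemma binomial_upper_step2:
  "(N - n) * (N - 1 - n) * (N choose n) = N * (N - 1) * ((N - 2) choose n)"
proof -
  have 1: "(N - n) * (N choose n) = N * ((N - 1) choose n)" by (rule binomial_absorb_comp)
  have 2: "(N - 1 - n) * ((N - 1) choose n) = (N - 1) * ((N - 1 - 1) choose n)"
    by (rule binomial_absorb_comp)
  have "(N - 1 - n) * ((N - n) * (N choose n)) = N * ((N - 1 - n) * ((N - 1) choose n))"
    unfolding 1 by (simp add: mult_ac)
  thus ?thesis unfolding 2 by (simp add: mult_ac numeral_2_eq_2)
qed

definition X_sq_minus_1 :: "complex poly" where "X_sq_minus_1 = [:-1, 0, 1:]"

lemma clausen_coeff_step: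
  "of_nat (Suc k) ^ 3 * (of_nat ((2 * Suc k) choose (Suc k)) ^ 2 * of_nat ((n + Suc k) choose (2 * Suc k)) :: 'a::comm_ring_1)
   = 2 * (2 * of_nat k + 1) * (of_nat n * (of_nat n + 1) - of_nat k * (of_nat k + 1)) *
     (of_nat ((2 * k) choose k) ^ 2 * of_nat ((n + k) choose (2 * k)))"
proof (cases "k \<le> n")
  case True
  let ?C = "(2 * Suc k) choose (Suc k)" and ?c = "(2 * k) choose k"
  let ?D = "(n + Suc k) choose (2 * Suc k)" and ?d = "(n + k) choose (2 * k)"
  have C: "Suc k * ?C = 2 * (2 * k + 1) * ?c" by (rule central_binomial_step)
  have D: "(2 * k + 1) * (2 * k + 2) * ?D = (n + k + 1) * (n - k) * ?d" by (rule binomial_pair_step)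
  have aux: "a ^ 3 * (C ^ 2 * D) = 2 * u * E * (c ^ 2 * d)"
    if "a * C = 2 * u * c" and "u * (2 * a) * D = E * d" and "u > 0" for a C D u c d E :: nat
  proof -
    have "(2 * u) * (a ^ 3 * (C ^ 2 * D)) = (a * C) ^ 2 * (u * (2 * a) * D)"
      by (simp add: power2_eq_square power3_eq_cube)
    also have "\<dots> = (2 * u) * (2 * u * E * (c ^ 2 * d))"
      unfolding that by (simp add: power2_eq_square)
    finally show ?thesis using that(3) by (simp add: mult_ac)
  qed
  have *: "Suc k ^ 3 * (?C ^ 2 * ?D) = 2 * (2 * k + 1) * ((n + k + 1) * (n - k)) * (?c ^ 2 * ?d)"
  proof (rule aux)
    show "(2 * k + 1) * (2 * Suc k) * ?D = (n + k + 1) * (n - k) * ?d"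
      using D by (simp only: mult_Suc_right add.commute)
  qed (use C in simp_all)
  have "of_nat (Suc k) ^ 3 * (of_nat ?C ^ 2 * of_nat ?D :: 'a) = of_nat (Suc k ^ 3 * (?C ^ 2 * ?D))"
    by (simp only: of_nat_mult of_nat_power)
  also have "\<dots> = 2 * (2 * of_nat k + 1) * ((of_nat n + of_nat k + 1) * (of_nat n - of_nat k)) * (of_nat ?c ^ 2 * of_nat ?d)"
    unfolding * by (simp only: of_nat_mult of_nat_add of_nat_1 of_nat_numeral of_nat_power of_nat_diff[OF True])
  also have "(of_nat n + of_nat k + 1) * (of_nat n - of_nat k) = (of_nat n * (of_nat n + 1) - of_nat k * (of_nat k + 1) :: 'a)"
    by (simp add: algebra_simps)
  finally show ?thesis .
qed (simp add: binomial_eq_0 del: binomial_Suc_Suc)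

text \<open>
  The symmetric square of Legendre's equation \<open>((t^2 - 1) u')' = n (n + 1) u\<close>: it annihilates
  \<open>u^2\<close> for every solution \<open>u\<close>.
\<close>

definition clausen_op :: "nat \<Rightarrow> complex poly \<Rightarrow> complex poly" where
  "clausen_op n v = (let N = of_nat (n * (n + 1)) in
     pderiv (X_sq_minus_1 * (pderiv (X_sq_minus_1 * pderiv v) - 2 * N * v))
     - 2 * N * (X_sq_minus_1 * pderiv v))"

lemma clausen_op_add: "clausen_op n (u + v) = clausen_op n u + clausen_op n v"
  by (simp add: clausen_op_def Let_def pderiv_add algebra_simps pderiv_diff)

lemma clausen_op_smult: "clausen_op n (smult c v) = smult c (clausen_op n v)"
  unfolding clausen_op_def Let_def
  by (simp only: pderiv_smult mult_smult_right smult_diff_right[symmetric])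

lemma clausen_op_sum: "clausen_op n (sum f A) = (\<Sum>i\<in>A. clausen_op n (f i))"
proof (induction A rule: infinite_finite_induct)
  case (infinite A)
  then show ?case by (simp add: clausen_op_def)
next
  case empty
  then show ?case by (simp add: clausen_op_def)
next
  case (insert x F)
  then show ?case by (simp add: clausen_op_add)
qed

text \<open>
  With \<open>q = t^2 - 1\<close> and \<open>w = q u'\<close>, Legendre's equation reads \<open>w' = N u\<close>; hence \<open>q (u^2)' = 2 u w\<close>,
  and then \<open>(2 u w)' - 2 N u^2 = 2 u' w\<close>, which multiplied by \<open>q\<close> becomes \<open>2 w^2\<close>, whose derivative
  is \<open>4 N u w\<close> again.
\<close>

lemma clausen_op_square:
  assumes "pderiv (X_sq_minus_1 * pderiv u) = of_nat (n * (n + 1)) * u"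
  shows "clausen_op n (u * u) = 0"
proof -
  define N :: "complex poly" where "N = of_nat (n * (n + 1))"
  define w where "w = X_sq_minus_1 * pderiv u"
  have dw: "pderiv w = N * u" using assms by (simp add: w_def N_def)
  have dN: "pderiv N = 0" unfolding N_def by (rule pderiv_of_nat)
  have 1: "X_sq_minus_1 * pderiv (u * u) = 2 * (u * w)"
    by (simp add: pderiv_mult w_def algebra_simps)
  have d2: "pderiv (2 * f) = 2 * pderiv f" for f :: "complex poly"
    by (simp only: mult_2 pderiv_add)
  have 2: "pderiv (2 * (u * w)) - 2 * N * (u * u) = 2 * (pderiv u * w)"
    by (simp only: d2 pderiv_mult dw) (simp add: algebra_simps)
  have 3: "X_sq_minus_1 * (2 * (pderiv u * w)) = 2 * (w * w)"
    unfolding w_def by (simp only: mult_ac)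
  show ?thesis
    unfolding clausen_op_def Let_def N_def[symmetric] 1 2 3
    by (simp only: d2 pderiv_mult dw) (simp add: algebra_simps)
qed

lemma coeff_X_sq_minus_1_mult:
  "coeff (X_sq_minus_1 * f) (Suc (Suc i)) = coeff f i - coeff f (Suc (Suc i))"
  by (simp add: X_sq_minus_1_def coeff_pCons split: nat.splits)

lemma two_of_nat_mult_poly: "2 * of_nat j * v = smult (2 * of_nat j) v" for v :: "complex poly"
  by (simp add: of_nat_poly numeral_poly mult.commute)

text \<open>
  At the top degree \<open>d\<close> the operator multiplies the leading coefficient by
  \<open>(d + 1) (d - 2 n) (d + 2 n + 2)\<close>.  So a polynomial solution is determined by its coefficient
  at \<open>t^(2n)\<close>, which is how the two sides of Clausen's identity get compared.
\<close>

lemma clausen_op_lead: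
  assumes "clausen_op n v = 0" and "v \<noteq> 0"
  shows "degree v = 2 * n"
proof -
  define N :: complex where "N = of_nat (n * (n + 1))"
  let ?d = "degree v"
  have z: "coeff v i = 0" if "i > ?d" for i using that by (rule coeff_eq_0)
  have qv: "coeff (X_sq_minus_1 * pderiv v) (Suc i) = of_nat i * coeff v i - of_nat (i + 2) * coeff v (i + 2)" for i
    by (cases i) (simp_all add: X_sq_minus_1_def coeff_pderiv coeff_pCons split: nat.splits)
  define x where "x = pderiv (X_sq_minus_1 * pderiv v) - 2 * of_nat (n * (n + 1)) * v"
  have x2: "x = pderiv (X_sq_minus_1 * pderiv v) - smult (2 * N) v"
    unfolding x_def N_def two_of_nat_mult_poly ..
  have xi: "coeff x i = of_nat (i + 1) * (of_nat i * coeff v i - of_nat (i + 2) * coeff v (i + 2)) - 2 * N * coeff v i" for i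
    unfolding x2 coeff_diff coeff_pderiv coeff_smult Suc_eq_plus1[symmetric] qv by simp
  have "coeff (clausen_op n v) (Suc ?d) =
     of_nat (?d + 2) * (coeff x ?d - coeff x (Suc (Suc ?d))) - 2 * N * coeff (X_sq_minus_1 * pderiv v) (Suc ?d)"
  proof -
    have "clausen_op n v = pderiv (X_sq_minus_1 * x) - smult (2 * N) (X_sq_minus_1 * pderiv v)"
      unfolding clausen_op_def Let_def x_def N_def two_of_nat_mult_poly ..
    note eq = this
    show ?thesis unfolding eq coeff_diff coeff_pderiv coeff_smult by (simp add: coeff_X_sq_minus_1_mult)
  qed
  also have "\<dots> = of_nat (?d + 2) * (of_nat (?d + 1) * of_nat ?d - 2 * N) * coeff v ?d - 2 * N * of_nat ?d * coeff v ?d"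
    by (simp add: xi qv z algebra_simps)
  also have "\<dots> = coeff v ?d * (of_nat (?d + 1) * ((of_nat ?d - of_nat (2 * n)) * of_nat (?d + 2 * n + 2)))"
    by (simp add: N_def algebra_simps)
  finally have "coeff v ?d * (of_nat (?d + 1) * ((of_nat ?d - of_nat (2 * n)) * of_nat (?d + 2 * n + 2))) = 0"
    using assms by simp
  moreover have "coeff v ?d \<noteq> 0" using assms by simp
  moreover have "(of_nat (?d + 1) :: complex) \<noteq> 0" "(of_nat (?d + 2 * n + 2) :: complex) \<noteq> 0"
    by (simp_all only: of_nat_eq_0_iff)
  ultimately have "(of_nat ?d :: complex) = of_nat (2 * n)" by simp
  thus ?thesis by (simp only: of_nat_eq_iff)
qed

text \<open>
  A monomial \<open>c t^j\<close> contributes \<open>c (j (j + 1) - n (n + 1)) t^j - c j (j - 1) t^(j - 2)\<close>, and the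
  coefficients of the Legendre polynomial make these contributions telescope.
\<close>

lemma legendre_poly_ode:
  "pderiv (X_sq_minus_1 * pderiv (legendre_poly n)) = of_nat (n * (n + 1)) * legendre_poly n"
proof -
  define e :: "nat \<Rightarrow> complex" where
    "e k = (-1) ^ k * of_nat (n choose k) * of_nat ((2 * n - 2 * k) choose n)" for k
  define L where "L f = pderiv (X_sq_minus_1 * pderiv f) - smult (of_nat (n * (n + 1))) f" for f
  have L_add: "L (f + g) = L f + L g" for f g
    by (simp add: L_def pderiv_add smult_add_right distrib_left)
  have L_sum: "L (sum f A) = (\<Sum>i\<in>A. L (f i))" if "finite A" for f and A :: "nat set"
    using that by (induction A) (simp_all add: L_add, simp add: L_def)
  have L_monom: "L (monom c j) = monom (c * (of_nat j * (of_nat j + 1) - of_nat (n * (n + 1)))) j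
      - monom (c * of_nat j * of_nat (j - 1)) (j - 2)" for c :: complex and j
  proof (rule poly_eqI)
    fix i
    have q: "coeff (X_sq_minus_1 * f) i = (if i < 2 then 0 else coeff f (i - 2)) - coeff f i" for f :: "complex poly" and i
      by (cases i; cases "i - 1") (auto simp: X_sq_minus_1_def coeff_pCons split: nat.splits)
    show "coeff (L (monom c j)) i = coeff (monom (c * (of_nat j * (of_nat j + 1) - of_nat (n * (n + 1)))) j
      - monom (c * of_nat j * of_nat (j - 1)) (j - 2)) i"
      unfolding L_def coeff_diff coeff_pderiv q coeff_smult
      by (cases j; cases "j - 1") (auto simp: coeff_monom algebra_simps coeff_pderiv)
  qed
  define h where "h = n div 2"
  define b where "b k = e k * (of_nat (n - 2 * k) * (of_nat (n - 2 * k) + 1) - of_nat (n * (n + 1)))" for k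
  have b0: "b 0 = 0" by (simp add: b_def algebra_simps)
  have bs: "e k * of_nat (n - 2 * k) * of_nat (n - 2 * k - 1) = b (Suc k)" if k: "k < h" for k
  proof -
    have le: "2 * k + 2 \<le> n" using k by (simp add: h_def)
    let ?N = "2 * n - 2 * k"
    have 1: "Suc k * (n choose Suc k) = (n - k) * (n choose k)" by (rule binomial_step_right)
    have 2: "(n - 2 * k) * (n - 2 * k - 1) * (?N choose n) = ?N * (?N - 1) * ((?N - 2) choose n)"
      using binomial_upper_step2[of ?N n] le by (simp add: algebra_simps)
    define a where "a = ?N - 1"
    have N: "?N = 2 * (n - k)" by simp
    have aux: "u * (X * (2 * u * a * Z)) = u * ((2 * s * a) * (X' * Z))" if "s * X' = u * X" for u X Z s X' :: nat
    proof -
      have "u * (X * (2 * u * a * Z)) = 2 * u * a * Z * (u * X)" by (simp only: mult_ac)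
      thus ?thesis unfolding that[symmetric] by (simp only: mult_ac)
    qed
    have "(n - k) * ((n choose k) * ((n - 2 * k) * (n - 2 * k - 1) * (?N choose n)))
        = (n - k) * (((2 * Suc k) * a) * ((n choose Suc k) * ((?N - 2) choose n)))"
      unfolding 2 a_def[symmetric] unfolding N by (rule aux[OF 1])
    hence 3: "(n choose k) * ((n - 2 * k) * (n - 2 * k - 1) * (?N choose n))
       = ((2 * Suc k) * a) * ((n choose Suc k) * ((?N - 2) choose n))"
      using le by simp
    have 4: "of_nat (n choose k) * (of_nat (n - 2 * k) * of_nat (n - 2 * k - 1) * of_nat (?N choose n)) 
       = of_nat (2 * Suc k) * of_nat a * (of_nat (n choose Suc k) * of_nat ((?N - 2) choose n) :: complex)"
      using arg_cong[OF 3, of "of_nat :: nat \<Rightarrow> complex"] by (simp only: of_nat_mult)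
    have ne: "n - 2 * Suc k = n - 2 * k - 2" "2 * n - 2 * Suc k = ?N - 2" by auto
    have 5: "of_nat (n - 2 * Suc k) * (of_nat (n - 2 * Suc k) + 1) - of_nat (n * (n + 1)) = - (of_nat (2 * Suc k) * of_nat a :: complex)"
      using le unfolding a_def by (simp add: of_nat_diff algebra_simps)
    have "e k * of_nat (n - 2 * k) * of_nat (n - 2 * k - 1) = (-1)^k * (of_nat (n choose k) * (of_nat (n - 2 * k) * of_nat (n - 2 * k - 1) * of_nat (?N choose n)))"
      by (simp only: e_def mult_ac)
    also have "\<dots> = b (Suc k)"
      unfolding 4 b_def 5 e_def unfolding ne by (simp del: of_nat_Suc binomial_Suc_Suc)
    finally show ?thesis .
  qed
  have be: "e h * of_nat (n - 2 * h) * of_nat (n - 2 * h - 1) = 0"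
  proof -
    have "n - 2 * h = 0 \<or> n - 2 * h = 1" unfolding h_def by presburger
    thus ?thesis by auto
  qed
  have "L (legendre_poly n) = (\<Sum>k\<le>h. L (monom (e k) (n - 2 * k)))"
    unfolding legendre_poly_def h_def e_def by (rule L_sum) simp
  also have "\<dots> = (\<Sum>k\<le>h. monom (b k) (n - 2 * k)) - (\<Sum>k\<le>h. monom (e k * of_nat (n - 2 * k) * of_nat (n - 2 * k - 1)) (n - 2 * k - 2))"
    unfolding L_monom b_def by (rule sum_subtractf)
  also have "(\<Sum>k\<le>h. monom (e k * of_nat (n - 2 * k) * of_nat (n - 2 * k - 1)) (n - 2 * k - 2))
      = (\<Sum>k<h. monom (e k * of_nat (n - 2 * k) * of_nat (n - 2 * k - 1)) (n - 2 * k - 2))"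
    unfolding lessThan_Suc_atMost[symmetric] sum.lessThan_Suc be by simp
  also have "\<dots> = (\<Sum>k<h. monom (b (Suc k)) (n - 2 * Suc k))"
    by (rule sum.cong[OF refl]) (simp only: lessThan_iff bs, simp)
  also have "(\<Sum>k\<le>h. monom (b k) (n - 2 * k)) = (\<Sum>k<h. monom (b (Suc k)) (n - 2 * Suc k))"
    unfolding sum.atMost_shift b0 by simp
  finally have "L (legendre_poly n) = 0" by simp
  thus ?thesis by (simp add: L_def of_nat_poly)
qed

text \<open>
  The operator maps powers of \<open>q = t^2 - 1\<close> to \<open>2 t\<close> times a combination of two neighbouring powers of \<open>q\<close>,
  so that on a polynomial in \<open>q\<close> it amounts to a first order recurrence for the coefficients.
\<close>

lemma clausen_op_power:
  "clausen_op n (X_sq_minus_1 ^ k) = smult 2 (pCons 0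
     (smult ((2 * of_nat k + 1) * (2 * of_nat k * (of_nat k + 1) - 2 * of_nat (n * (n + 1)))) (X_sq_minus_1 ^ k)
      + smult (4 * of_nat k ^ 3) (X_sq_minus_1 ^ (k - 1))))"
proof -
  define q where "q = X_sq_minus_1"
  define N :: complex where "N = of_nat (n * (n + 1))"
  define t :: "complex poly" where "t = [:0, 1:]"
  have dq: "pderiv q = smult 2 t" by (simp add: q_def X_sq_minus_1_def t_def pderiv_pCons)
  have dt: "pderiv t = 1" by (simp add: t_def pderiv_pCons)
  have tt: "t * t = q + 1" by (simp add: t_def q_def X_sq_minus_1_def one_pCons)
  have dpow: "pderiv (q ^ Suc j) = smult (2 * of_nat (Suc j)) (q ^ j * t)" for j
    by (simp only: pderiv_power_Suc dq mult_smult_right smult_smult mult_ac)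
  show ?thesis
  proof (cases k)
    case 0
    have "clausen_op n 1 = smult (-2 * N) (pderiv q)"
      unfolding clausen_op_def Let_def two_of_nat_mult_poly N_def[symmetric] q_def[symmetric]
      by (simp add: pderiv_smult pderiv_minus)
    thus ?thesis using 0 by (simp add: dq t_def N_def)
  next
    case (Suc j)
    have ttq: "q ^ i * t * t = q ^ Suc i + q ^ i" for i
      by (simp only: mult.assoc tt) (simp add: algebra_simps)
    let ?k = "of_nat k :: complex"
    have 1: "q * pderiv (q ^ k) = smult (2 * ?k) (q ^ k * t)"
      unfolding Suc dpow by (simp only: mult_smult_right power_Suc mult_ac)
    have key: "t * (q ^ j * t) = q ^ k + q ^ j"
      using ttq[of j] by (simp only: Suc mult_ac)
    have 2: "pderiv (q ^ k * t) = smult (2 * ?k + 1) (q ^ k) + smult (2 * ?k) (q ^ j)"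
    proof -
      have "pderiv (q ^ k * t) = q ^ k + t * smult (2 * ?k) (q ^ j * t)"
        unfolding pderiv_mult dt by (simp only: dpow Suc mult_1_right)
      also have "\<dots> = q ^ k + smult (2 * ?k) (q ^ k + q ^ j)"
        by (simp only: mult_smult_right key)
      finally show ?thesis by (simp add: smult_add_left smult_add_right)
    qed
    have 3: "pderiv (q ^ Suc i) = smult (2 * (of_nat i + 1)) (q ^ i * t)" for i
      unfolding dpow by (simp add: algebra_simps)
    have aux: "q * (smult K (smult (K + 1) Qk + smult K Qj) - smult M Qk) = smult (K * (K + 1) - M) (q * Qk) + smult (K * K) Qk"
      if "q * Qj = Qk" for Qj Qk K M
      by (simp add: smult_add_right smult_diff_left right_diff_distrib distrib_left that)
    have A: "q * (pderiv (q * pderiv (q ^ k)) - smult (2 * N) (q ^ k)) =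
        smult (2 * ?k * (2 * ?k + 1) - 2 * N) (q ^ Suc k) + smult (2 * ?k * (2 * ?k)) (q ^ k)"
      unfolding 1 pderiv_smult 2 power_Suc[of q k] by (rule aux) (simp add: Suc)
    have "clausen_op n (q ^ k) = pderiv (q * (pderiv (q * pderiv (q ^ k)) - smult (2 * N) (q ^ k))) - smult (2 * N) (q * pderiv (q ^ k))"
      unfolding clausen_op_def Let_def q_def N_def two_of_nat_mult_poly ..
    also have "\<dots> = smult ((2 * ?k * (2 * ?k + 1) - 2 * N) * (2 * (?k + 1)) - 2 * N * (2 * ?k)) (q ^ k * t)
         + smult (2 * ?k * (2 * ?k) * (2 * ?k)) (q ^ j * t)"
    proof -
      have dqk: "pderiv (q ^ k) = smult (2 * ?k) (q ^ j * t)" by (simp only: dpow Suc)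
      show ?thesis unfolding A unfolding 1 unfolding pderiv_add pderiv_smult 3 dqk smult_smult
        by (simp only: smult_diff_left diff_add_eq)
    qed
    also have "(2 * ?k * (2 * ?k + 1) - 2 * N) * (2 * (?k + 1)) - 2 * N * (2 * ?k) = 2 * ((2 * ?k + 1) * (2 * ?k * (?k + 1) - 2 * N))"
      by (simp add: algebra_simps)
    also have "2 * ?k * (2 * ?k) * (2 * ?k) = 2 * (4 * ?k ^ 3)" by (simp add: power3_eq_cube)
    finally show ?thesis unfolding q_def[symmetric] N_def[symmetric]
      by (simp add: t_def Suc smult_add_right)
  qed
qed

text \<open>
  The sum \<open>F_n(y)\<close> at \<open>y = (t^2 - 1) / 4\<close>, as a polynomial in \<open>t\<close>.
\<close>

definition clausen_poly :: "nat \<Rightarrow> complex poly" where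
  "clausen_poly n = (\<Sum>k\<le>n. smult (of_nat ((2 * k) choose k) ^ 2 * of_nat ((n + k) choose (2 * k)) / 4 ^ k) (X_sq_minus_1 ^ k))"

lemma clausen_op_clausen_poly: "clausen_op n (clausen_poly n) = 0"
proof -
  define c :: "nat \<Rightarrow> complex" where "c k = of_nat ((2 * k) choose k) ^ 2 * of_nat ((n + k) choose (2 * k))" for k
  define b where "b k = c k / 4 ^ k * (4 * of_nat k ^ 3)" for k
  have bs: "c k / 4 ^ k * ((2 * of_nat k + 1) * (2 * of_nat k * (of_nat k + 1) - 2 * of_nat (n * (n + 1)))) = - b (Suc k)" for k
  proof -
    have "b (Suc k) = (of_nat (Suc k) ^ 3 * c (Suc k)) / 4 ^ k"
      by (simp add: b_def field_simps del: of_nat_Suc)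
    also have "of_nat (Suc k) ^ 3 * c (Suc k) = 2 * (2 * of_nat k + 1) * (of_nat n * (of_nat n + 1) - of_nat k * (of_nat k + 1)) * c k"
      unfolding c_def by (rule clausen_coeff_step)
    finally show ?thesis by (simp add: field_simps)
  qed
  have b_end: "b (Suc n) = 0" by (simp add: b_def c_def del: binomial_Suc_Suc)
  have "clausen_op n (clausen_poly n) = (\<Sum>k\<le>n. smult (c k / 4 ^ k) (clausen_op n (X_sq_minus_1 ^ k)))"
    unfolding clausen_poly_def clausen_op_sum clausen_op_smult c_def ..
  also have "\<dots> = (\<Sum>k\<le>n. smult 2 (pCons 0 (smult (b k) (X_sq_minus_1 ^ (k - 1)) - smult (b (Suc k)) (X_sq_minus_1 ^ k))))"
  proof (rule sum.cong[OF refl])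
    fix k
    have "smult (c k / 4 ^ k) (clausen_op n (X_sq_minus_1 ^ k)) = smult 2 (pCons 0 
      (smult (c k / 4 ^ k * ((2 * of_nat k + 1) * (2 * of_nat k * (of_nat k + 1) - 2 * of_nat (n * (n + 1))))) (X_sq_minus_1 ^ k) +
       smult (b k) (X_sq_minus_1 ^ (k - 1))))"
      unfolding clausen_op_power b_def by (simp add: smult_add_right mult_ac)
    thus "smult (c k / 4 ^ k) (clausen_op n (X_sq_minus_1 ^ k)) = smult 2 (pCons 0 (smult (b k) (X_sq_minus_1 ^ (k - 1)) - smult (b (Suc k)) (X_sq_minus_1 ^ k)))"
      unfolding bs by simp
  qed
  also have "\<dots> = smult 2 (pCons 0 (\<Sum>k\<le>n. smult (b k) (X_sq_minus_1 ^ (k - 1)) - smult (b (Suc k)) (X_sq_minus_1 ^ k)))"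
  proof -
    have "pCons 0 (u + v) = pCons 0 u + pCons 0 v" for u v :: "complex poly" by simp
    note pcu = this
    have pc: "pCons 0 (sum f A) = (\<Sum>k\<in>A. pCons 0 (f k))" if "finite A" for f :: "nat \<Rightarrow> complex poly" and A
      using that by (induction rule: finite_induct) (simp, simp only: sum.insert not_False_eq_True pcu)
    have sm: "smult c (sum f A) = (\<Sum>k\<in>A. smult c (f k))" for c :: complex and f :: "nat \<Rightarrow> complex poly" and A
      by (induction A rule: infinite_finite_induct) (simp_all add: smult_add_right)
    show ?thesis by (simp only: pc[OF finite_atMost] sm)
  qed
  also have "(\<Sum>k\<le>n. smult (b k) (X_sq_minus_1 ^ (k - 1)) - smult (b (Suc k)) (X_sq_minus_1 ^ k)) = 0"
  proof -
    have "(\<Sum>k\<le>m. smult (b k) (X_sq_minus_1 ^ (k - 1)) - smult (b (Suc k)) (X_sq_minus_1 ^ k)) = - smult (b (Suc m)) (X_sq_minus_1 ^ m)" for m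
    proof (induction m)
      case (Suc m)
      thus ?case by (simp only: sum.atMost_Suc diff_Suc_1) simp
    qed (simp add: b_def)
    note eq = this
    show ?thesis unfolding eq b_end by simp
  qed
  finally show ?thesis by simp
qed


text \<open>
  Both sides are annihilated by the operator and have the same coefficient at \<open>t^(2n)\<close>.
\<close>

lemma legendre_poly_square: "legendre_poly n * legendre_poly n = smult (4 ^ n) (clausen_poly n)"
proof (rule ccontr)
  assume neq: "\<not> ?thesis"
  define d where "d = legendre_poly n * legendre_poly n + smult (- (4 ^ n)) (clausen_poly n)"
  have "clausen_op n d = 0"
    unfolding d_def clausen_op_add clausen_op_smult clausen_op_clausen_poly
    by (simp add: clausen_op_square[OF legendre_poly_ode])
  moreover have d0: "d \<noteq> 0" using neq by (simp add: d_def)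
  ultimately have deg: "degree d = 2 * n" by (rule clausen_op_lead)
  have degP: "degree (legendre_poly n) \<le> n"
    unfolding legendre_poly_def by (rule degree_sum_le) (auto intro: order.trans[OF degree_monom_le])
  have cP: "coeff (legendre_poly n) n = of_nat ((2 * n) choose n)"
  proof -
    have "coeff (legendre_poly n) n = (\<Sum>k\<le>n div 2. if k = 0 then of_nat ((2 * n) choose n) else 0)"
      unfolding legendre_poly_def coeff_sum by (rule sum.cong) auto
    thus ?thesis by simp
  qed
  have degq: "degree (X_sq_minus_1 ^ k) \<le> 2 * k" for k
    by (rule order.trans[OF degree_power_le]) (simp add: X_sq_minus_1_def)
  have "degree (legendre_poly n) = n"
    using degP le_degree[of "legendre_poly n" n] cP by simp
  hence "coeff (legendre_poly n * legendre_poly n) (n + n) = coeff (legendre_poly n) n * coeff (legendre_poly n) n"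
    using coeff_mult_degree_sum[of "legendre_poly n" "legendre_poly n"] by simp
  moreover have "coeff (X_sq_minus_1 ^ k) (2 * k) = 1" for k
  proof (induction k)
    case (Suc k)
    have z: "coeff (X_sq_minus_1 ^ k) (Suc (Suc (2 * k))) = 0"
      using degq[of k] by (intro coeff_eq_0) simp
    show ?case by (simp add: coeff_X_sq_minus_1_mult z Suc)
  qed simp
  hence "coeff (clausen_poly n) (2 * n) = of_nat ((2 * n) choose n) ^ 2 / 4 ^ n"
  proof -
    assume lc: "\<And>k. coeff (X_sq_minus_1 ^ k) (2 * k) = 1"
    have "coeff (X_sq_minus_1 ^ k) (2 * n) = (if k = n then 1 else 0)" if "k \<le> n" for k
      using that lc degq[of k] by (auto intro!: coeff_eq_0)
    hence "coeff (clausen_poly n) (2 * n) = (\<Sum>k\<le>n. if k = n then of_nat ((2 * n) choose n) ^ 2 / 4 ^ n else 0)"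
      unfolding clausen_poly_def coeff_sum by (intro sum.cong) (auto simp: mult_2)
    thus ?thesis by simp
  qed
  ultimately have "coeff d (2 * n) = 0"
    by (simp add: d_def cP power2_eq_square mult_2)
  thus False using d0 deg leading_coeff_0_iff[of d] by simp
qed

text \<open>
  Evaluation at \<open>t = sqrt s\<close>; over the complex numbers the square root always exists, and it only
  enters through its parity.
\<close>

lemma clausen_sum_eq_square_complex:
  fixes y s :: complex
  assumes s: "s = 1 + 4 * y"
  shows "4 ^ n * clausen_sum n y = s ^ (n mod 2) * legendre_even_part n s ^ 2"
proof -
  define t where "t = csqrt s"
  have t2: "t ^ 2 = s" by (simp add: t_def)
  have "poly (legendre_poly n) t = t ^ (n mod 2) * legendre_even_part n s"
  proof -
    have e: "n - 2 * k = n mod 2 + 2 * (n div 2 - k)" if "k \<le> n div 2" for k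
      using that by presburger
    show ?thesis unfolding legendre_poly_def legendre_even_part_def poly_sum poly_monom sum_distrib_left
      by (rule sum.cong[OF refl]) (simp add: e power_add power_mult t2 mult.left_commute)
  qed
  hence "poly (legendre_poly n * legendre_poly n) t = s ^ (n mod 2) * legendre_even_part n s ^ 2"
  proof -
    assume P: "poly (legendre_poly n) t = t ^ (n mod 2) * legendre_even_part n s"
    have "(t ^ (n mod 2)) ^ 2 = s ^ (n mod 2)"
      unfolding t2[symmetric] by (simp only: power_mult[symmetric] mult.commute)
    thus ?thesis unfolding poly_mult P by (simp only: power2_eq_square mult_ac)
  qed
  moreover have "poly (clausen_poly n) t = clausen_sum n y"
  proof -
    have "poly X_sq_minus_1 t = 4 * y"
      using t2 s by (simp add: X_sq_minus_1_def power2_eq_square algebra_simps)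
    thus ?thesis by (simp add: clausen_poly_def clausen_sum_def poly_sum power_mult_distrib mult.assoc)
  qed
  ultimately show ?thesis by (simp add: legendre_poly_square)
qed

lemma clausen_sum_eq_square:
  fixes y :: rat
  shows "4 ^ n * clausen_sum n y = (1 + 4 * y) ^ (n mod 2) * legendre_even_part n (1 + 4 * y) ^ 2"
proof -
  have c: "of_rat (clausen_sum n y) = (clausen_sum n (of_rat y) :: complex)"
    by (simp add: clausen_sum_def of_rat_sum of_rat_mult of_rat_power)
  have l: "of_rat (legendre_even_part n y) = (legendre_even_part n (of_rat y) :: complex)" for y
    by (simp add: legendre_even_part_def of_rat_sum of_rat_mult of_rat_power of_rat_minus)
  have "(of_rat (4 ^ n * clausen_sum n y) :: complex) = of_rat ((1 + 4 * y) ^ (n mod 2) * legendre_even_part n (1 + 4 * y) ^ 2)"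
    unfolding of_rat_mult of_rat_power c l
    using clausen_sum_eq_square_complex[of "of_rat (1 + 4 * y)" "of_rat y" n]
    by (simp add: of_rat_add of_rat_mult)
  thus ?thesis by (simp only: of_rat_eq_iff)
qed

section \<open>Rationals with denominator prime to p\<close>

definition p_integral :: "nat \<Rightarrow> rat \<Rightarrow> bool" where
  "p_integral p r \<longleftrightarrow> coprime (snd (quotient_of r)) (int p)"

locale odd_prime =
  fixes p :: nat
  assumes prime_p: "prime p" and odd_p: "odd p"
begin

text \<open>
  The exponent in Euler's criterion; modulo \<open>p\<close> it stands for \<open>-1/2\<close>.
\<close>

definition m :: nat where "m = (p - 1) div 2"

abbreviation integral :: "rat \<Rightarrow> bool" where "integral \<equiv> p_integral p"
abbreviation qcong :: "nat \<Rightarrow> rat \<Rightarrow> rat \<Rightarrow> bool" where "qcong \<equiv> rat_cong_prime_power p"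

lemma p_eq: "p = 2 * m + 1" using odd_p by (auto simp: m_def elim: oddE)
lemma int_p_eq: "int p = 2 * int m + 1" using p_eq by linarith
lemma p_pos: "p > 0" using prime_p by (simp add: prime_gt_0_nat)
lemma p_gt_2: "p > 2" using prime_p odd_p by (metis even_numeral le_neq_implies_less prime_ge_2_nat)
lemma m_pos: "m > 0" using p_gt_2 p_eq by linarith
lemma prime_int_p: "prime (int p)" using prime_p by simp

lemma not_dvd_small: "0 < k \<Longrightarrow> k < p \<Longrightarrow> \<not> int p dvd int k"
  by (auto simp: int_dvd_int_iff dest: dvd_imp_le)

lemma coprime_int_p: "\<not> int p dvd a \<Longrightarrow> coprime a (int p)"
  using prime_int_p by (metis coprime_commute prime_imp_coprime_int)

lemma not_dvd_two: "\<not> int p dvd 2"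
  using not_dvd_small[of 2] p_gt_2 by simp

lemma not_dvd_two_power: "\<not> int p dvd 2 ^ k"
  using not_dvd_two prime_int_p by (metis prime_dvd_power)

lemma not_dvd_three:
  assumes "p \<noteq> 3"
  shows "\<not> int p dvd 3"
proof
  assume "int p dvd 3"
  hence "p \<le> 3" by (auto dest: zdvd_imp_le)
  thus False using assms p_gt_2 by simp
qed

lemma not_dvd_four: "\<not> int p dvd 4"
  using not_dvd_two_power[of 2] by simp

lemma cong_cancel:
  assumes "[u * a = u * b] (mod int p ^ r)" and "\<not> int p dvd u"
  shows "[a = b] (mod int p ^ r)"
  using assms coprime_int_p[of u] by (metis cong_mult_lcancel coprime_power_right_iff)

lemma cong_cancel1:
  assumes "[u * a = u * b] (mod int p)" and "\<not> int p dvd u"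
  shows "[a = b] (mod int p)"
  using cong_cancel[of u a b 1] assms by simp

lemma p_integral_iff: "integral r \<longleftrightarrow> (\<exists>a b. \<not> int p dvd b \<and> r = of_int a / of_int b)"
proof
  assume r: "integral r"
  obtain a b where ab: "quotient_of r = (a, b)" by force
  have "r = of_int a / of_int b" using quotient_of_div[OF ab] .
  moreover have "\<not> int p dvd b"
  proof
    assume "int p dvd b"
    moreover have "coprime b (int p)" using r ab by (simp add: p_integral_def)
    ultimately have "is_unit (int p)" using coprime_absorb_right[of "int p" b] by simp
    thus False using p_gt_2 by simp
  qed
  ultimately show "\<exists>a b. \<not> int p dvd b \<and> r = of_int a / of_int b" by blast
next
  assume "\<exists>a b. \<not> int p dvd b \<and> r = of_int a / of_int b"
  then obtain a b where ab: "\<not> int p dvd b" "r = of_int a / of_int b" by blast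
  obtain c d where cd: "quotient_of r = (c, d)" by force
  have d: "d > 0" and co: "coprime c d" using cd quotient_of_denom_pos quotient_of_coprime by blast+
  have "b \<noteq> 0" using ab by auto
  have "of_int a / of_int b = (of_int c / of_int d :: rat)" using quotient_of_div[OF cd] ab by simp
  hence "a * d = c * b" using d \<open>b \<noteq> 0\<close> by (simp add: frac_eq_eq flip: of_int_mult)
  hence "d dvd b" using co by (metis coprime_commute coprime_dvd_mult_right_iff dvd_triv_right)
  hence "\<not> int p dvd d" using ab dvd_trans by blast
  thus "integral r" unfolding p_integral_def cd by (simp add: coprime_int_p)
qed

lemma integral_of_int [simp, intro]: "integral (of_int a)"
  unfolding p_integral_iff using p_gt_2 by (intro exI[of _ a] exI[of _ 1]) auto

lemma integral_of_nat [simp, intro]: "integral (of_nat a)"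
  using integral_of_int[of "int a"] by simp

lemma integral_0 [simp]: "integral 0" and integral_1 [simp]: "integral 1" and integral_numeral [simp]: "integral (numeral k)"
  using integral_of_int[of 0] integral_of_int[of 1] integral_of_int[of "numeral k"] by simp_all

lemma integral_add [intro]: "integral a \<Longrightarrow> integral b \<Longrightarrow> integral (a + b)"
proof -
  assume "integral a" "integral b"
  then obtain x y u v where *: "\<not> int p dvd y" "a = of_int x / of_int y" "\<not> int p dvd v" "b = of_int u / of_int v"
    unfolding p_integral_iff by blast
  hence "y \<noteq> 0" "v \<noteq> 0" by auto
  hence "a + b = of_int (x * v + u * y) / of_int (y * v)" using * by (simp add: field_simps)
  moreover have "\<not> int p dvd y * v" using * prime_int_p by (simp add: prime_dvd_mult_iff)
  ultimately show ?thesis unfolding p_integral_iff by blast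
qed

lemma integral_mult [intro]: "integral a \<Longrightarrow> integral b \<Longrightarrow> integral (a * b)"
proof -
  assume "integral a" "integral b"
  then obtain x y u v where *: "\<not> int p dvd y" "a = of_int x / of_int y" "\<not> int p dvd v" "b = of_int u / of_int v"
    unfolding p_integral_iff by blast
  hence "a * b = of_int (x * u) / of_int (y * v)" by simp
  moreover have "\<not> int p dvd y * v" using * prime_int_p by (simp add: prime_dvd_mult_iff)
  ultimately show ?thesis unfolding p_integral_iff by blast
qed

lemma integral_minus [intro]: "integral a \<Longrightarrow> integral (- a)"
  using integral_mult[OF integral_of_int[of "-1"], of a] by simp

lemma integral_power [intro]: "integral a \<Longrightarrow> integral (a ^ k)"
  by (induction k) auto

lemma integral_sum [intro]: "(\<And>i. i \<in> A \<Longrightarrow> integral (f i)) \<Longrightarrow> integral (sum f A)"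
  by (induction A rule: infinite_finite_induct) auto

lemma integral_divide:
  assumes "integral a" and "\<not> int p dvd b"
  shows "integral (a / of_int b)"
proof -
  have "integral (1 / of_int b)" unfolding p_integral_iff using assms(2) by (metis of_int_1)
  from integral_mult[OF assms(1) this] show ?thesis by simp
qed

lemma qcong_iff: "qcong r a b \<longleftrightarrow> (\<exists>t. integral t \<and> a - b = of_nat p ^ r * t)"
proof -
  have "(of_nat p :: rat) ^ r \<noteq> 0" using p_pos by simp
  thus ?thesis unfolding rat_cong_prime_power_def p_integral_def[symmetric]
    by (auto simp: field_simps)
qed

lemma qcong_refl [simp, intro]: "qcong r a a"
  unfolding qcong_iff by (intro exI[of _ 0]) simp

lemma qcong_sym: "qcong r a b \<Longrightarrow> qcong r b a"
  unfolding qcong_iff by (metis integral_minus minus_diff_eq mult_minus_right)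

lemma qcong_add: "qcong r a b \<Longrightarrow> qcong r c d \<Longrightarrow> qcong r (a + c) (b + d)"
  unfolding qcong_iff by (metis add_diff_add distrib_left integral_add)

lemma qcong_trans [trans]: "qcong r a b \<Longrightarrow> qcong r b c \<Longrightarrow> qcong r a c"
proof -
  assume "qcong r a b" "qcong r b c"
  from qcong_add[OF this] show ?thesis unfolding qcong_iff by (simp add: algebra_simps)
qed

lemma qcong_mult_left: "qcong r a b \<Longrightarrow> integral c \<Longrightarrow> qcong r (c * a) (c * b)"
  unfolding qcong_iff by (metis integral_mult mult.left_commute right_diff_distrib)

lemma qcong_mult: "qcong r a b \<Longrightarrow> qcong r c d \<Longrightarrow> integral b \<Longrightarrow> integral c \<Longrightarrow> qcong r (a * c) (b * d)"
  using qcong_trans[of r "a * c" "b * c" "b * d"] qcong_mult_left[of r a b c] qcong_mult_left[of r c d b]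
  by (simp add: mult.commute)

lemma qcong_sum: "(\<And>i. i \<in> A \<Longrightarrow> qcong r (f i) (g i)) \<Longrightarrow> qcong r (sum f A) (sum g A)"
  by (induction A rule: infinite_finite_induct) (auto intro: qcong_add)

lemma qcong_of_int_iff: "qcong r (of_int a) (of_int b) \<longleftrightarrow> [a = b] (mod int p ^ r)"
proof
  assume "qcong r (of_int a) (of_int b)"
  then obtain t where "integral t" and t: "of_int a - of_int b = of_nat p ^ r * t"
    unfolding qcong_iff by blast
  then obtain c d where cd: "\<not> int p dvd d" "t = of_int c / of_int d" unfolding p_integral_iff by blast
  hence "d \<noteq> 0" by auto
  hence "of_int ((a - b) * d) = (of_int (int p ^ r * c) :: rat)" using t cd by (simp add: field_simps)
  hence "(a - b) * d = int p ^ r * c" by (simp only: of_int_eq_iff)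
  hence "[d * (a - b) = d * 0] (mod int p ^ r)" by (simp add: cong_0_iff mult.commute)
  hence "[a - b = 0] (mod int p ^ r)" using cd cong_cancel by blast
  thus "[a = b] (mod int p ^ r)" by (simp add: cong_iff_dvd_diff cong_0_iff)
next
  assume "[a = b] (mod int p ^ r)"
  then obtain c where "a - b = int p ^ r * c" by (auto simp: cong_iff_dvd_diff)
  hence "of_int a - of_int b = (of_nat p ^ r * of_int c :: rat)" by (metis of_int_diff of_int_mult of_int_of_nat_eq of_int_power)
  thus "qcong r (of_int a) (of_int b)" unfolding qcong_iff by blast
qed

lemma qcong_cancel:
  assumes "qcong r (of_int u * a) (of_int u * b)" and u: "\<not> int p dvd u"
  shows "qcong r a b"
proof -
  obtain t where "integral t" "of_int u * a - of_int u * b = of_nat p ^ r * t"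
    using assms(1) unfolding qcong_iff by blast
  moreover have "u \<noteq> 0" using u by auto
  ultimately have "a - b = of_nat p ^ r * (t / of_int u)" by (simp add: field_simps)
  moreover have "integral (t / of_int u)" using \<open>integral t\<close> u by (rule integral_divide)
  ultimately show ?thesis unfolding qcong_iff by blast
qed

lemma qcong_2_imp_1: "qcong 2 a b \<Longrightarrow> qcong 1 a b"
  unfolding qcong_iff by (metis integral_mult integral_of_nat mult.assoc power2_eq_square power_one_right)

lemma qcong_square_0: "qcong 1 a 0 \<Longrightarrow> qcong 2 (a ^ 2) 0"
  unfolding qcong_iff by (auto simp: power_mult_distrib)

text \<open>
  Together with the preceding rule: a square that vanishes modulo \<open>p\<close> vanishes modulo \<open>p^2\<close>.
\<close>

lemma qcong_square_0D:
  assumes a: "integral a" and "qcong 1 (a ^ 2) 0"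
  shows "qcong 1 a 0"
proof -
  obtain c d where cd: "\<not> int p dvd d" "a = of_int c / of_int d" using a unfolding p_integral_iff by blast
  hence "d \<noteq> 0" by auto
  have "qcong 1 (of_int (d^2) * a ^ 2) (of_int (d^2) * 0)"
    using assms(2) by (rule qcong_mult_left) (rule integral_of_int)
  also have "of_int (d^2) * a ^ 2 = of_int (c ^ 2)" using cd \<open>d \<noteq> 0\<close> by (simp add: power_divide)
  finally have "qcong 1 (of_int (c^2)) (of_int 0)" by simp
  hence "[c ^ 2 = 0] (mod int p ^ 1)" by (simp only: qcong_of_int_iff)
  hence "int p dvd c" using prime_dvd_power[OF prime_int_p, of c 2] by (simp add: cong_0_iff)
  hence "qcong 1 (of_int c) (of_int 0)" by (simp only: qcong_of_int_iff cong_0_iff power_one_right)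
  hence "qcong 1 (of_int d * a) (of_int d * 0)" using cd \<open>d \<noteq> 0\<close> by simp
  thus ?thesis using cd qcong_cancel by blast
qed

section \<open>Binomial coefficients modulo p\<close>

lemma int_Suc_times_binomial:
  "int (Suc l) * int ((a + Suc l) choose Suc l) = (int a + int l + 1) * int ((a + l) choose l)"
proof -
  have "int (Suc l * (Suc (a + l) choose Suc l)) = int (Suc (a + l) * ((a + l) choose l))"
    by (simp only: Suc_times_binomial)
  thus ?thesis by (simp only: of_nat_mult add_Suc_right of_nat_Suc of_nat_add ac_simps)
qed

lemma int_binomial_step_right:
  "int (Suc l) * int (b choose Suc l) = (int b - int l) * int (b choose l)"
proof (cases "l \<le> b")
  case True
  have "int (Suc l * (b choose Suc l)) = int ((b - l) * (b choose l))"
    by (simp only: binomial_step_right)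
  thus ?thesis by (simp only: of_nat_mult of_nat_diff[OF True])
qed (simp add: binomial_eq_0)

text \<open>
  If \<open>a \<equiv> - b - 1\<close>, then \<open>C(a + l, l)\<close> agrees with \<open>C(l - b - 1, l) = (-1)^l C(b, l)\<close>.
  With \<open>a = b = m\<close> this expresses that \<open>m\<close> behaves like \<open>-1/2\<close>.
\<close>

lemma binomial_negate_cong:
  assumes "[int a + int b + 1 = 0] (mod int p)" and "l < p"
  shows "[int ((a + l) choose l) = (-1) ^ l * int (b choose l)] (mod int p)"
  using assms(2)
proof (induction l)
  case (Suc l)
  have 1: "int (Suc l) * int ((a + Suc l) choose Suc l) = (int a + int l + 1) * int ((a + l) choose l)"
    by (rule int_Suc_times_binomial)
  have 2: "int (Suc l) * int (b choose Suc l) = (int b - int l) * int (b choose l)"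
    by (rule int_binomial_step_right)
  have 3: "[int a + int l + 1 = - (int b - int l)] (mod int p)"
    using assms(1) by (simp add: cong_iff_dvd_diff algebra_simps)
  have "[int (Suc l) * int ((a + Suc l) choose Suc l) = int (Suc l) * ((-1) ^ Suc l * int (b choose Suc l))] (mod int p)"
  proof -
    have "[(int a + int l + 1) * int ((a + l) choose l) = - (int b - int l) * ((-1) ^ l * int (b choose l))] (mod int p)"
      by (rule cong_mult[OF 3 Suc.IH]) (use Suc.prems in simp)
    also have "- (int b - int l) * ((-1) ^ l * int (b choose l)) = (-1) ^ Suc l * (int (Suc l) * int (b choose Suc l))"
      unfolding 2 by (simp add: algebra_simps)
    finally show ?thesis unfolding 1 by (simp only: mult_ac)
  qed
  thus ?case by (rule cong_cancel1) (use Suc.prems not_dvd_small in blast)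
qed simp

lemma int_central_binomial_step:
  "int (Suc k) * int ((2 * Suc k) choose Suc k) = 2 * (2 * int k + 1) * int ((2 * k) choose k)"
proof -
  have "int (Suc k * ((2 * Suc k) choose Suc k)) = int (2 * (2 * k + 1) * ((2 * k) choose k))"
    by (simp only: central_binomial_step)
  thus ?thesis by (simp only: of_nat_mult of_nat_add of_nat_1 of_nat_numeral)
qed

lemma int_binomial_pair_step:
  "(2 * int k + 1) * (2 * int k + 2) * int ((n + Suc k) choose (2 * Suc k))
   = (int n + int k + 1) * (int n - int k) * int ((n + k) choose (2 * k))"
proof (cases "k \<le> n")
  case True
  have "int ((2 * k + 1) * (2 * k + 2) * ((n + Suc k) choose (2 * Suc k))) = int ((n + k + 1) * (n - k) * ((n + k) choose (2 * k)))"
    by (simp only: binomial_pair_step)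
  thus ?thesis by (simp only: of_nat_mult of_nat_add of_nat_1 of_nat_numeral of_nat_diff[OF True])
qed (simp add: binomial_eq_0 del: binomial_Suc_Suc)

text \<open>
  The rational identity \<open>C(2k,k) = (-4)^k C(-1/2,k)\<close>, with \<open>m \<equiv> -1/2\<close>.
\<close>

lemma central_binomial_cong:
  "[int ((2 * k) choose k) = (-4) ^ k * int (m choose k)] (mod int p)" if "k \<le> m"
  using that
proof (induction k)
  case (Suc k)
  have 3: "[2 * (2 * int k + 1) = -4 * (int m - int k)] (mod int p)"
  proof -
    have "2 * (2 * int k + 1) - (-4 * (int m - int k)) = int p * 2"
      using int_p_eq by simp
    thus ?thesis by (metis cong_iff_dvd_diff dvd_triv_left)
  qed
  have "[int (Suc k) * int ((2 * Suc k) choose Suc k) = int (Suc k) * ((-4) ^ Suc k * int (m choose Suc k))] (mod int p)"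
  proof -
    have "[2 * (2 * int k + 1) * int ((2 * k) choose k) = -4 * (int m - int k) * ((-4) ^ k * int (m choose k))] (mod int p)"
      by (rule cong_mult[OF 3 Suc.IH]) (use Suc.prems in simp)
    also have "-4 * (int m - int k) * ((-4) ^ k * int (m choose k)) = (-4) ^ Suc k * (int (Suc k) * int (m choose Suc k))"
      unfolding int_binomial_step_right by (simp add: algebra_simps)
    finally show ?thesis unfolding int_central_binomial_step by (simp only: mult_ac)
  qed
  thus ?case by (rule cong_cancel1) (rule not_dvd_small; use Suc.prems p_eq in linarith)
qed simp

lemma prime_dvd_central_binomial:
  assumes "m < k" and "k < p"
  shows "p dvd ((2 * k) choose k)"
proof -
  have "p dvd fact (2 * k)" using assms prime_p p_eq by (simp add: prime_dvd_fact_iff)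
  also have "fact (2 * k) = fact k * fact k * ((2 * k) choose k)"
    using binomial_fact_lemma[of k "2 * k"] by (simp add: mult_2)
  finally show ?thesis using assms prime_p by (simp add: prime_dvd_mult_iff prime_dvd_fact_iff)
qed

section \<open>Alternating sums of Apery polynomials modulo the square of p\<close>

lemma alternating_telescope:
  "(\<Sum>n<N. (-1) ^ n * (h n + h (Suc n))) = h 0 - (-1) ^ N * (h N :: int)"
  by (induction N) (simp_all add: algebra_simps)

text \<open>
  The inner sum that multiplies \<open>C(2k,k)^2 x^k\<close> in the alternating sum of Apery polynomials.
\<close>

definition bsq_sum :: "nat \<Rightarrow> int" where
  "bsq_sum k = (\<Sum>n<p. (-1) ^ n * int ((n + k) choose (2 * k)) ^ 2)"

text \<open>
  With \<open>f_k(n) = C(n+k,2k)\<close>, the combination of \<open>f_(k+1)(n)^2\<close> and \<open>f_k(n)^2\<close> in the claim equals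
  \<open>h(n) + h(n + 1)\<close> for \<open>h(n) = (f_k(n) (n - k))^2 (n^2 - (k + 1) (3 k + 2))\<close>.  Hence the alternating sum
  telescopes to \<open>h(0) + h(p)\<close>; here \<open>h(0) = 0\<close>, and \<open>h(p)\<close> is divisible by \<open>p^2\<close> because \<open>f_k(p) (p - k)\<close> is
  divisible by \<open>p\<close>.
\<close>

lemma bsq_sum_step:
  assumes "k \<le> m"
  shows "[8 * (int k + 1)^2 * (2 * int k + 1)^2 * bsq_sum (Suc k) = (int k + 1) * (2 * int k + 1)^3 * bsq_sum k] (mod int p ^ 2)"
proof -
  define f where "f k n = int ((n + k) choose (2 * k))" for k n
  define c where "c n = (int n ^ 2 - (int k + 1) * (3 * int k + 2))" for n
  define h where "h n = (f k n * (int n - int k)) ^ 2 * c n" for n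
  have f_next: "f k (Suc n) * (int (Suc n) - int k) = f k n * (int n + int k + 1)" for n
  proof (cases "k \<le> Suc n")
    case True
    have "int ((Suc (n + k) - 2 * k) * (Suc (n + k) choose (2 * k))) = int (Suc (n + k) * ((n + k) choose (2 * k)))"
      using binomial_absorb_comp[of "Suc (n + k)" "2 * k"] by (simp only: diff_Suc_1)
    moreover have "Suc (n + k) - 2 * k = Suc n - k" by simp
    ultimately show ?thesis unfolding f_def of_nat_mult
      using True by (simp add: of_nat_diff mult.commute algebra_simps)
  qed (simp add: f_def binomial_eq_0 del: binomial_Suc_Suc)
  have f_up: "(2 * int k + 1) * (2 * int k + 2) * f (Suc k) n = (int n + int k + 1) * (int n - int k) * f k n" for n
    unfolding f_def by (rule int_binomial_pair_step)
  have key: "8 * (int k + 1)^2 * (2 * int k + 1)^2 * f (Suc k) n ^ 2 - (int k + 1) * (2 * int k + 1)^3 * f k n ^ 2 = h n + h (Suc n)" for n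
  proof -
    have "8 * (int k + 1)^2 * (2 * int k + 1)^2 * f (Suc k) n ^ 2 = 2 * ((2 * int k + 1) * (2 * int k + 2) * f (Suc k) n) ^ 2"
      by (simp add: power2_eq_square algebra_simps)
    also have "\<dots> = 2 * ((int n + int k + 1) * (int n - int k)) ^ 2 * f k n ^ 2"
      unfolding f_up by (simp add: power_mult_distrib)
    finally have 1: "8 * (int k + 1)^2 * (2 * int k + 1)^2 * f (Suc k) n ^ 2 = 2 * ((int n + int k + 1) * (int n - int k)) ^ 2 * f k n ^ 2" .
    \<comment> \<open>The identity behind the certificate, after division by the square of \<open>f k n\<close>.\<close>
    have poly: "2 * ((x + y + 1) * (x - y)) ^ 2 - (y + 1) * (2 * y + 1) ^ 3
       = (x - y) ^ 2 * (x ^ 2 - (y + 1) * (3 * y + 2)) + (x + y + 1) ^ 2 * ((x + 1) ^ 2 - (y + 1) * (3 * y + 2))" for x y :: int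
      by (simp add: power2_eq_square power3_eq_cube algebra_simps)
    have "h n + h (Suc n) = f k n ^ 2 * ((int n - int k) ^ 2 * c n + (int n + int k + 1) ^ 2 * c (Suc n))"
      unfolding h_def f_next power_mult_distrib by (simp only: distrib_left mult_ac)
    also have "\<dots> = f k n ^ 2 * (2 * ((int n + int k + 1) * (int n - int k)) ^ 2 - (int k + 1) * (2 * int k + 1)^3)"
      unfolding poly c_def by (simp add: add.commute)
    finally show ?thesis unfolding 1 by (simp add: algebra_simps)
  qed
  have h0: "h 0 = 0" by (cases k) (simp_all add: h_def f_def binomial_eq_0 del: binomial_Suc_Suc)
  have hp: "int p ^ 2 dvd h p"
  proof -
    have "int p dvd f k p * (int p - int k)"
    proof (cases "k = 0")
      case False
      have "p dvd fact (p + k)" using prime_p by (simp add: prime_dvd_fact_iff)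
      also have "fact (p + k) = fact (2 * k) * fact (p - k) * ((p + k) choose (2 * k))"
        using binomial_fact_lemma[of "2 * k" "p + k"] assms p_eq by simp
      finally have "p dvd ((p + k) choose (2 * k))"
        using False assms prime_p p_eq by (auto simp: prime_dvd_mult_iff prime_dvd_fact_iff)
      thus ?thesis by (simp add: f_def)
    qed simp
    thus ?thesis unfolding h_def by (simp add: dvd_power_same)
  qed
  have "8 * (int k + 1)^2 * (2 * int k + 1)^2 * bsq_sum (Suc k) - (int k + 1) * (2 * int k + 1)^3 * bsq_sum k
     = (\<Sum>n<p. (-1) ^ n * (8 * (int k + 1)^2 * (2 * int k + 1)^2 * f (Suc k) n ^ 2 - (int k + 1) * (2 * int k + 1)^3 * f k n ^ 2))"
    unfolding bsq_sum_def f_def[symmetric] sum_distrib_left sum_subtractf[symmetric]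
    by (rule sum.cong[OF refl]) (simp only: right_diff_distrib mult.left_commute)
  also have "\<dots> = h p"
    unfolding key alternating_telescope h0 using odd_p by simp
  finally show ?thesis using hp by (simp add: cong_iff_dvd_diff)
qed

text \<open>
  The right-hand side obeys the same recurrence, since \<open>4 (m + k + 1) (m - k) = p^2 - (2 k + 1)^2\<close>.
\<close>

lemma bsq_sum_cong:
  assumes "k \<le> m"
  shows "[bsq_sum k = (-1) ^ k * int ((m + k) choose (2 * k))] (mod int p ^ 2)"
  using assms
proof (induction k)
  case 0
  have "(\<Sum>n<2 * j + 1. (-1) ^ n) = (1 :: int)" for j :: nat by (induction j) auto
  from this[of m] have "bsq_sum 0 = 1" unfolding bsq_sum_def p_eq[symmetric] by simp
  thus ?case by simp
next
  case (Suc k)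
  define B where "B k = (-1) ^ k * int ((m + k) choose (2 * k))" for k
  define u where "u = 8 * (int k + 1)^2 * (2 * int k + 1)^2"
  have B_up: "[4 * (2 * int k + 1) * (2 * int k + 2) * B (Suc k) = (2 * int k + 1) ^ 2 * B k] (mod int p ^ 2)"
  proof -
    have "4 * (2 * int k + 1) * (2 * int k + 2) * B (Suc k) = (-1) ^ Suc k * (4 * ((2 * int k + 1) * (2 * int k + 2) * int ((m + Suc k) choose (2 * Suc k))))"
      by (simp only: B_def mult_ac)
    also have "\<dots> = - (4 * ((int m + int k + 1) * (int m - int k))) * B k"
      unfolding int_binomial_pair_step by (simp add: B_def)
    also have "4 * ((int m + int k + 1) * (int m - int k)) = int p ^ 2 - (2 * int k + 1) ^ 2"
      by (simp add: int_p_eq power2_eq_square algebra_simps)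
    also have "- (int p ^ 2 - (2 * int k + 1) ^ 2) * B k = (2 * int k + 1) ^ 2 * B k + int p ^ 2 * (- B k)"
      by (simp add: algebra_simps)
    finally show ?thesis by (simp only: cong_iff_dvd_diff add_diff_cancel_left' dvd_triv_left)
  qed
  have "[u * bsq_sum (Suc k) = (int k + 1) * (2 * int k + 1)^3 * bsq_sum k] (mod int p ^ 2)"
    unfolding u_def using Suc.prems by (intro bsq_sum_step) simp
  also have "[(int k + 1) * (2 * int k + 1)^3 * bsq_sum k = (int k + 1) * (2 * int k + 1)^3 * B k] (mod int p ^ 2)"
    unfolding B_def by (intro cong_mult cong_refl Suc.IH) (use Suc.prems in simp)
  also have "(int k + 1) * (2 * int k + 1)^3 * B k = (int k + 1) * (2 * int k + 1) * ((2 * int k + 1) ^ 2 * B k)"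
    by (simp add: power2_eq_square power3_eq_cube)
  also have "[\<dots> = (int k + 1) * (2 * int k + 1) * (4 * (2 * int k + 1) * (2 * int k + 2) * B (Suc k))] (mod int p ^ 2)"
    by (intro cong_mult cong_refl cong_sym[OF B_up])
  also have "(int k + 1) * (2 * int k + 1) * (4 * (2 * int k + 1) * (2 * int k + 2) * B (Suc k)) = u * B (Suc k)"
    unfolding u_def by (simp add: power2_eq_square algebra_simps)
  finally have "[u * bsq_sum (Suc k) = u * B (Suc k)] (mod int p ^ 2)" .
  moreover have "\<not> int p dvd u"
  proof -
    have "\<not> int p dvd int (k + 1)" "\<not> int p dvd int (2 * k + 1)"
      using Suc.prems p_eq by (intro not_dvd_small; simp)+
    hence "\<not> int p dvd int k + 1" "\<not> int p dvd 2 * int k + 1" by (simp_all add: add.commute)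
    moreover have "\<not> int p dvd 8" using not_dvd_two_power[of 3] by simp
    ultimately show ?thesis unfolding u_def using prime_int_p by (auto simp: prime_dvd_mult_iff dest!: prime_dvd_power[OF prime_int_p])
  qed
  ultimately show ?case unfolding B_def by (rule cong_cancel)
qed

lemma apery_term_eq:
  assumes "k \<le> n"
  shows "(n choose k) * ((n + k) choose k) = ((n + k) choose (2 * k)) * ((2 * k) choose k)"
proof -
  have "fact k * fact k * fact (n - k) * ((n choose k) * ((n + k) choose k)) = fact (n + k)"
    using binomial_fact_lemma[of k n] binomial_fact_lemma[of k "n + k"] assms
    by (simp add: mult_ac) (metis mult.assoc mult.commute)
  moreover have "fact k * fact k * fact (n - k) * (((n + k) choose (2 * k)) * ((2 * k) choose k)) = fact (n + k)"
    using binomial_fact_lemma[of "2 * k" "n + k"] binomial_fact_lemma[of k "2 * k"] assms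
    by (simp add: mult_ac) (metis mult.assoc mult.commute)
  ultimately have "fact k * fact k * fact (n - k) * ((n choose k) * ((n + k) choose k)) = fact k * fact k * fact (n - k) * (((n + k) choose (2 * k)) * ((2 * k) choose k))"
    by simp
  moreover have "(fact k * fact k * fact (n - k) :: nat) \<noteq> 0" by simp
  ultimately show ?thesis by (metis mult_left_cancel)
qed

text \<open>
  Summing up to a bound \<open>N\<close> that is uniform in \<open>n\<close> allows the order of summation to be exchanged.
\<close>

lemma apery_poly_eq:
  assumes "n < N"
  shows "apery_poly n x = (\<Sum>k<N. of_nat ((2 * k) choose k) ^ 2 * of_nat ((n + k) choose (2 * k)) ^ 2 * x ^ k)"
proof -
  have "apery_poly n x = (\<Sum>k\<le>n. of_nat ((2 * k) choose k) ^ 2 * of_nat ((n + k) choose (2 * k)) ^ 2 * x ^ k)"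
    unfolding apery_poly_def atLeast0AtMost
  proof (rule sum.cong[OF refl])
    fix k assume "k \<in> {..n}"
    hence "of_nat (n choose k) * of_nat ((n + k) choose k) = (of_nat ((n + k) choose (2 * k)) * of_nat ((2 * k) choose k) :: rat)"
      using apery_term_eq[of k n] by (simp flip: of_nat_mult)
    hence "(of_nat (n choose k) * of_nat ((n + k) choose k)) ^ 2 = (of_nat ((2 * k) choose k) * of_nat ((n + k) choose (2 * k)) :: rat) ^ 2"
      by (simp add: mult.commute)
    thus "of_nat (n choose k) ^ 2 * of_nat ((n + k) choose k) ^ 2 * x ^ k = of_nat ((2 * k) choose k) ^ 2 * of_nat ((n + k) choose (2 * k)) ^ 2 * x ^ k"
      by (simp add: power_mult_distrib)
  qed
  also have "\<dots> = (\<Sum>k<N. of_nat ((2 * k) choose k) ^ 2 * of_nat ((n + k) choose (2 * k)) ^ 2 * x ^ k)"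
    using assms by (intro sum.mono_neutral_left) auto
  finally show ?thesis .
qed

text \<open>
  For \<open>k > m\<close> both sides have coefficient zero: the factor \<open>C(2k,k)^2\<close> is divisible by \<open>p^2\<close>.
\<close>

lemma alternating_apery_sum_cong:
  assumes x: "integral x"
  shows "qcong 2 (\<Sum>n<p. (-1) ^ n * apery_poly n x) (clausen_sum m (- x))"
proof -
  have "(\<Sum>n<p. (-1) ^ n * apery_poly n x) = (\<Sum>n<p. \<Sum>k<p. (-1) ^ n * (of_nat ((2 * k) choose k) ^ 2 * of_nat ((n + k) choose (2 * k)) ^ 2 * x ^ k))"
    by (rule sum.cong[OF refl]) (simp add: apery_poly_eq[of _ p] sum_distrib_left)
  also have "\<dots> = (\<Sum>k<p. of_int (int ((2 * k) choose k) ^ 2 * bsq_sum k) * x ^ k)"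
    by (subst sum.swap) (simp add: bsq_sum_def sum_distrib_left sum_distrib_right mult_ac)
  also have "qcong 2 \<dots> (\<Sum>k<p. of_int (int ((2 * k) choose k) ^ 2 * ((-1) ^ k * int ((m + k) choose (2 * k)))) * x ^ k)"
  proof (rule qcong_sum)
    fix k assume k: "k \<in> {..<p}"
    have "[int ((2 * k) choose k) ^ 2 * bsq_sum k = int ((2 * k) choose k) ^ 2 * ((-1) ^ k * int ((m + k) choose (2 * k)))] (mod int p ^ 2)"
    proof (cases "k \<le> m")
      case True
      thus ?thesis by (intro cong_mult cong_refl bsq_sum_cong)
    next
      case False
      hence "int p dvd int ((2 * k) choose k)" using prime_dvd_central_binomial[of k] k by simp
      hence "int p ^ 2 dvd int ((2 * k) choose k) ^ 2" by (rule dvd_power_same)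
      thus ?thesis by (metis cong_iff_dvd_diff dvd_mult2 right_diff_distrib)
    qed
    hence "qcong 2 (of_int (int ((2 * k) choose k) ^ 2 * bsq_sum k)) (of_int (int ((2 * k) choose k) ^ 2 * ((-1) ^ k * int ((m + k) choose (2 * k)))))"
      by (simp only: qcong_of_int_iff)
    from qcong_mult[OF this qcong_refl integral_of_int integral_power[OF x]]
    show "qcong 2 (of_int (int ((2 * k) choose k) ^ 2 * bsq_sum k) * x ^ k) (of_int (int ((2 * k) choose k) ^ 2 * ((-1) ^ k * int ((m + k) choose (2 * k)))) * x ^ k)" .
  qed
  also have "(\<Sum>k<p. of_int (int ((2 * k) choose k) ^ 2 * ((-1) ^ k * int ((m + k) choose (2 * k)))) * x ^ k) = clausen_sum m (- x)"
  proof -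
    have "(\<Sum>k<p. of_int (int ((2 * k) choose k) ^ 2 * ((-1) ^ k * int ((m + k) choose (2 * k)))) * x ^ k)
       = (\<Sum>k<p. of_nat ((2 * k) choose k) ^ 2 * of_nat ((m + k) choose (2 * k)) * (- x) ^ k)"
      by (rule sum.cong[OF refl]) (simp add: power_minus[of x])
    also have "\<dots> = clausen_sum m (- x)"
      unfolding clausen_sum_def using p_eq by (intro sum.mono_neutral_right) auto
    finally show ?thesis .
  qed
  finally show ?thesis .
qed

text \<open>
  In this form modulo \<open>p\<close> the sum is symmetric under \<open>k \<mapsto> m - k\<close>, which exchanges \<open>4 y\<close> and its inverse.
\<close>

lemma clausen_sum_cong_cubes:
  assumes y: "integral y"
  shows "qcong 1 (clausen_sum m y) (\<Sum>k\<le>m. of_int (int (m choose k) ^ 3) * (4 * y) ^ k)"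
  unfolding clausen_sum_def
proof (rule qcong_sum)
  fix k assume "k \<in> {..m}"
  hence k: "k \<le> m" by simp
  have "int ((2 * k) choose k) ^ 2 * int ((m + k) choose (2 * k)) = int ((2 * k) choose k) * (int (m choose k) * int ((m + k) choose k))"
    using apery_term_eq[OF k] by (simp add: power2_eq_square flip: of_nat_mult)
  also have "[\<dots> = ((-4) ^ k * int (m choose k)) * (int (m choose k) * ((-1) ^ k * int (m choose k)))] (mod int p)"
  proof (intro cong_mult cong_refl central_binomial_cong[OF k] binomial_negate_cong)
    show "[int m + int m + 1 = 0] (mod int p)" using int_p_eq by (simp add: cong_0_iff)
    show "k < p" using k p_eq by simp
  qed
  also have "((-4) ^ k * int (m choose k)) * (int (m choose k) * ((-1) ^ k * int (m choose k))) = 4 ^ k * int (m choose k) ^ 3"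
    by (simp add: power3_eq_cube power_minus[of 4])
  finally have "qcong 1 (of_int (int ((2 * k) choose k) ^ 2 * int ((m + k) choose (2 * k)))) (of_int (4 ^ k * int (m choose k) ^ 3))"
    by (simp add: qcong_of_int_iff del: of_int_mult of_int_power)
  from qcong_mult[OF this qcong_refl integral_of_int integral_power[OF y]]
  show "qcong 1 (of_nat ((2 * k) choose k) ^ 2 * of_nat ((m + k) choose (2 * k)) * y ^ k) (of_int (int (m choose k) ^ 3) * (4 * y) ^ k)"
    by (simp add: power_mult_distrib mult_ac)
qed

text \<open>
  The arguments \<open>-1\<close> and \<open>-1/16\<close> correspond to the mutually inverse values \<open>4 y = -4\<close> and \<open>4 y = -1/4\<close>.
\<close>

lemma clausen_sum_reversal:
  "qcong 1 (clausen_sum m (-1)) ((-4) ^ m * clausen_sum m (- (1 / 16)))"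
proof -
  have i16: "integral (1 / 16)"
    using integral_divide[OF integral_1, of 16] not_dvd_two_power[of 4] by simp
  have "qcong 1 (clausen_sum m (-1)) (\<Sum>k\<le>m. of_int (int (m choose k) ^ 3) * (4 * -1) ^ k)"
    by (rule clausen_sum_cong_cubes) (use integral_minus[OF integral_1] in simp)
  also have "(\<Sum>k\<le>m. of_int (int (m choose k) ^ 3) * (4 * -1) ^ k) = (\<Sum>k\<le>m. of_int (int (m choose (m - k)) ^ 3) * (-4 :: rat) ^ (m - k))"
    by (rule sum.reindex_bij_witness[of _ "\<lambda>k. m - k" "\<lambda>k. m - k"]) auto
  also have "\<dots> = (-4) ^ m * (\<Sum>k\<le>m. of_int (int (m choose k) ^ 3) * (4 * - (1 / 16)) ^ k)"
  proof -
    have "(-4 :: rat) ^ (m - k) = (-4) ^ m * (4 * - (1 / 16)) ^ k" if "k \<le> m" for k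
    proof -
      have "(-4 :: rat) ^ m = (-4) ^ (m - k) * (-4) ^ k" using that by (simp flip: power_add)
      moreover have "(-4 :: rat) ^ k * (4 * - (1 / 16)) ^ k = 1" by (simp flip: power_mult_distrib)
      ultimately show ?thesis by (simp add: mult.assoc)
    qed
    thus ?thesis unfolding sum_distrib_left
      by (intro sum.cong) (simp_all add: binomial_symmetric[symmetric] mult_ac)
  qed
  also have "qcong 1 \<dots> ((-4) ^ m * clausen_sum m (- (1 / 16)))"
    by (rule qcong_mult_left[OF qcong_sym[OF clausen_sum_cong_cubes]])
       (use integral_minus[OF i16] integral_power[OF integral_minus[OF integral_numeral]] in simp_all)
  finally show ?thesis .
qed

section \<open>Sums of Apery numbers modulo p\<close>

text \<open>
  Put \<open>d = 2 (m - j)\<close>.  Only \<open>n = m - j + l\<close> with \<open>l \<ge> 0\<close> contributes, and then the binomial coefficient is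
  \<open>C(d + l, l)\<close>, which is \<open>(-1)^l C(2j, l)\<close> because \<open>d \<equiv> - 2 j - 1\<close>.
\<close>

lemma square_binomial_sum_cong:
  assumes j: "j \<le> m"
  shows "[(\<Sum>n<p. int ((n + (m - j)) choose (2 * (m - j))) ^ 2) = int ((4 * j) choose (2 * j))] (mod int p)"
proof -
  define d where "d = 2 * (m - j)"
  have "(\<Sum>n<p. int ((n + (m - j)) choose d) ^ 2) = (\<Sum>n\<in>{m - j..<p}. int ((n + (m - j)) choose d) ^ 2)"
    by (rule sum.mono_neutral_right) (auto simp: d_def binomial_eq_0)
  also have "\<dots> = (\<Sum>l\<le>m + j. int ((d + l) choose l) ^ 2)"
  proof (rule sum.reindex_bij_witness[of _ "\<lambda>l. l + (m - j)" "\<lambda>n. n - (m - j)"])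
    fix n assume n: "n \<in> {m - j..<p}"
    hence "n + (m - j) = d + (n - (m - j))" by (simp add: d_def)
    thus "int ((d + (n - (m - j))) choose (n - (m - j))) ^ 2 = int ((n + (m - j)) choose d) ^ 2"
      using binomial_symmetric[of d "d + (n - (m - j))"] by simp
  qed (use j p_eq in auto)
  also have "[\<dots> = (\<Sum>l\<le>m + j. ((-1) ^ l * int ((2 * j) choose l)) ^ 2)] (mod int p)"
  proof (intro cong_sum cong_pow binomial_negate_cong)
    fix l assume "l \<in> {..m + j}"
    show "[int d + int (2 * j) + 1 = 0] (mod int p)"
      using j int_p_eq by (simp add: d_def of_nat_diff cong_0_iff)
    show "l < p" using \<open>l \<in> {..m + j}\<close> j p_eq by simp
  qed
  also have "(\<Sum>l\<le>m + j. ((-1) ^ l * int ((2 * j) choose l)) ^ 2) = (\<Sum>l\<le>2 * j. int ((2 * j) choose l) ^ 2)"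
    using j by (intro sum.mono_neutral_cong_right) (auto simp: power_mult_distrib simp flip: power_mult)
  also have "\<dots> = int (\<Sum>l\<le>2 * j. ((2 * j) choose l) ^ 2)" by simp
  also have "\<dots> = int ((4 * j) choose (2 * j))"
    unfolding choose_square_sum by simp
  finally show ?thesis unfolding d_def .
qed


lemma fermat:
  assumes "\<not> int p dvd a"
  shows "[a ^ (2 * m) = 1] (mod int p)"
proof -
  define b where "b = nat (a mod int p)"
  have b: "int b = a mod int p" using p_pos by (simp add: b_def)
  hence "\<not> int p dvd int b" using assms by (simp add: dvd_eq_mod_eq_0)
  hence "[b ^ (p - 1) = 1] (mod p)" using prime_p by (intro fermat_theorem) (simp_all add: int_dvd_int_iff)
  hence "[b ^ (2 * m) = 1] (mod p)" using p_eq by (metis add_diff_cancel_right')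
  hence "[int b ^ (2 * m) = 1] (mod int p)" by (metis cong_int_iff of_nat_1 of_nat_power)
  moreover have "[a ^ (2 * m) = int b ^ (2 * m)] (mod int p)" unfolding b by (intro cong_pow) (simp add: cong_def)
  ultimately show ?thesis by (metis cong_trans)
qed

text \<open>
  Both sides satisfy the same first order recurrence in \<open>j\<close>: \<open>p div 4\<close> is \<open>-1/4\<close> or \<open>-3/4\<close> modulo \<open>p\<close>,
  so \<open>C(p div 4 + j, 2j)\<close> is the product of two quarter-integer Pochhammer symbols.  For \<open>j > p div 4\<close> both sides
  vanish modulo \<open>p\<close>.
\<close>

lemma middle_binomial_cong:
  assumes "j \<le> m"
  shows "[int ((4 * j) choose (2 * j)) = (-64) ^ j * int ((p div 4 + j) choose (2 * j))] (mod int p)"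
  using assms
proof (induction j)
  case (Suc j)
  define a where "a = (2 * int j + 1) * (2 * int j + 2)"
  define N where "N = p div 4"
  define C where "C k = int ((2 * k) choose k)" for k
  have c: "int (Suc k) * C (Suc k) = 2 * (2 * int k + 1) * C k" for k
    unfolding C_def by (rule int_central_binomial_step)
  have c1: "int (Suc (Suc (2 * j))) * C (Suc (Suc (2 * j))) = 2 * (4 * int j + 3) * C (Suc (2 * j))"
    and c0: "int (Suc (2 * j)) * C (Suc (2 * j)) = 2 * (4 * int j + 1) * C (2 * j)"
    using c[of "Suc (2 * j)"] c[of "2 * j"] by simp_all
  have "a * C (2 * j + 2) = int (Suc (2 * j)) * (int (Suc (Suc (2 * j))) * C (Suc (Suc (2 * j))))"
    by (simp add: a_def add.commute)
  also have "\<dots> = 2 * (4 * int j + 3) * (int (Suc (2 * j)) * C (Suc (2 * j)))"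
    unfolding c1 by (simp only: mult_ac)
  also have "\<dots> = 4 * (4 * int j + 1) * (4 * int j + 3) * C (2 * j)"
    unfolding c0 by (simp add: algebra_simps)
  finally have 1: "a * C (2 * j + 2) = 4 * (4 * int j + 1) * (4 * int j + 3) * C (2 * j)" .
  have 2: "a * int ((N + Suc j) choose (2 * Suc j)) = (int N + int j + 1) * (int N - int j) * int ((N + j) choose (2 * j))"
    unfolding a_def by (rule int_binomial_pair_step)
  have "p = 4 * N + 1 \<or> p = 4 * N + 3" unfolding N_def using odd_p by presburger
  hence "int p = 4 * int N + 1 \<or> int p = 4 * int N + 3" by linarith
  hence 3: "[4 * (4 * int j + 1) * (4 * int j + 3) = -64 * ((int N + int j + 1) * (int N - int j))] (mod int p)"
  proof
    assume e: "int p = 4 * int N + 1"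
    have "4 * (4 * int j + 1) * (4 * int j + 3) - (-64 * ((int N + int j + 1) * (int N - int j))) = int p * (16 * int N + 12)"
      unfolding e by (simp add: algebra_simps)
    thus ?thesis by (metis cong_iff_dvd_diff dvd_triv_left)
  next
    assume e: "int p = 4 * int N + 3"
    have "4 * (4 * int j + 1) * (4 * int j + 3) - (-64 * ((int N + int j + 1) * (int N - int j))) = int p * (16 * int N + 4)"
      unfolding e by (simp add: algebra_simps)
    thus ?thesis by (metis cong_iff_dvd_diff dvd_triv_left)
  qed
  have IH: "[C (2 * j) = (-64) ^ j * int ((N + j) choose (2 * j))] (mod int p)"
    using Suc by (simp add: C_def N_def)
  have "[a * C (2 * j + 2) = a * ((-64) ^ Suc j * int ((N + Suc j) choose (2 * Suc j)))] (mod int p)"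
  proof -
    have "a * ((-64) ^ Suc j * int ((N + Suc j) choose (2 * Suc j))) = (-64) ^ Suc j * (a * int ((N + Suc j) choose (2 * Suc j)))"
      by (simp only: mult_ac)
    also have "\<dots> = -64 * ((int N + int j + 1) * (int N - int j)) * ((-64) ^ j * int ((N + j) choose (2 * j)))"
      unfolding 2 by (simp only: mult_ac power_Suc)
    finally show ?thesis unfolding 1 by (simp only: cong_mult[OF 3 IH])
  qed
  moreover have "\<not> int p dvd a"
  proof -
    have "\<not> int p dvd int (2 * j + 1)" "\<not> int p dvd int (2 * j + 2)"
      using Suc.prems p_eq by (intro not_dvd_small; simp)+
    thus ?thesis unfolding a_def using prime_int_p by (simp add: prime_dvd_mult_iff add.commute)
  qed
  ultimately have "[C (2 * j + 2) = (-64) ^ Suc j * int ((N + Suc j) choose (2 * Suc j))] (mod int p)"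
    by (rule cong_cancel1)
  moreover have e: "4 * Suc j = 2 * (2 * j + 2)" "2 * Suc j = 2 * j + 2" by simp_all
  ultimately show ?case unfolding C_def N_def e by simp
qed simp

lemma reflected_central_binomial_cong:
  assumes "j \<le> m"
  shows "[256 ^ j * int ((2 * (m - j)) choose (m - j)) ^ 2 = int ((2 * j) choose j) ^ 2] (mod int p)"
proof -
  have sq: "((-4 :: int) ^ i * x) ^ 2 = 16 ^ i * x ^ 2" for i x
  proof -
    have "((-4 :: int) ^ i) ^ 2 = ((-4) ^ 2) ^ i" by (simp only: power_mult[symmetric] mult.commute)
    thus ?thesis by (simp add: power_mult_distrib)
  qed
  have "[256 ^ j * int ((2 * (m - j)) choose (m - j)) ^ 2 = 256 ^ j * ((-4) ^ (m - j) * int (m choose (m - j))) ^ 2] (mod int p)"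
    by (intro cong_mult cong_pow cong_refl central_binomial_cong) simp
  also have "256 ^ j * ((-4) ^ (m - j) * int (m choose (m - j))) ^ 2 = 4 ^ (2 * m) * ((-4) ^ j * int (m choose j)) ^ 2"
  proof -
    have "(4 :: int) ^ (2 * m) = 16 ^ m" by (simp add: power_mult)
    also have "\<dots> = 16 ^ j * 16 ^ (m - j)" using assms by (simp flip: power_add)
    finally show ?thesis unfolding sq using binomial_symmetric[OF assms]
      by (simp flip: power_mult_distrib)
  qed
  also have "[\<dots> = 1 * int ((2 * j) choose j) ^ 2] (mod int p)"
    by (intro cong_mult cong_pow fermat not_dvd_four cong_sym[OF central_binomial_cong[OF assms]])
  finally show ?thesis by simp
qed

text \<open>
  After the substitution \<open>k = m - j\<close> the factor \<open>C(2k,k)^2\<close> becomes \<open>C(2j,j)^2 / 256^j\<close> and the inner sum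
  becomes \<open>C(4j,2j)\<close>.
\<close>

lemma apery_sum_cong:
  "qcong 1 (\<Sum>n<p. apery_number n) (clausen_sum (p div 4) (- (1 / 4)))"
proof -
  define S where "S k = (\<Sum>n<p. int ((n + k) choose (2 * k)) ^ 2)" for k
  have "(\<Sum>n<p. apery_number n) = (\<Sum>n<p. \<Sum>k<p. of_nat ((2 * k) choose k) ^ 2 * of_nat ((n + k) choose (2 * k)) ^ 2)"
    unfolding apery_number_def by (rule sum.cong[OF refl]) (simp add: apery_poly_eq[of _ p])
  also have "\<dots> = of_int (\<Sum>k<p. int ((2 * k) choose k) ^ 2 * S k)"
    by (subst sum.swap) (simp add: S_def sum_distrib_left)
  also have "qcong 1 \<dots> (of_int (\<Sum>k\<le>m. int ((2 * k) choose k) ^ 2 * S k))"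
  proof -
    have "(\<Sum>k<p. int ((2 * k) choose k) ^ 2 * S k) = (\<Sum>k\<le>m. int ((2 * k) choose k) ^ 2 * S k) + (\<Sum>k\<in>{m<..<p}. int ((2 * k) choose k) ^ 2 * S k)"
      using p_eq by (subst sum.union_disjoint[symmetric]) (auto intro!: sum.cong)
    moreover have "int p dvd (\<Sum>k\<in>{m<..<p}. int ((2 * k) choose k) ^ 2 * S k)"
    proof (rule dvd_sum)
      fix k assume "k \<in> {m<..<p}"
      hence "int p dvd int ((2 * k) choose k)" using prime_dvd_central_binomial[of k] by simp
      thus "int p dvd int ((2 * k) choose k) ^ 2 * S k" by (simp add: power2_eq_square)
    qed
    ultimately show ?thesis unfolding qcong_of_int_iff by (simp add: cong_iff_dvd_diff)
  qed
  also have "(\<Sum>k\<le>m. int ((2 * k) choose k) ^ 2 * S k) = (\<Sum>j\<le>m. int ((2 * (m - j)) choose (m - j)) ^ 2 * S (m - j))"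
    by (rule sum.reindex_bij_witness[of _ "\<lambda>k. m - k" "\<lambda>k. m - k"]) auto
  also have "of_int \<dots> = (\<Sum>j\<le>m. of_int (int ((2 * (m - j)) choose (m - j)) ^ 2 * S (m - j)) :: rat)"
    by simp
  also have "qcong 1 \<dots> (\<Sum>j\<le>m. of_nat ((2 * j) choose j) ^ 2 * of_nat ((p div 4 + j) choose (2 * j)) * (- (1 / 4)) ^ j)"
  proof (rule qcong_sum)
    fix j assume "j \<in> {..m}"
    hence j: "j \<le> m" by simp
    define c where "c = int ((2 * j) choose j) ^ 2"
    define d where "d = int ((p div 4 + j) choose (2 * j))"
    have "[256 ^ j * int ((2 * (m - j)) choose (m - j)) ^ 2 * S (m - j) = c * ((-64) ^ j * d)] (mod int p)"
      unfolding c_def d_def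
      by (intro cong_mult reflected_central_binomial_cong[OF j]
            cong_trans[OF square_binomial_sum_cong[OF j, folded S_def] middle_binomial_cong[OF j]])
    hence "qcong 1 (of_int (256 ^ j * int ((2 * (m - j)) choose (m - j)) ^ 2 * S (m - j))) (of_int (c * ((-64) ^ j * d)))"
      unfolding qcong_of_int_iff by simp
    moreover have "(-64 :: rat) ^ j = 256 ^ j * (- (1 / 4)) ^ j"
      by (simp flip: power_mult_distrib)
    ultimately have "qcong 1 (of_int (256 ^ j) * (of_int (int ((2 * (m - j)) choose (m - j)) ^ 2 * S (m - j))))
       (of_int (256 ^ j) * (of_int c * of_int d * (- (1 / 4)) ^ j))"
      by (simp add: mult_ac)
    moreover have "\<not> int p dvd 256 ^ j"
      using not_dvd_two_power[of "8 * j"] by (simp add: power_mult)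
    ultimately have "qcong 1 (of_int (int ((2 * (m - j)) choose (m - j)) ^ 2 * S (m - j))) (of_int c * of_int d * (- (1 / 4)) ^ j)"
      by (rule qcong_cancel)
    thus "qcong 1 (of_int (int ((2 * (m - j)) choose (m - j)) ^ 2 * S (m - j)))
       (of_nat ((2 * j) choose j) ^ 2 * of_nat ((p div 4 + j) choose (2 * j)) * (- (1 / 4)) ^ j)"
      by (simp add: c_def d_def)
  qed
  also have "(\<Sum>j\<le>m. of_nat ((2 * j) choose j) ^ 2 * of_nat ((p div 4 + j) choose (2 * j)) * (- (1 / 4)) ^ j) = clausen_sum (p div 4) (- (1 / 4) :: rat)"
    unfolding clausen_sum_def using p_eq by (intro sum.mono_neutral_right) auto
  finally show ?thesis .
qed

text \<open>
  Here \<open>p div 4\<close> is odd, and an odd Legendre polynomial vanishes at 0.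
\<close>

lemma apery_sum_cong_0:
  assumes "p mod 8 = 5 \<or> p mod 8 = 7"
  shows "qcong 1 (\<Sum>n<p. apery_number n) 0"
proof -
  have "(p div 4) mod 2 = 1" using assms by presburger
  hence "4 ^ (p div 4) * clausen_sum (p div 4) (- (1 / 4)) = (0 :: rat)"
    unfolding clausen_sum_eq_square by simp
  hence "clausen_sum (p div 4) (- (1 / 4)) = (0 :: rat)" by simp
  thus ?thesis using apery_sum_cong by simp
qed

text \<open>
  Here \<open>p div 4\<close> is twice \<open>j = p div 8\<close>, the Legendre polynomial has the value \<open>\<plusminus>C(2j,j) / 4^j\<close> at 0, and
  \<open>C(2j,j) \<equiv> (-4)^j C(m,j)\<close>.
\<close>

lemma apery_sum_cong_binomial_square:
  assumes "p mod 8 = 1 \<or> p mod 8 = 3"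
  shows "qcong 1 (\<Sum>n<p. apery_number n) (of_int (int (m choose (p div 8)) ^ 2))"
proof -
  define j where "j = p div 8"
  have j: "p div 4 = 2 * j" unfolding j_def using assms by presburger
  have le: "j \<le> m" unfolding j_def m_def by presburger
  have "4 ^ (2 * j) * clausen_sum (2 * j) (- (1 / 4)) = (legendre_even_part (2 * j) 0 :: rat) ^ 2"
    unfolding clausen_sum_eq_square by simp
  also have "legendre_even_part (2 * j) (0 :: rat) = (\<Sum>k\<le>j. if k = j then (-1) ^ j * of_nat ((2 * j) choose j) else 0)"
    unfolding legendre_even_part_def by (intro sum.cong) auto
  also have "\<dots> ^ 2 = of_int (int ((2 * j) choose j) ^ 2)"
    by (simp add: power_mult_distrib flip: power_mult)
  also have "qcong 1 (of_int (int ((2 * j) choose j) ^ 2)) (of_int (((-4) ^ j * int (m choose j)) ^ 2))"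
    unfolding qcong_of_int_iff power_one_right by (intro cong_pow central_binomial_cong le)
  also have "of_int (((-4) ^ j * int (m choose j)) ^ 2) = (4 ^ (2 * j) * of_int (int (m choose j) ^ 2) :: rat)"
    by (simp add: power_mult_distrib power_mult power2_eq_square flip: power_mult_distrib)
  finally have "qcong 1 (of_int (4 ^ (2 * j)) * clausen_sum (2 * j) (- (1 / 4))) (of_int (4 ^ (2 * j)) * of_int (int (m choose j) ^ 2))"
    by simp
  moreover have "\<not> int p dvd 4 ^ (2 * j)"
    using not_dvd_two_power[of "4 * j"] by (simp add: power_mult)
  ultimately have "qcong 1 (clausen_sum (2 * j) (- (1 / 4))) (of_int (int (m choose j) ^ 2))"
    by (rule qcong_cancel)
  from qcong_trans[OF apery_sum_cong[unfolded j] this] show ?thesis unfolding j_def .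
qed


section \<open>Quadratic character sums\<close>

definition chi :: "int \<Rightarrow> int" where "chi a = Legendre a (int p)"

definition resid :: "int set" where "resid = {0..<int p}"

lemma finite_residues [simp]: "finite resid" and card_residues [simp]: "card resid = p"
  by (simp_all add: resid_def)

lemma mod_in_residues [simp]: "a mod int p \<in> resid"
  using p_pos by (simp add: resid_def)

lemma residues_cong_eq: "x \<in> resid \<Longrightarrow> y \<in> resid \<Longrightarrow> [x = y] (mod int p) \<Longrightarrow> x = y"
  by (auto simp: resid_def cong_def)

lemma residues_dvd_iff: "x \<in> resid \<Longrightarrow> int p dvd x \<longleftrightarrow> x = 0"
  by (auto simp: resid_def dest: zdvd_imp_le)

lemma zero_in_residues [simp]: "0 \<in> resid" and one_in_residues [simp]: "1 \<in> resid"
  using p_gt_2 by (simp_all add: resid_def)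

lemma chi_eq_0_iff: "chi a = 0 \<longleftrightarrow> int p dvd a"
  by (simp add: chi_def Legendre_def cong_0_iff)

lemma chi_range: "chi a \<in> {-1, 0, 1}"
  by (simp add: chi_def Legendre_def)

lemma chi_cong_power: "[chi a = a ^ m] (mod int p)"
  unfolding chi_def m_def using euler_criterion[OF prime_p p_gt_2] .

lemma sign_cong_eq: "x \<in> {-1, 0, 1} \<Longrightarrow> y \<in> {-1, 0, 1} \<Longrightarrow> [x = y] (mod int p) \<Longrightarrow> x = y"
  using p_gt_2 not_dvd_two by (auto simp: cong_iff_dvd_diff dest: zdvd_imp_le)

lemma chi_eqI: "x \<in> {-1, 0, 1} \<Longrightarrow> [a ^ m = x] (mod int p) \<Longrightarrow> chi a = x"
  using sign_cong_eq[OF chi_range] cong_trans[OF chi_cong_power] by blast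

lemma chi_cong: "[a = b] (mod int p) \<Longrightarrow> chi a = chi b"
  by (rule chi_eqI[OF chi_range]) (rule cong_trans[OF cong_pow cong_sym[OF chi_cong_power]])

lemma chi_mult: "chi (a * b) = chi a * chi b"
proof (rule chi_eqI)
  show "chi a * chi b \<in> {-1, 0, 1}" using chi_range[of a] chi_range[of b] by auto
  show "[(a * b) ^ m = chi a * chi b] (mod int p)"
    unfolding power_mult_distrib by (rule cong_sym[OF cong_mult[OF chi_cong_power chi_cong_power]])
qed

lemma chi_0 [simp]: "chi 0 = 0" by (simp add: chi_eq_0_iff)

lemma chi_1 [simp]: "chi 1 = 1" by (rule chi_eqI) simp_all

lemma chi_power: "chi (a ^ k) = chi a ^ k"
  by (induction k) (simp_all add: chi_mult)

lemma chi_square: "\<not> int p dvd a \<Longrightarrow> chi a ^ 2 = 1"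
  using chi_range[of a] by (auto simp: chi_eq_0_iff)

lemma chi_mult_self: "\<not> int p dvd a \<Longrightarrow> chi a * chi a = 1"
  using chi_square by (simp add: power2_eq_square)

lemma chi_even_power: "\<not> int p dvd a \<Longrightarrow> even k \<Longrightarrow> chi a ^ k = 1"
  by (elim evenE) (simp add: power_mult chi_square)

lemma prime_dvd_mult_p: "int p dvd a * b \<longleftrightarrow> int p dvd a \<or> int p dvd b"
  using prime_int_p by (rule prime_dvd_mult_iff)

lemma prime_dvd_power_p: "k > 0 \<Longrightarrow> int p dvd a ^ k \<longleftrightarrow> int p dvd a"
  using prime_int_p by (simp add: prime_dvd_power_iff)

text \<open>
  Functions of an integer that depend only on its residue class.  Sums over \<open>resid\<close> of such functions can be
  reindexed by any map that is injective modulo \<open>p\<close>.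
\<close>

definition modular :: "(int \<Rightarrow> 'a) \<Rightarrow> bool" where
  "modular f \<longleftrightarrow> (\<forall>x y. [x = y] (mod int p) \<longrightarrow> f x = f y)"

lemma modularI: "(\<And>x y. [x = y] (mod int p) \<Longrightarrow> f x = f y) \<Longrightarrow> modular f"
  by (simp add: modular_def)

lemma modularD: "modular f \<Longrightarrow> [x = y] (mod int p) \<Longrightarrow> f x = f y"
  by (simp add: modular_def)

lemma sum_residues_reindex:
  assumes f: "modular f" and h: "\<And>x y. x \<in> resid \<Longrightarrow> y \<in> resid \<Longrightarrow> [h x = h y] (mod int p) \<Longrightarrow> x = y"
  shows "(\<Sum>x\<in>resid. f (h x)) = sum f resid"
proof -
  have "inj_on (\<lambda>x. h x mod int p) resid"
    by (intro inj_onI h) (simp_all add: cong_def)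
  moreover have "(\<lambda>x. h x mod int p) ` resid \<subseteq> resid" by auto
  ultimately have "bij_betw (\<lambda>x. h x mod int p) resid resid"
    by (simp add: bij_betw_def endo_inj_surj)
  hence "(\<Sum>x\<in>resid. f (h x mod int p)) = sum f resid" by (rule sum.reindex_bij_betw)
  moreover have "f (h x mod int p) = f (h x)" for x by (rule modularD[OF f]) (simp add: cong_def)
  ultimately show ?thesis by simp
qed

lemma cong_mult_cancel_p: "[a * x = a * y] (mod int p) \<Longrightarrow> \<not> int p dvd a \<Longrightarrow> [x = y] (mod int p)"
  by (rule cong_cancel1)

lemma sum_residues_scale:
  assumes f: "modular f" and a: "\<not> int p dvd a"
  shows "(\<Sum>x\<in>resid. f (a * x)) = sum f resid"
proof (rule sum_residues_reindex[OF f])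
  fix x y assume "x \<in> resid" "y \<in> resid" "[a * x = a * y] (mod int p)"
  thus "x = y" using cong_mult_cancel_p[OF _ a] residues_cong_eq by blast
qed

lemma sum_residues_affine:
  assumes f: "modular f" and a: "\<not> int p dvd a"
  shows "(\<Sum>x\<in>resid. f (a * x + b)) = sum f resid"
proof (rule sum_residues_reindex[OF f])
  fix x y assume "x \<in> resid" "y \<in> resid" "[a * x + b = a * y + b] (mod int p)"
  moreover from this have "[a * x = a * y] (mod int p)" by (simp add: cong_add_rcancel)
  ultimately show "x = y" using cong_mult_cancel_p[OF _ a] residues_cong_eq by blast
qed

lemma sum_residues_shift:
  assumes f: "modular f"
  shows "(\<Sum>x\<in>resid. f (x + b)) = sum f resid"
proof -
  have "\<not> int p dvd 1" using p_gt_2 by simp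
  from sum_residues_affine[OF f this, of b] show ?thesis by simp
qed

text \<open>
  A primitive root.  It serves to write the nonzero residues as powers.
\<close>

definition g :: int where "g = int (SOME x. residue_primroot p x)"

lemma primroot: "residue_primroot p (nat g)"
proof -
  have "\<exists>x. residue_primroot p x" using prime_p prime_primitive_root_exists prime_gt_1_nat by blast
  thus ?thesis unfolding g_def by (simp add: someI_ex)
qed

lemma g_nonneg: "g \<ge> 0" by (simp add: g_def)

lemma g_power_cong_1_iff: "[g ^ k = 1] (mod int p) \<longleftrightarrow> 2 * m dvd k"
proof -
  have "ord p (nat g) = 2 * m"
    using primroot prime_p p_eq by (simp add: residue_primroot_def totient_prime)
  moreover have "[g ^ k = 1] (mod int p) \<longleftrightarrow> [nat g ^ k = 1] (mod p)"
    using g_nonneg by (metis cong_int_iff int_nat_eq of_nat_1 of_nat_power)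
  ultimately show ?thesis using ord_divides[of "nat g" k p] by simp
qed

lemma not_dvd_g: "\<not> int p dvd g"
proof
  assume "int p dvd g"
  hence "[g ^ (2 * m) = 0] (mod int p)" using m_pos by (simp add: cong_0_iff prime_dvd_power_p)
  moreover have "[g ^ (2 * m) = 1] (mod int p)" by (simp add: g_power_cong_1_iff)
  ultimately have "[0 = 1] (mod int p)" by (metis cong_sym cong_trans)
  thus False using p_gt_2 by (simp add: cong_iff_dvd_diff)
qed

lemma not_dvd_g_power: "\<not> int p dvd g ^ k"
  using not_dvd_g prime_int_p by (metis prime_dvd_power)

lemma chi_g: "chi g = -1"
proof -
  have "chi g \<noteq> 1"
  proof
    assume "chi g = 1"
    hence "[g ^ m = 1] (mod int p)" using chi_cong_power[of g] by (simp add: cong_sym)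
    thus False using m_pos dvd_imp_le[of "2 * m" m] by (simp add: g_power_cong_1_iff)
  qed
  thus ?thesis using chi_range[of g] not_dvd_g chi_eq_0_iff[of g] by auto
qed

lemma sum_residues_primroot:
  assumes f: "modular f"
  shows "sum f resid = f 0 + (\<Sum>i<2 * m. f (g ^ i))"
proof -
  have "bij_betw (\<lambda>i. nat g ^ i mod p) {..<totient p} (totatives p)"
    using primroot p_gt_2 by (intro residue_primroot_is_generator) auto
  moreover have "totient p = 2 * m" using totient_prime[OF prime_p] p_eq by linarith
  ultimately have b: "bij_betw (\<lambda>i. nat g ^ i mod p) {..<2 * m} {0<..<p}"
    using totatives_prime[OF prime_p] by simp
  have "sum f resid = f 0 + sum f (resid - {0})"
    by (rule sum.remove) simp_all
  also have "sum f (resid - {0}) = (\<Sum>x\<in>{0<..<p}. f (int x))"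
    by (rule sum.reindex_bij_witness[of _ int nat]) (auto simp: resid_def)
  also have "\<dots> = (\<Sum>i<2 * m. f (int (nat g ^ i mod p)))"
    by (rule sum.reindex_bij_betw[OF b, symmetric])
  also have "\<dots> = (\<Sum>i<2 * m. f (g ^ i))"
    by (intro sum.cong refl modularD[OF f]) (simp add: zmod_int g_nonneg cong_def)
  finally show ?thesis .
qed

lemma primroot_exists_exponent:
  assumes "\<not> int p dvd D"
  shows "\<exists>i. [D = g ^ i] (mod int p)"
proof -
  have "bij_betw (\<lambda>i. nat g ^ i mod p) {..<totient p} (totatives p)"
    using primroot p_gt_2 by (intro residue_primroot_is_generator) auto
  moreover have "nat (D mod int p) \<in> totatives p"
  proof -
    have "D mod int p \<noteq> 0" using assms by (simp add: dvd_eq_mod_eq_0)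
    moreover have "0 \<le> D mod int p" "D mod int p < int p" using p_pos by simp_all
    ultimately show ?thesis unfolding totatives_prime[OF prime_p] by auto
  qed
  ultimately obtain i where "nat (D mod int p) = nat g ^ i mod p"
    by (metis (no_types, lifting) bij_betwE bij_betw_imp_surj_on imageE)
  hence "D mod int p = g ^ i mod int p"
    using p_pos g_nonneg by (metis Euclidean_Rings.pos_mod_sign int_nat_eq nat_int of_nat_0_less_iff of_nat_power zmod_int)
  thus ?thesis by (auto simp: cong_def)
qed

lemma modular_chi_poly: "(\<And>x y. [x = y] (mod int p) \<Longrightarrow> [h x = h y] (mod int p)) \<Longrightarrow> modular (\<lambda>x. chi (h x))"
  by (intro modularI chi_cong) simp

lemma modular_chi: "modular chi" by (intro modularI chi_cong)

lemma sum_chi: "sum chi resid = 0"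
proof -
  have "(\<Sum>x\<in>resid. chi (g * x)) = sum chi resid"
    by (rule sum_residues_scale[OF modular_chi not_dvd_g])
  hence "- sum chi resid = sum chi resid" by (simp add: chi_mult chi_g sum_negf)
  thus ?thesis by simp
qed

lemma sum_chi_square: "(\<Sum>x\<in>resid. chi x * chi x) = int p - 1"
proof -
  have "(\<Sum>x\<in>resid. chi x * chi x) = (\<Sum>x\<in>resid - {0}. 1)"
    by (rule sum.mono_neutral_cong_right) (auto simp: chi_mult_self residues_dvd_iff)
  thus ?thesis using p_pos by (simp add: card_Diff_subset)
qed

text \<open>
  After a shift the sum depends on \<open>c = b - a\<close> only.  Call it \<open>J(c)\<close>: scaling shows that it is the same for all
  nonzero \<open>c\<close>, and the total of all \<open>J(c)\<close> is zero because \<open>\<chi>\<close> has sum zero.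
\<close>

lemma sum_chi_quadratic: "(\<Sum>x\<in>resid. chi ((x + a) * (x + b))) = (if [a = b] (mod int p) then int p - 1 else -1)"
proof -
  define J where "J c = (\<Sum>x\<in>resid. chi (x * (x + c)))" for c
  have J_cong: "J c = J d" if "[c = d] (mod int p)" for c d
    unfolding J_def by (intro sum.cong chi_cong cong_mult cong_add that refl cong_refl)
  have J0: "J 0 = int p - 1" unfolding J_def using sum_chi_square by (simp add: chi_mult)
  have J_scale: "J (r * c) = J c" if r: "\<not> int p dvd r" for r c
  proof -
    have "J (r * c) = (\<Sum>x\<in>resid. chi ((r * x) * (r * x + r * c)))"
      unfolding J_def by (rule sum_residues_scale[symmetric, OF _ r])
        (intro modular_chi_poly cong_mult cong_add cong_refl)
    also have "\<dots> = (\<Sum>x\<in>resid. chi r * chi r * chi (x * (x + c)))"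
      by (rule sum.cong[OF refl]) (simp add: chi_mult[symmetric] algebra_simps)
    finally show ?thesis by (simp add: chi_mult_self[OF r] J_def)
  qed
  \<comment> \<open>Summing \<open>J\<close> over all shifts factors into two sums of \<open>chi\<close>, both zero.\<close>
  have J1: "J 1 = -1"
  proof -
    have "(\<Sum>c\<in>resid. J c) = (\<Sum>x\<in>resid. chi x * (\<Sum>c\<in>resid. chi (c + x)))"
      unfolding J_def by (subst sum.swap) (simp add: chi_mult sum_distrib_left add.commute)
    also have "\<dots> = 0" by (simp add: sum_residues_shift[OF modular_chi] sum_chi)
    finally have "J 0 + (\<Sum>c\<in>resid - {0}. J c) = 0"
      by (subst (asm) sum.remove[of _ 0]) simp_all
    moreover have "(\<Sum>c\<in>resid - {0}. J c) = (\<Sum>c\<in>resid - {0}. J 1)"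
      by (rule sum.cong[OF refl]) (use J_scale[of _ 1] in \<open>auto simp: residues_dvd_iff\<close>)
    ultimately have "(int p - 1) * (J 1 + 1) = 0"
      using J0 p_pos by (simp add: card_Diff_subset of_nat_diff algebra_simps)
    thus ?thesis using p_gt_2 by simp
  qed
  have "(\<Sum>x\<in>resid. chi ((x + a) * (x + b))) = (\<Sum>x\<in>resid. chi ((x + a) * (x + a + (b - a))))"
    by simp
  also have "\<dots> = J (b - a)"
    unfolding J_def by (rule sum_residues_shift) (intro modular_chi_poly cong_mult cong_add cong_refl)
  also have "\<dots> = (if [a = b] (mod int p) then int p - 1 else -1)"
  proof (cases "[a = b] (mod int p)")
    case True
    hence "[b - a = 0] (mod int p)" by (metis cong_diff_iff_cong_0 cong_sym)
    thus ?thesis using J_cong J0 True by auto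
  next
    case False
    hence "\<not> int p dvd b - a" by (metis cong_iff_dvd_diff cong_sym)
    thus ?thesis using J_scale[of "b - a" 1] J1 False by simp
  qed
  finally show ?thesis .
qed

text \<open>
  Replacing \<open>x\<close> by \<open>g x\<close> multiplies the sum by \<open>g^k\<close>, so it vanishes unless \<open>p - 1\<close> divides \<open>k\<close>.  The
  condition \<open>k > 0\<close> matters: for \<open>k = 0\<close> the term at \<open>x = 0\<close> counts as well.
\<close>

lemma power_sum_cong:
  "[(\<Sum>x\<in>resid. x ^ k) = (if k > 0 \<and> 2 * m dvd k then -1 else 0)] (mod int p)"
proof (cases "k > 0 \<and> 2 * m dvd k")
  case True
  have "(\<Sum>x\<in>resid. x ^ k) = (\<Sum>x\<in>resid - {0}. x ^ k)"
    using True by (intro sum.mono_neutral_right) auto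
  also have "[\<dots> = (\<Sum>x\<in>resid - {0}. 1)] (mod int p)"
  proof (rule cong_sum)
    fix x assume "x \<in> resid - {0}"
    hence "\<not> int p dvd x" by (simp add: residues_dvd_iff)
    hence "[x ^ (2 * m) = 1] (mod int p)"
      using chi_cong_power[of x, THEN cong_pow, of 2] chi_square[of x] by (simp add: cong_sym mult.commute flip: power_mult)
    thus "[x ^ k = 1] (mod int p)"
      using True by (metis cong_pow dvd_def power_mult power_one)
  qed
  also have "(\<Sum>x\<in>resid - {0}. 1) = int p - 1" using p_pos by (simp add: card_Diff_subset of_nat_diff)
  also have "[int p - 1 = -1] (mod int p)" by (simp add: cong_iff_dvd_diff)
  finally show ?thesis using True by simp
next
  case False
  show ?thesis
  proof (cases "k = 0")
    case True
    thus ?thesis by (simp add: cong_0_iff)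
  next
    case k: False
    define F where "F x = x ^ k mod int p" for x
    have F: "modular F" by (intro modularI) (metis F_def cong_def cong_pow)
    have "[(\<Sum>x\<in>resid. (g * x) ^ k) = (\<Sum>x\<in>resid. F (g * x))] (mod int p)"
      by (intro cong_sum) (simp add: F_def cong_def)
    also have "(\<Sum>x\<in>resid. F (g * x)) = sum F resid" by (rule sum_residues_scale[OF F not_dvd_g])
    also have "[\<dots> = (\<Sum>x\<in>resid. x ^ k)] (mod int p)"
      by (intro cong_sum) (simp add: F_def cong_def)
    finally have "[g ^ k * (\<Sum>x\<in>resid. x ^ k) = (\<Sum>x\<in>resid. x ^ k)] (mod int p)"
      by (simp add: power_mult_distrib sum_distrib_left)
    hence "int p dvd (g ^ k - 1) * (\<Sum>x\<in>resid. x ^ k)"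
      by (simp add: cong_iff_dvd_diff algebra_simps)
    moreover have "\<not> int p dvd g ^ k - 1"
      using False k g_power_cong_1_iff[of k] by (simp add: cong_iff_dvd_diff)
    ultimately show ?thesis using False by (auto simp: prime_dvd_mult_p cong_0_iff)
  qed
qed

lemma card_roots_of_unity:
  assumes e: "2 * m = e * M"
  shows "card {t \<in> resid. [t ^ e = 1] (mod int p)} = e"
proof -
  have pos: "e > 0" "M > 0" using e m_pos by (auto intro: Nat.gr0I)
  define F :: "int \<Rightarrow> int" where "F t = (if [t ^ e = 1] (mod int p) then 1 else 0)" for t
  have F: "modular F"
    by (intro modularI) (simp add: F_def, metis cong_pow cong_sym cong_trans)
  have root_iff: "[(g ^ i) ^ e = 1] (mod int p) \<longleftrightarrow> M dvd i" for i
    using pos by (simp add: g_power_cong_1_iff e mult.commute[of i] flip: power_mult)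
  have "int (card {t \<in> resid. [t ^ e = 1] (mod int p)}) = sum F resid"
    by (simp add: F_def sum.If_cases Int_def)
  also have "\<dots> = (\<Sum>i<2 * m. F (g ^ i))"
    using pos p_gt_2 by (simp add: sum_residues_primroot[OF F]) (simp add: F_def cong_iff_dvd_diff power_0_left)
  also have "\<dots> = int (card {i \<in> {..<e * M}. M dvd i})"
    unfolding F_def root_iff e by (simp add: sum.If_cases Int_def)
  also have "{i \<in> {..<e * M}. M dvd i} = (\<lambda>k. k * M) ` {..<e}"
    using pos by (auto elim!: dvdE simp: mult.commute)
  also have "card \<dots> = e" using pos by (subst card_image) (auto intro: inj_onI)
  finally show ?thesis by simp
qed

text \<open>
  The solutions of \<open>x^e \<equiv> y^e\<close> are the products of \<open>y\<close> with the \<open>e\<close>-th roots of unity.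
\<close>

lemma sum_over_equal_powers:
  fixes w :: "int \<Rightarrow> int"
  assumes w: "modular w" and y: "\<not> int p dvd y"
  shows "(\<Sum>x\<in>resid. if [x ^ e = y ^ e] (mod int p) then w x else 0) = (\<Sum>t | t \<in> resid \<and> [t ^ e = 1] (mod int p). w (y * t))"
proof -
  define f where "f x = (if [x ^ e = y ^ e] (mod int p) then w x else 0)" for x
  have "modular f"
    unfolding f_def by (intro modularI) (metis (no_types, lifting) cong_pow cong_sym cong_trans modularD[OF w])
  hence "sum f resid = (\<Sum>t\<in>resid. f (y * t))" using sum_residues_scale[OF _ y] by metis
  also have "\<dots> = (\<Sum>t\<in>resid. if [t ^ e = 1] (mod int p) then w (y * t) else 0)"
  proof (rule sum.cong[OF refl])
    fix t
    have ye: "\<not> int p dvd y ^ e" using y prime_int_p by (metis prime_dvd_power)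
    have "[(y * t) ^ e = y ^ e] (mod int p) \<longleftrightarrow> [y ^ e * t ^ e = y ^ e * 1] (mod int p)"
      by (simp add: power_mult_distrib)
    also have "\<dots> \<longleftrightarrow> [t ^ e = 1] (mod int p)"
      using cong_mult_cancel_p[OF _ ye] cong_mult[OF cong_refl] by metis
    finally show "f (y * t) = (if [t ^ e = 1] (mod int p) then w (y * t) else 0)" by (simp add: f_def)
  qed
  also have "\<dots> = (\<Sum>t | t \<in> resid \<and> [t ^ e = 1] (mod int p). w (y * t))"
    by (simp add: sum.If_cases Int_def)
  finally show ?thesis unfolding f_def .
qed

text \<open>
  If \<open>F\<close> depends only on the class of \<open>D\<close> modulo \<open>e\<close>-th powers, then the sum of \<open>F\<close> over \<open>D, g D, ..., g^(e-1) D\<close>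
  is the same for every nonzero \<open>D\<close>: it covers each class equally often.
\<close>

lemma class_function_average:
  fixes F :: "int \<Rightarrow> int"
  assumes F: "modular F" and F0: "F 0 = 0"
    and inv: "\<And>D r. \<not> int p dvd r \<Longrightarrow> F (D * r ^ e) = F D"
  shows "int e * sum F resid = (int p - 1) * (\<Sum>i<e. F (g ^ i))"
proof -
  have K: "(\<Sum>i<e. F (g ^ i * g ^ k)) = (\<Sum>i<e. F (g ^ i))" for k
  proof (induction k)
    case (Suc k)
    have "(\<Sum>i<e. F (g ^ i * g ^ Suc k)) + F (g ^ k) = (\<Sum>i<Suc e. F (g ^ i * g ^ k))"
      by (subst sum.lessThan_Suc_shift) (simp add: mult_ac)
    also have "\<dots> = (\<Sum>i<e. F (g ^ i * g ^ k)) + F (g ^ k)"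
      using inv[OF not_dvd_g, of "g ^ k"] by (simp add: mult.commute)
    finally show ?case using Suc by simp
  qed simp
  have "(\<Sum>D\<in>resid. \<Sum>i<e. F (g ^ i * D)) = (\<Sum>i<e. sum F resid)"
    by (subst sum.swap) (simp add: sum_residues_scale[OF F not_dvd_g_power])
  hence "int e * sum F resid = (\<Sum>D\<in>resid. \<Sum>i<e. F (g ^ i * D))" by simp
  also have "\<dots> = (\<Sum>D\<in>resid - {0}. \<Sum>i<e. F (g ^ i * D))"
    by (rule sum.mono_neutral_right) (auto simp: F0)
  also have "\<dots> = (\<Sum>D\<in>resid - {0}. \<Sum>i<e. F (g ^ i))"
  proof (rule sum.cong[OF refl])
    fix D assume "D \<in> resid - {0}"
    hence "\<not> int p dvd D" by (simp add: residues_dvd_iff)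
    then obtain k where k: "[D = g ^ k] (mod int p)" using primroot_exists_exponent by blast
    have "(\<Sum>i<e. F (g ^ i * D)) = (\<Sum>i<e. F (g ^ i * g ^ k))"
      by (intro sum.cong refl modularD[OF F] cong_mult cong_refl k)
    thus "(\<Sum>i<e. F (g ^ i * D)) = (\<Sum>i<e. F (g ^ i))" unfolding K .
  qed
  also have "\<dots> = (int p - 1) * (\<Sum>i<e. F (g ^ i))"
    using p_pos by (simp add: card_Diff_subset of_nat_diff)
  finally show ?thesis .
qed

section \<open>The sums of chi(x^3 + D)\<close>

definition cubic_sum :: "int \<Rightarrow> int" where
  "cubic_sum D = (\<Sum>x\<in>resid. chi (x ^ 3 + D))"

lemma modular_cubic_sum: "modular cubic_sum"
  unfolding cubic_sum_def by (intro modularI sum.cong refl chi_cong cong_add cong_refl)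

lemma cubic_sum_scale:
  assumes r: "\<not> int p dvd r"
  shows "cubic_sum (D * r ^ 3) = chi r * cubic_sum D"
proof -
  have "cubic_sum (D * r ^ 3) = (\<Sum>x\<in>resid. chi ((r * x) ^ 3 + D * r ^ 3))"
    unfolding cubic_sum_def
    by (rule sum_residues_scale[symmetric, OF _ r]) (intro modular_chi_poly cong_add cong_pow cong_refl)
  also have "\<dots> = (\<Sum>x\<in>resid. chi r ^ 3 * chi (x ^ 3 + D))"
    by (rule sum.cong[OF refl]) (simp add: chi_mult[symmetric] chi_power[symmetric] algebra_simps power_mult_distrib)
  also have "chi r ^ 3 = chi r" using chi_square[OF r] by (simp add: power3_eq_cube power2_eq_square)
  finally show ?thesis by (simp add: cubic_sum_def sum_distrib_left)
qed

lemma cubic_sum_eq_0: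
  assumes "p mod 3 = 2"
  shows "cubic_sum D = 0"
proof -
  define q where "q = p div 3"
  have p: "p = 3 * q + 2" using assms unfolding q_def by presburger
  have "(\<Sum>x\<in>resid. chi (x ^ 3 + D)) = (\<Sum>x\<in>resid. chi (x + D))"
  proof (rule sum_residues_reindex[where f = "\<lambda>x. chi (x + D)"])
    show "modular (\<lambda>x. chi (x + D))" by (intro modular_chi_poly cong_add cong_refl)
    fix x y assume xy: "x \<in> resid" "y \<in> resid" "[x ^ 3 = y ^ 3] (mod int p)"
    have cube_root: "[(x ^ 3) ^ (2 * q + 1) = x] (mod int p)" for x
    proof (cases "int p dvd x")
      case True
      thus ?thesis unfolding cong_iff_dvd_diff by (intro dvd_diff) (simp_all add: prime_dvd_power_p)
    next
      case False
      have "(x ^ 3) ^ (2 * q + 1) = (x ^ m) ^ 4 * x"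
      proof -
        have "3 * (2 * q + 1) = m * 4 + 1" using p p_eq by presburger
        thus ?thesis by (metis power_Suc2 power_mult Suc_eq_plus1)
      qed
      also have "[\<dots> = chi x ^ 4 * x] (mod int p)"
        by (intro cong_mult cong_pow cong_refl cong_sym[OF chi_cong_power])
      finally show ?thesis using chi_even_power[OF False, of 4] by simp
    qed
    have "[x = y] (mod int p)" using cube_root[of x] cube_root[of y] cong_pow[OF xy(3), of "2 * q + 1"]
      by (metis cong_sym cong_trans)
    thus "x = y" using xy residues_cong_eq by blast
  qed
  thus ?thesis using sum_residues_shift[OF modular_chi, of D] sum_chi by (simp add: cubic_sum_def)
qed

text \<open>
  Exchanging the sums leaves quadratic sums, each of which is \<open>p - 1\<close> or \<open>-1\<close>; so the total is \<open>p N - p^2\<close>, where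
  \<open>N = 3 p - 2\<close> is the number of pairs with \<open>x^3 \<equiv> y^3\<close>.
\<close>

lemma cubic_sum_square_total:
  assumes "p mod 3 = 1"
  shows "(\<Sum>D\<in>resid. cubic_sum D ^ 2) = 2 * int p * (int p - 1)"
proof -
  have M: "2 * m = 3 * (p div 3)" using assms p_eq by presburger
  have "(\<Sum>D\<in>resid. cubic_sum D ^ 2) = (\<Sum>D\<in>resid. \<Sum>y\<in>resid. \<Sum>x\<in>resid. chi ((D + x ^ 3) * (D + y ^ 3)))"
    by (simp add: cubic_sum_def power2_eq_square sum_product chi_mult add.commute) (subst sum.swap, simp add: mult.commute)
  also have "\<dots> = (\<Sum>y\<in>resid. \<Sum>x\<in>resid. \<Sum>D\<in>resid. chi ((D + x ^ 3) * (D + y ^ 3)))"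
    by (subst sum.swap) (intro sum.cong refl sum.swap)
  also have "\<dots> = (\<Sum>y\<in>resid. \<Sum>x\<in>resid. (if [x ^ 3 = y ^ 3] (mod int p) then int p else 0) - 1)"
    unfolding sum_chi_quadratic by (intro sum.cong) auto
  also have "\<dots> = (\<Sum>y\<in>resid. (if y = 0 then int p else 3 * int p) - int p)"
  proof (rule sum.cong[OF refl])
    fix y assume y: "y \<in> resid"
    have "(\<Sum>x\<in>resid. if [x ^ 3 = y ^ 3] (mod int p) then int p else 0) = (if y = 0 then int p else 3 * int p)"
    proof (cases "y = 0")
      case True
      hence "(\<Sum>x\<in>resid. if [x ^ 3 = y ^ 3] (mod int p) then int p else 0) = (\<Sum>x\<in>resid. if x = 0 then int p else 0)"
        by (intro sum.cong refl) (auto simp: cong_0_iff residues_dvd_iff prime_dvd_power_p)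
      thus ?thesis using True by simp
    next
      case False
      have "modular (\<lambda>x. int p)" by (simp add: modular_def)
      from sum_over_equal_powers[OF this, of y 3] show ?thesis
        using False y card_roots_of_unity[OF M] by (simp add: residues_dvd_iff)
    qed
    thus "(\<Sum>x\<in>resid. (if [x ^ 3 = y ^ 3] (mod int p) then int p else 0) - 1) = (if y = 0 then int p else 3 * int p) - int p"
      by (simp add: sum_subtractf)
  qed
  also have "\<dots> = (\<Sum>y\<in>resid. 2 * int p - (if y = 0 then 2 * int p else 0))"
    by (intro sum.cong) auto
  also have "\<dots> = 2 * int p * (int p - 1)" by (simp add: sum_subtractf algebra_simps)
  finally show ?thesis .
qed

text \<open>
  Modulo 2 the sum counts the \<open>x\<close> with \<open>x^3 + 1\<close> nonzero, and there are \<open>p - 3\<close> of them.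
\<close>

lemma even_cubic_sum_1:
  assumes "p mod 3 = 1"
  shows "even (cubic_sum 1)"
proof -
  have M: "2 * m = 3 * (p div 3)" using assms p_eq by presburger
  have odd_iff: "odd (chi a) \<longleftrightarrow> \<not> int p dvd a" for a
    using chi_range[of a] by (auto simp flip: chi_eq_0_iff)
  have "even (cubic_sum 1) \<longleftrightarrow> even (card {x \<in> resid. odd (chi (x ^ 3 + 1))})"
    unfolding cubic_sum_def by (rule even_sum_iff) simp
  also have "{x \<in> resid. odd (chi (x ^ 3 + 1))} = resid - {x \<in> resid. int p dvd x ^ 3 + 1}"
    by (auto simp: odd_iff)
  also have "card \<dots> = p - card {x \<in> resid. int p dvd x ^ 3 + 1}"
    by (subst card_Diff_subset) auto
  also have "card {x \<in> resid. int p dvd x ^ 3 + 1} = card {t \<in> resid. [t ^ 3 = 1] (mod int p)}"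
  proof -
    define F :: "int \<Rightarrow> int" where "F x = (if int p dvd x ^ 3 + 1 then 1 else 0)" for x
    have dvd_cong: "int p dvd a \<longleftrightarrow> int p dvd b" if "[a = b] (mod int p)" for a b
      using that by (rule cong_dvd_iff[OF cong_sym, THEN sym]) 
    have F: "modular F" unfolding F_def
      by (intro modularI if_cong refl dvd_cong cong_add cong_pow cong_refl)
    have "\<not> int p dvd -1" using p_gt_2 by simp
    from sum_residues_scale[OF F this]
    have "(\<Sum>x\<in>resid. F (- x)) = sum F resid" by simp
    moreover have "F (- x) = (if [x ^ 3 = 1] (mod int p) then 1 else 0)" for x
      by (simp add: F_def cong_iff_dvd_diff) (metis dvd_minus_iff minus_diff_eq add.commute uminus_add_conv_diff)
    ultimately have "(\<Sum>x\<in>resid. if [x ^ 3 = 1] (mod int p) then 1 else 0) = sum F resid" by (simp only:)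
    hence "int (card {t \<in> resid. [t ^ 3 = 1] (mod int p)}) = int (card {x \<in> resid. int p dvd x ^ 3 + 1})"
      by (simp add: F_def sum.If_cases Int_def)
    thus ?thesis by simp
  qed
  also have "\<dots> = 3" by (rule card_roots_of_unity[OF M])
  finally show ?thesis using p_gt_2 odd_p by simp
qed

text \<open>
  The values \<open>a, b, c\<close> of \<open>\<chi>(D) S(D)\<close> at \<open>D = 1, g, g^2\<close> satisfy \<open>a + b + c = 0\<close> and \<open>a^2 + b^2 + c^2 = 6 p\<close>, that
  is, \<open>a^2 + a b + b^2 = 3 p\<close>.  As \<open>a = 2 u\<close> is even, this can be rewritten as \<open>(b + u)^2 + 3 u^2 = 3 p\<close>.
\<close>

lemma cubic_sum_representation:
  assumes "p mod 3 = 1"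
  shows "\<exists>u v. cubic_sum 1 = 2 * u \<and> int p = u ^ 2 + 3 * v ^ 2"
proof -
  define T where "T D = chi D * cubic_sum D" for D
  have T: "modular T" unfolding T_def
    by (intro modularI) (metis chi_cong modularD[OF modular_cubic_sum])
  have T0: "T 0 = 0" by (simp add: T_def)
  have inv: "T (D * r ^ 3) = T D" if r: "\<not> int p dvd r" for D r
  proof -
    have "T (D * r ^ 3) = chi D * cubic_sum D * (chi r ^ 4)"
      unfolding T_def cubic_sum_scale[OF r] chi_mult chi_power by (simp add: eval_nat_numeral mult_ac)
    thus ?thesis using chi_even_power[OF r, of 4] by (simp add: T_def)
  qed
  have sum_T: "sum T resid = 0"
  proof -
    have "sum T resid = (\<Sum>x\<in>resid. \<Sum>D\<in>resid. chi ((D + 0) * (D + x ^ 3)))"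
      unfolding T_def cubic_sum_def sum_distrib_left by (subst sum.swap) (simp add: chi_mult add.commute)
    also have "\<dots> = (\<Sum>x\<in>resid. (if x = 0 then int p else 0) - 1)"
      unfolding sum_chi_quadratic
      by (intro sum.cong refl) (auto simp: cong_sym_eq[of 0] cong_0_iff residues_dvd_iff prime_dvd_power_p)
    finally show ?thesis by (simp add: sum_subtractf)
  qed
  have c0: "cubic_sum 0 = 0"
  proof -
    have "chi (x ^ 3) = chi x" for x using chi_range[of x] by (auto simp: chi_power)
    hence "cubic_sum 0 = sum chi resid" by (simp add: cubic_sum_def)
    thus ?thesis by (simp add: sum_chi)
  qed
  have T_sq: "T D ^ 2 = cubic_sum D ^ 2" for D
  proof (cases "int p dvd D")
    case True
    hence "cubic_sum D = 0" using modularD[OF modular_cubic_sum, of D 0] c0 by (simp add: cong_0_iff)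
    thus ?thesis by (simp add: T_def)
  qed (simp add: T_def power_mult_distrib chi_square)
  define a b c where "a = T 1" and "b = T g" and "c = T (g ^ 2)"
  have "int 3 * sum T resid = (int p - 1) * (\<Sum>i<3. T (g ^ i))"
    by (rule class_function_average[OF T T0 inv])
  hence s1: "a + b + c = 0"
    using sum_T p_gt_2 by (simp add: eval_nat_numeral a_def b_def c_def)
  have "int 3 * (\<Sum>D\<in>resid. T D ^ 2) = (int p - 1) * (\<Sum>i<3. T (g ^ i) ^ 2)"
    by (rule class_function_average) (use T inv in \<open>auto simp: T0 modular_def\<close>)
  moreover have "(\<Sum>i<3. T (g ^ i) ^ 2) = a ^ 2 + b ^ 2 + c ^ 2"
    by (simp add: eval_nat_numeral a_def b_def c_def)
  moreover have "(\<Sum>D\<in>resid. T D ^ 2) = 2 * int p * (int p - 1)"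
    unfolding T_sq by (rule cubic_sum_square_total[OF assms])
  ultimately have "(int p - 1) * (6 * int p) = (int p - 1) * (a ^ 2 + b ^ 2 + c ^ 2)"
    by (simp add: mult_ac)
  hence s2: "a ^ 2 + b ^ 2 + c ^ 2 = 6 * int p" using p_gt_2 by simp
  have a: "a = cubic_sum 1" by (simp add: a_def T_def)
  obtain u where u: "a = 2 * u" using even_cubic_sum_1[OF assms] unfolding a by (auto elim: evenE)
  have c: "c = - a - b" using s1 by simp
  have eq: "(b + u) ^ 2 + 3 * u ^ 2 = 3 * int p"
    using s2 unfolding c u by (simp add: power2_eq_square algebra_simps)
  hence "3 dvd (b + u) ^ 2" by presburger
  hence "3 dvd b + u" using prime_dvd_power[of "3 :: int" "b + u" 2] by simp
  then obtain v where "b + u = 3 * v" by (auto elim: dvdE)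
  hence "int p = u ^ 2 + 3 * v ^ 2" using eq by (simp add: power2_eq_square)
  moreover have "cubic_sum 1 = 2 * u" using u a by simp
  ultimately show ?thesis by blast
qed



section \<open>The sums of chi(x (x^4 + D)) for primes 1 modulo 8\<close>

definition quintic_sum :: "int \<Rightarrow> int" where
  "quintic_sum D = (\<Sum>x\<in>resid. chi (x * (x ^ 4 + D)))"

lemma modular_quintic_sum: "modular quintic_sum"
  unfolding quintic_sum_def by (intro modularI sum.cong refl chi_cong cong_mult cong_add cong_refl)

lemma quintic_sum_scale:
  assumes r: "\<not> int p dvd r"
  shows "quintic_sum (D * r ^ 4) = chi r * quintic_sum D"
proof -
  have "quintic_sum (D * r ^ 4) = (\<Sum>x\<in>resid. chi ((r * x) * ((r * x) ^ 4 + D * r ^ 4)))"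
    unfolding quintic_sum_def
    by (rule sum_residues_scale[symmetric, OF _ r]) (intro modular_chi_poly cong_mult cong_add cong_pow cong_refl)
  also have "\<dots> = (\<Sum>x\<in>resid. chi r ^ 5 * chi (x * (x ^ 4 + D)))"
  proof (rule sum.cong[OF refl])
    fix x
    have "(r * x) * ((r * x) ^ 4 + D * r ^ 4) = r ^ 5 * (x * (x ^ 4 + D))"
      by (simp add: eval_nat_numeral algebra_simps)
    thus "chi ((r * x) * ((r * x) ^ 4 + D * r ^ 4)) = chi r ^ 5 * chi (x * (x ^ 4 + D))"
      by (simp only: chi_mult chi_power)
  qed
  also have "chi r ^ 5 = chi r" using chi_range[of r] by auto
  finally show ?thesis by (simp add: quintic_sum_def sum_distrib_left)
qed

lemma quintic_sum_0: "quintic_sum 0 = 0"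
proof -
  have "chi (x * (x ^ 4 + 0)) = chi x" for x
    using chi_range[of x] by (auto simp: chi_power chi_mult)
  thus ?thesis by (simp add: quintic_sum_def sum_chi)
qed

text \<open>
  Substitute \<open>x \<mapsto> 1/x\<close>, written as the power \<open>x^(p-2)\<close>, and multiply by the square \<open>x^6\<close>.
\<close>

lemma quintic_sum_inverse:
  assumes DE: "[D * E = 1] (mod int p)"
  shows "quintic_sum D = chi D * quintic_sum E"
proof -
  have inv: "[x * x ^ (2 * m - 1) = 1] (mod int p)" if "\<not> int p dvd x" for x
  proof -
    have "x * x ^ (2 * m - 1) = (x ^ m) ^ 2" using m_pos by (simp add: mult.commute flip: power_mult power_Suc)
    also have "[\<dots> = chi x ^ 2] (mod int p)" by (intro cong_pow cong_sym[OF chi_cong_power])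
    finally show ?thesis using chi_square[OF that] by simp
  qed
  have "(\<Sum>x\<in>resid. chi (x ^ (2 * m - 1) * ((x ^ (2 * m - 1)) ^ 4 + E))) = quintic_sum E"
    unfolding quintic_sum_def
  proof (rule sum_residues_reindex[where f = "\<lambda>x. chi (x * (x ^ 4 + E))"])
    show "modular (\<lambda>x. chi (x * (x ^ 4 + E)))" by (intro modular_chi_poly cong_mult cong_add cong_pow cong_refl)
    fix x y assume xy: "x \<in> resid" "y \<in> resid" "[x ^ (2 * m - 1) = y ^ (2 * m - 1)] (mod int p)"
    have pos: "2 * m - 1 > 0" using m_pos by simp
    have dvd_iff: "int p dvd x \<longleftrightarrow> int p dvd y"
      using cong_dvd_iff[OF xy(3)] cong_0_iff xy(3) prime_dvd_power_p[OF pos] by (metis cong_sym cong_trans)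
    have "[x = y] (mod int p)"
    proof (cases "int p dvd x")
      case True
      thus ?thesis using dvd_iff by (simp add: cong_iff_dvd_diff)
    next
      case False
      have "[x * y ^ (2 * m - 1) * y = y] (mod int p)"
        using cong_mult[OF cong_trans[OF cong_mult[OF cong_refl cong_sym[OF xy(3)]] inv[OF False]] cong_refl, of y] by simp
      moreover have "[x * (y * y ^ (2 * m - 1)) = x * 1] (mod int p)"
        using False dvd_iff by (intro cong_mult cong_refl inv) simp
      ultimately show ?thesis by (metis cong_sym cong_trans mult.assoc mult.commute mult_1_right)
    qed
    thus "x = y" using xy residues_cong_eq by blast
  qed
  note eq = this
  have "chi D * quintic_sum E = (\<Sum>x\<in>resid. chi (D * (x ^ (2 * m - 1) * ((x ^ (2 * m - 1)) ^ 4 + E))))"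
    unfolding eq[symmetric] sum_distrib_left chi_mult ..
  also have "\<dots> = quintic_sum D"
    unfolding quintic_sum_def
  proof (rule sum.cong[OF refl])
    fix x assume "x \<in> resid"
    define y where "y = x ^ (2 * m - 1)"
    show "chi (D * (x ^ (2 * m - 1) * ((x ^ (2 * m - 1)) ^ 4 + E))) = chi (x * (x ^ 4 + D))"
      unfolding y_def[symmetric]
    proof (cases "int p dvd x")
      case True
      moreover have "int p dvd y" using True m_pos by (simp add: y_def prime_dvd_power_p)
      ultimately have "chi (D * (y * (y ^ 4 + E))) = 0" "chi (x * (x ^ 4 + D)) = 0"
        unfolding chi_eq_0_iff by simp_all
      thus "chi (D * (y * (y ^ 4 + E))) = chi (x * (x ^ 4 + D))" by simp
    next
      case False
      have xy: "[x * y = 1] (mod int p)" unfolding y_def by (rule inv[OF False])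
      have "chi (D * (y * (y ^ 4 + E))) = chi (x ^ 6) * chi (D * (y * (y ^ 4 + E)))"
        using chi_even_power[OF False, of 6] by (simp add: chi_power)
      also have "\<dots> = chi ((x * y) * (x * ((x * y) ^ 4 * D + x ^ 4 * (D * E))))"
        unfolding chi_mult[symmetric] by (rule arg_cong[of _ _ chi]) (simp add: eval_nat_numeral algebra_simps)
      also have "\<dots> = chi (1 * (x * (1 ^ 4 * D + x ^ 4 * 1)))"
        by (intro chi_cong cong_mult cong_add cong_pow cong_refl xy DE)
      finally show "chi (D * (y * (y ^ 4 + E))) = chi (x * (x ^ 4 + D))" by (simp add: add.commute)
    qed
  qed
  finally show ?thesis by simp
qed

text \<open>
  All fourth roots of unity are squares here, because 8 divides \<open>p - 1\<close>; so each of the four solutions \<open>x\<close> of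
  \<open>x^4 \<equiv> y^4\<close> has \<open>\<chi>(x) = \<chi>(y)\<close>.
\<close>

lemma quintic_sum_square_total:
  assumes "p mod 8 = 1"
  shows "(\<Sum>D\<in>resid. quintic_sum D ^ 2) = 4 * int p * (int p - 1)"
proof -
  have M: "2 * m = 4 * (p div 4)" using assms p_eq by presburger
  have "(\<Sum>D\<in>resid. quintic_sum D ^ 2) = (\<Sum>D\<in>resid. \<Sum>y\<in>resid. \<Sum>x\<in>resid. chi x * chi y * chi ((D + x ^ 4) * (D + y ^ 4)))"
    by (simp add: quintic_sum_def power2_eq_square sum_product chi_mult add.commute) (subst sum.swap, simp add: mult_ac)
  also have "\<dots> = (\<Sum>y\<in>resid. \<Sum>x\<in>resid. \<Sum>D\<in>resid. chi x * chi y * chi ((D + x ^ 4) * (D + y ^ 4)))"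
    by (subst sum.swap) (intro sum.cong refl sum.swap)
  also have "\<dots> = (\<Sum>y\<in>resid. \<Sum>x\<in>resid. int p * chi y * (if [x ^ 4 = y ^ 4] (mod int p) then chi x else 0) - chi y * chi x)"
    unfolding sum_distrib_left[symmetric] sum_chi_quadratic by (intro sum.cong refl) (simp add: algebra_simps)
  also have "\<dots> = (\<Sum>y\<in>resid. int p * chi y * (\<Sum>x\<in>resid. if [x ^ 4 = y ^ 4] (mod int p) then chi x else 0))"
    by (simp add: sum_subtractf sum_distrib_left[symmetric] sum_chi)
  also have "\<dots> = (\<Sum>y\<in>resid. 4 * int p * (chi y * chi y))"
  proof (rule sum.cong[OF refl])
    fix y assume y: "y \<in> resid"
    show "int p * chi y * (\<Sum>x\<in>resid. if [x ^ 4 = y ^ 4] (mod int p) then chi x else 0) = 4 * int p * (chi y * chi y)"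
    proof (cases "y = 0")
      case False
      have "(\<Sum>x\<in>resid. if [x ^ 4 = y ^ 4] (mod int p) then chi x else 0) = (\<Sum>t | t \<in> resid \<and> [t ^ 4 = 1] (mod int p). chi (y * t))"
        by (rule sum_over_equal_powers[OF modular_chi]) (use False y in \<open>simp add: residues_dvd_iff\<close>)
      also have "\<dots> = (\<Sum>t | t \<in> resid \<and> [t ^ 4 = 1] (mod int p). chi y)"
      proof (rule sum.cong[OF refl])
        fix t assume "t \<in> {t. t \<in> resid \<and> [t ^ 4 = 1] (mod int p)}"
        hence "[(t ^ 4) ^ (p div 8) = 1 ^ (p div 8)] (mod int p)" by (intro cong_pow) simp
        moreover have "m = 4 * (p div 8)" using assms p_eq by presburger
        ultimately have "[t ^ m = 1] (mod int p)" by (metis power_mult power_one)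
        hence "chi t = 1" by (intro chi_eqI) simp_all
        thus "chi (y * t) = chi y" by (simp add: chi_mult)
      qed
      also have "\<dots> = 4 * chi y" using card_roots_of_unity[OF M] by simp
      finally show ?thesis by simp
    qed simp
  qed
  also have "\<dots> = 4 * int p * (int p - 1)" by (simp add: sum_distrib_left[symmetric] sum_chi_square)
  finally show ?thesis .
qed

text \<open>
  The average over the four classes gives that the squares at \<open>1, g, g^2, g^3\<close> add up to \<open>16 p\<close>.  Inversion
  maps the class of \<open>g\<close> to that of \<open>g^3\<close>, and it maps the class of \<open>g^2\<close> to itself with a change of sign.
\<close>

lemma quintic_sum_norm:
  assumes "p mod 8 = 1"
  shows "quintic_sum 1 ^ 2 + 2 * quintic_sum g ^ 2 = 16 * int p"
proof -
  define j where "j = p div 8"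
  have pj: "p = 8 * j + 1" and mj: "m = 4 * j" and j: "j > 0"
    unfolding j_def using assms p_eq p_gt_2 by presburger+
  have g_inv: "[g ^ i * g ^ (2 * m - i) = 1] (mod int p)" if "i \<le> 2 * m" for i
    using that by (simp add: g_power_cong_1_iff flip: power_add)
  \<comment> \<open>Inversion combined with a fourth power \<open>g^(4l)\<close>: the exponents \<open>i\<close> and \<open>k\<close> may be exchanged if \<open>i + k + 4 l = p - 1\<close>.\<close>
  have step: "quintic_sum (g ^ i) = chi (g ^ i) * chi (g ^ l) * quintic_sum (g ^ k)" if "i + k + 4 * l = 2 * m" for i k l
  proof -
    have "quintic_sum (g ^ i) = chi (g ^ i) * quintic_sum (g ^ (2 * m - i))"
      using that by (intro quintic_sum_inverse g_inv) simp
    also have "2 * m - i = k + l * 4" using that by simp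
    also have "quintic_sum (g ^ (k + l * 4)) = chi (g ^ l) * quintic_sum (g ^ k)"
      unfolding power_add power_mult by (rule quintic_sum_scale[OF not_dvd_g_power])
    finally show ?thesis by simp
  qed
  have odd_exp: "odd (2 * j - 1)" using j by simp
  have "quintic_sum (g ^ 2) = - quintic_sum (g ^ 2)"
    using step[of 2 2 "2 * j - 1"] j odd_exp by (simp add: mj chi_power chi_g)
  hence q2: "quintic_sum (g ^ 2) = 0" by simp
  have q3: "quintic_sum g = quintic_sum (g ^ 3)"
    using step[of 1 3 "2 * j - 1"] j odd_exp by (simp add: mj chi_power chi_g)
  have "int 4 * (\<Sum>D\<in>resid. quintic_sum D ^ 2) = (int p - 1) * (\<Sum>i<4. quintic_sum (g ^ i) ^ 2)"
  proof (rule class_function_average)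
    show "modular (\<lambda>D. (quintic_sum D)\<^sup>2)"
      using modularD[OF modular_quintic_sum] by (intro modularI) metis
    show "(quintic_sum (D * r ^ 4))\<^sup>2 = (quintic_sum D)\<^sup>2" if "\<not> int p dvd r" for D r
      using that by (simp add: quintic_sum_scale power_mult_distrib chi_square)
  qed (simp add: quintic_sum_0)
  hence "(int p - 1) * (16 * int p) = (int p - 1) * (quintic_sum 1 ^ 2 + 2 * quintic_sum g ^ 2)"
    unfolding quintic_sum_square_total[OF assms] using q2 q3 by (simp add: eval_nat_numeral mult_ac)
  thus ?thesis using p_gt_2 by simp
qed

text \<open>
  Among the exponents \<open>m + 4 k\<close> in the expansion of \<open>(x (x^4 + 1))^m\<close> only those for \<open>k = j\<close> and \<open>k = 3 j\<close> are
  multiples of \<open>p - 1\<close>, where \<open>m = 4 j\<close>.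
\<close>

lemma quintic_sum_cong_binomial:
  assumes "p mod 8 = 1"
  shows "[quintic_sum 1 = - 2 * int (m choose (p div 8))] (mod int p)"
proof -
  define j where "j = p div 8"
  have mj: "m = 4 * j" and j: "j > 0"
    unfolding j_def using assms p_eq p_gt_2 by presburger+
  have "[quintic_sum 1 = (\<Sum>x\<in>resid. (x * (x ^ 4 + 1)) ^ m)] (mod int p)"
    unfolding quintic_sum_def by (intro cong_sum chi_cong_power)
  also have "(\<Sum>x\<in>resid. (x * (x ^ 4 + 1)) ^ m) = (\<Sum>x\<in>resid. \<Sum>k\<le>m. int (m choose k) * x ^ (m + 4 * k))"
    by (rule sum.cong[OF refl])
       (simp add: power_mult_distrib binomial_ring sum_distrib_left power_add mult.left_commute flip: power_mult)
  also have "\<dots> = (\<Sum>k\<le>m. int (m choose k) * (\<Sum>x\<in>resid. x ^ (m + 4 * k)))"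
    by (subst sum.swap) (simp add: sum_distrib_left)
  also have "[\<dots> = (\<Sum>k\<le>m. int (m choose k) * (if m + 4 * k > 0 \<and> 2 * m dvd m + 4 * k then -1 else 0))] (mod int p)"
    by (intro cong_sum cong_mult cong_refl power_sum_cong)
  also have "(\<Sum>k\<le>m. int (m choose k) * (if m + 4 * k > 0 \<and> 2 * m dvd m + 4 * k then -1 else 0))
     = (\<Sum>k\<in>{j, 3 * j}. - int (m choose k))"
  proof (rule sum.mono_neutral_cong_right)
    have "2 * m dvd m + 4 * k \<longleftrightarrow> k = j \<or> k = 3 * j" if "k \<le> m" for k
    proof
      assume "2 * m dvd m + 4 * k"
      hence "2 * (4 * j) dvd 4 * (j + k)" by (simp add: mj algebra_simps)
      then obtain c where "4 * (j + k) = 2 * (4 * j) * c" by (elim dvdE)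
      hence c: "j + k = 2 * j * c" by simp
      have "2 * j * c \<le> 5 * j" using c that mj by linarith
      hence "j * (2 * c) \<le> j * 5" by (simp only: mult_ac)
      hence "2 * c \<le> 5" using j by simp
      hence "c \<le> 2" by simp
      moreover have "c \<noteq> 0" using c j by (intro notI) simp
      ultimately have "c = 1 \<or> c = 2" by linarith
      thus "k = j \<or> k = 3 * j" using c by auto
    qed (auto simp: mj)
    thus "\<forall>k\<in>{..m} - {j, 3 * j}. int (m choose k) * (if m + 4 * k > 0 \<and> 2 * m dvd m + 4 * k then -1 else 0) = 0"
      and "\<And>k. k \<in> {j, 3 * j} \<Longrightarrow> int (m choose k) * (if m + 4 * k > 0 \<and> 2 * m dvd m + 4 * k then -1 else 0) = - int (m choose k)"
      using mj m_pos by auto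
  qed (auto simp: mj)
  also have "\<dots> = - 2 * int (m choose j)"
    using j binomial_symmetric[of j m] mj by simp
  finally show ?thesis unfolding j_def .
qed

end

section \<open>Gaussian integers\<close>

datatype gint = GInt (re: int) (im: int)

instantiation gint :: comm_ring_1
begin

definition "0 = GInt 0 0"
definition "1 = GInt 1 0"
definition "z + w = GInt (re z + re w) (im z + im w)"
definition "z - w = GInt (re z - re w) (im z - im w)"
definition "- z = GInt (- re z) (- im z)"
definition "z * w = GInt (re z * re w - im z * im w) (re z * im w + im z * re w)"

instance
  by standard (simp_all add: zero_gint_def one_gint_def plus_gint_def minus_gint_def uminus_gint_def
    times_gint_def algebra_simps)

end

lemma re_im_simps [simp]:
  "re 0 = 0" "im 0 = 0" "re 1 = 1" "im 1 = 0"
  "re (z + w) = re z + re w" "im (z + w) = im z + im w"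
  "re (z - w) = re z - re w" "im (z - w) = im z - im w"
  "re (- z) = - re z" "im (- z) = - im z"
  "re (z * w) = re z * re w - im z * im w" "im (z * w) = re z * im w + im z * re w"
  by (simp_all add: zero_gint_def one_gint_def plus_gint_def minus_gint_def uminus_gint_def times_gint_def)

lemma re_im_of_nat [simp]: "re (of_nat k) = int k" "im (of_nat k) = 0"
  by (induction k) simp_all

lemma re_im_of_int [simp]: "re (of_int k) = k" "im (of_int k) = 0"
  by (cases k; simp)+

lemma re_im_numeral [simp]: "re (numeral k) = numeral k" "im (numeral k) = 0"
  using re_im_of_int[of "numeral k"] by simp_all

lemma gint_eq_iff: "z = w \<longleftrightarrow> re z = re w \<and> im z = im w"
  by (auto intro: gint.expand)

definition conj :: "gint \<Rightarrow> gint" where "conj z = GInt (re z) (- im z)"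

definition gnorm :: "gint \<Rightarrow> int" where "gnorm z = re z ^ 2 + im z ^ 2"

definition gi :: gint where "gi = GInt 0 1"

lemma re_im_conj [simp]: "re (conj z) = re z" "im (conj z) = - im z"
  by (simp_all add: conj_def)

lemma re_im_gi [simp]: "re gi = 0" "im gi = 1"
  by (simp_all add: gi_def)

lemma conj_mult: "conj (z * w) = conj z * conj w" and conj_conj [simp]: "conj (conj z) = z"
  by (simp_all add: gint_eq_iff)

lemma conj_power: "conj (z ^ k) = conj z ^ k"
  by (induction k) (simp_all add: conj_mult, simp add: gint_eq_iff)

lemma gnorm_mult: "gnorm (z * w) = gnorm z * gnorm w"
  by (simp add: gnorm_def power2_eq_square algebra_simps)

lemma gnorm_power: "gnorm (z ^ k) = gnorm z ^ k"
  by (induction k) (simp_all add: gnorm_mult, simp add: gnorm_def)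

lemma mult_conj: "z * conj z = of_int (gnorm z)"
  by (simp add: gint_eq_iff gnorm_def power2_eq_square)

lemma gnorm_conj [simp]: "gnorm (conj z) = gnorm z" by (simp add: gnorm_def)

lemma gnorm_of_int: "gnorm (of_int c) = c ^ 2" by (simp add: gnorm_def)

lemma gint_decomp: "z = of_int (re z) + of_int (im z) * gi"
  by (simp add: gint_eq_iff)

lemma add_conj: "z + conj z = of_int (2 * re z)"
  by (simp add: gint_eq_iff)

lemma of_int_dvd_gint_iff: "of_int k dvd z \<longleftrightarrow> k dvd re z \<and> k dvd im z"
proof
  assume "k dvd re z \<and> k dvd im z"
  then obtain a b where "re z = k * a" "im z = k * b" by (auto elim!: dvdE)
  hence "z = of_int k * GInt a b" by (simp add: gint_eq_iff)
  thus "of_int k dvd z" by simp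
qed (auto elim!: dvdE)

lemma gi_power4: "gi ^ 4 = 1" by (simp add: gint_eq_iff eval_nat_numeral)

lemma re_im_power4:
  "re (z ^ 4) = re z ^ 4 - 6 * re z ^ 2 * im z ^ 2 + im z ^ 4"
  "im (z ^ 4) = 4 * re z * im z * (re z - im z) * (re z + im z)"
  by (simp_all add: eval_nat_numeral algebra_simps)

context odd_prime
begin

definition gcong :: "gint \<Rightarrow> gint \<Rightarrow> bool" where
  "gcong z w \<longleftrightarrow> of_int (int p) dvd z - w"

lemma gcong_iff: "gcong z w \<longleftrightarrow> [re z = re w] (mod int p) \<and> [im z = im w] (mod int p)"
  unfolding gcong_def of_int_dvd_gint_iff by (simp add: cong_iff_dvd_diff)

lemma gcong_refl [simp, intro]: "gcong z z" by (simp add: gcong_iff)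

lemma gcong_sym: "gcong z w \<Longrightarrow> gcong w z" by (simp add: gcong_iff cong_sym)

lemma gcong_trans [trans]: "gcong z w \<Longrightarrow> gcong w v \<Longrightarrow> gcong z v"
  unfolding gcong_iff using cong_trans by blast

lemma gcong_add: "gcong a b \<Longrightarrow> gcong c d \<Longrightarrow> gcong (a + c) (b + d)"
  unfolding gcong_iff by (auto intro: cong_add)

lemma gcong_mult: "gcong a b \<Longrightarrow> gcong c d \<Longrightarrow> gcong (a * c) (b * d)"
  unfolding gcong_iff by (auto intro!: cong_add cong_mult cong_diff)

lemma gcong_power: "gcong a b \<Longrightarrow> gcong (a ^ k) (b ^ k)"
  by (induction k) (auto intro: gcong_mult)

lemma gcong_sum: "(\<And>i. i \<in> A \<Longrightarrow> gcong (f i) (h i)) \<Longrightarrow> gcong (sum f A) (sum h A)"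
  by (induction A rule: infinite_finite_induct) (auto intro: gcong_add)

lemma gcong_of_int_iff: "gcong (of_int a) (of_int b) \<longleftrightarrow> [a = b] (mod int p)"
  by (simp add: gcong_iff)

lemma gcong_conj: "gcong z w \<Longrightarrow> gcong (conj z) (conj w)"
  by (simp add: gcong_iff cong_minus_minus_iff)

lemma gnorm_cong: "gcong z w \<Longrightarrow> [gnorm z = gnorm w] (mod int p)"
  unfolding gcong_iff gnorm_def by (auto intro: cong_add cong_pow)

lemma freshman: "gcong ((x + y) ^ p) (x ^ p + y ^ p)"
proof -
  have "(x + y) ^ p = (\<Sum>k\<le>p. of_nat (p choose k) * x ^ k * y ^ (p - k))" by (rule binomial_ring)
  also have "gcong \<dots> (\<Sum>k\<le>p. if k = 0 then y ^ p else if k = p then x ^ p else 0)"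
  proof (rule gcong_sum)
    fix k assume k: "k \<in> {..p}"
    show "gcong (of_nat (p choose k) * x ^ k * y ^ (p - k)) (if k = 0 then y ^ p else if k = p then x ^ p else 0)"
    proof (cases "k = 0 \<or> k = p")
      case False
      hence "p dvd (p choose k)" using k prime_p by (intro dvd_choose_prime) auto
      then obtain c where "p choose k = p * c" by (elim dvdE)
      hence "of_nat (p choose k) * x ^ k * y ^ (p - k) = of_int (int p) * (of_nat c * x ^ k * y ^ (p - k))"
        by (simp add: mult_ac)
      thus ?thesis using False by (simp add: gcong_def)
    qed (use p_pos in auto)
  qed
  also have "(\<Sum>k\<le>p. if k = 0 then y ^ p else if k = p then x ^ p else 0) = x ^ p + y ^ p"
    using p_pos by (subst sum.remove[of _ 0]) (simp_all add: sum.delta' add.commute)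
  finally show ?thesis .
qed

lemma int_power_p: "[a ^ p = a] (mod int p)"
proof (cases "int p dvd a")
  case True
  thus ?thesis unfolding cong_iff_dvd_diff using p_pos by (intro dvd_diff) (simp_all add: prime_dvd_power_p)
next
  case False
  have "a ^ p = (a ^ m) ^ 2 * a" using p_eq by (metis mult.commute power_Suc2 power_mult Suc_eq_plus1)
  also have "[\<dots> = chi a ^ 2 * a] (mod int p)"
    by (intro cong_mult cong_pow cong_refl cong_sym[OF chi_cong_power])
  finally show ?thesis using chi_square[OF False] by simp
qed

lemma gcong_power_p: "gcong (z ^ p) (of_int (re z) + of_int (im z) * gi ^ p)"
proof -
  have "gcong (z ^ p) (of_int (re z) ^ p + (of_int (im z) * gi) ^ p)"
    using freshman[of "of_int (re z)" "of_int (im z) * gi"] by (simp flip: gint_decomp)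
  also have "gcong \<dots> (of_int (re z) + of_int (im z) * gi ^ p)"
    unfolding power_mult_distrib
    by (intro gcong_add gcong_mult gcong_refl) (simp_all only: of_int_power[symmetric] gcong_of_int_iff int_power_p)
  finally show ?thesis .
qed

lemma chi_minus_1: "chi (-1) = (-1) ^ m"
proof (rule chi_eqI)
  show "(-1) ^ m \<in> {-1, 0, 1 :: int}" by (cases "even m") auto
qed simp

lemma gi_power_mod: "gi ^ k = gi ^ (k mod 4)"
proof -
  have "gi ^ k = gi ^ (4 * (k div 4) + k mod 4)" by simp
  thus ?thesis by (simp only: power_add power_mult gi_power4 power_one mult_1_left)
qed

text \<open>
  The supplementary law, from two evaluations of \<open>(1 + i)^p\<close> modulo \<open>p\<close>: it is \<open>1 + i^p\<close>, and it is
  \<open>(1 + i) (2 i)^m\<close>, where \<open>2^m \<equiv> \<chi>(2)\<close>.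
\<close>

lemma chi_2: "chi 2 = (if p mod 8 = 1 \<or> p mod 8 = 7 then 1 else -1)"
proof -
  define \<rho> where "\<rho> = GInt 1 1"
  have sq: "\<rho> ^ 2 = of_int 2 * gi" by (simp add: \<rho>_def gint_eq_iff power2_eq_square)
  have "\<rho> ^ p = \<rho> * (\<rho> ^ 2) ^ m" 
    using arg_cong[OF p_eq, of "\<lambda>k. \<rho> ^ k"] by (simp add: power_mult)
  also have "\<dots> = of_int (2 ^ m) * (\<rho> * gi ^ m)" unfolding sq by (simp add: power_mult_distrib mult_ac)
  also have "gcong \<dots> (of_int (chi 2) * (\<rho> * gi ^ m))"
    by (intro gcong_mult gcong_refl) (simp add: gcong_of_int_iff cong_sym[OF chi_cong_power] del: of_int_power)
  finally have "gcong (\<rho> ^ p) (of_int (chi 2) * (\<rho> * gi ^ m))" .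
  moreover have "gcong (\<rho> ^ p) (1 + gi ^ p)"
    using gcong_power_p[of \<rho>] by (simp add: \<rho>_def)
  ultimately have "gcong (of_int (chi 2) * (\<rho> * gi ^ m)) (1 + gi ^ p)"
    by (rule gcong_trans[OF gcong_sym])
  hence *: "gcong (of_int (chi 2) * (\<rho> * gi ^ (m mod 4))) (1 + gi ^ (p mod 4))"
    by (simp only: gi_power_mod[symmetric])
  have powers: "gi ^ 0 = 1" "gi ^ 1 = gi" "gi ^ 2 = -1" "gi ^ 3 = - gi"
    by (simp_all add: gint_eq_iff eval_nat_numeral)
  have "p mod 8 = 1 \<or> p mod 8 = 3 \<or> p mod 8 = 5 \<or> p mod 8 = 7" using odd_p by presburger
  moreover have "m mod 4 = (p mod 8) div 2"
  proof -
    have "x mod 4 = ((2 * x + 1) mod 8) div 2" for x :: nat by presburger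
    from this[of m] show ?thesis using p_eq by simp
  qed
  moreover have "p mod 4 = (p mod 8) mod 4" by (simp add: mod_mod_cancel)
  ultimately have "[chi 2 = (if p mod 8 = 1 \<or> p mod 8 = 7 then 1 else -1)] (mod int p)"
  proof (elim disjE)
    assume "p mod 8 = 1" "m mod 4 = p mod 8 div 2" "p mod 4 = p mod 8 mod 4"
    thus ?thesis using * powers by (simp add: gcong_iff \<rho>_def)
  next
    assume "p mod 8 = 3" "m mod 4 = p mod 8 div 2" "p mod 4 = p mod 8 mod 4"
    hence "[- chi 2 = 1] (mod int p)" using * powers by (simp add: gcong_iff \<rho>_def)
    thus ?thesis using \<open>p mod 8 = 3\<close> cong_minus_minus_iff[of "chi 2" "-1"] by simp
  next
    assume "p mod 8 = 5" "m mod 4 = p mod 8 div 2" "p mod 4 = p mod 8 mod 4"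
    hence "[- chi 2 = 1] (mod int p)" using * powers by (simp add: gcong_iff \<rho>_def)
    thus ?thesis using \<open>p mod 8 = 5\<close> cong_minus_minus_iff[of "chi 2" "-1"] by simp
  next
    assume "p mod 8 = 7" "m mod 4 = p mod 8 div 2" "p mod 4 = p mod 8 mod 4"
    thus ?thesis using * powers by (simp add: gcong_iff \<rho>_def)
  qed
  thus ?thesis by (intro sign_cong_eq chi_range) auto
qed

lemma Legendre_minus_2:
  "Legendre (-2) (int p) = -1 \<longleftrightarrow> p mod 8 = 5 \<or> p mod 8 = 7"
proof -
  have "chi (-2) = chi (-1) * chi 2" by (simp flip: chi_mult)
  moreover have "even m \<longleftrightarrow> p mod 8 = 1 \<or> p mod 8 = 5" unfolding m_def using odd_p by presburger
  moreover have "p mod 8 = 1 \<or> p mod 8 = 3 \<or> p mod 8 = 5 \<or> p mod 8 = 7" using odd_p by presburger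
  ultimately show ?thesis unfolding chi_minus_1 chi_2 by (auto simp: chi_def)
qed

definition gresidues :: "gint set" where
  "gresidues = {z. re z \<in> resid \<and> im z \<in> resid}"

definition gmodular :: "(gint \<Rightarrow> 'a) \<Rightarrow> bool" where
  "gmodular f \<longleftrightarrow> (\<forall>z w. gcong z w \<longrightarrow> f z = f w)"

lemma gmodularI: "(\<And>z w. gcong z w \<Longrightarrow> f z = f w) \<Longrightarrow> gmodular f"
  by (simp add: gmodular_def)

lemma gmodularD: "gmodular f \<Longrightarrow> gcong z w \<Longrightarrow> f z = f w"
  by (simp add: gmodular_def)

lemma gresidues_eq: "gresidues = (\<lambda>(a, b). GInt a b) ` (resid \<times> resid)"
proof
  show "gresidues \<subseteq> (\<lambda>(a, b). GInt a b) ` (resid \<times> resid)"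
  proof
    fix z assume "z \<in> gresidues"
    thus "z \<in> (\<lambda>(a, b). GInt a b) ` (resid \<times> resid)"
      by (intro image_eqI[of _ _ "(re z, im z)"]) (simp_all add: gresidues_def)
  qed
qed (auto simp: gresidues_def)

lemma finite_gresidues [simp]: "finite gresidues" by (simp add: gresidues_eq)

lemma sum_gresidues: "sum f gresidues = (\<Sum>a\<in>resid. \<Sum>b\<in>resid. f (GInt a b))"
  unfolding gresidues_eq by (subst sum.reindex) (auto simp: inj_on_def sum.cartesian_product case_prod_unfold intro!: sum.cong)

lemma card_gresidues: "card gresidues = p ^ 2"
  unfolding gresidues_eq by (subst card_image) (auto simp: inj_on_def card_cartesian_product power2_eq_square)

lemma gresidues_cong_eq: "z \<in> gresidues \<Longrightarrow> w \<in> gresidues \<Longrightarrow> gcong z w \<Longrightarrow> z = w"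
  by (auto simp: gresidues_def gcong_iff gint_eq_iff intro: residues_cong_eq)

lemma sum_gresidues_reindex:
  assumes f: "gmodular f" and h: "\<And>z w. z \<in> gresidues \<Longrightarrow> w \<in> gresidues \<Longrightarrow> gcong (h z) (h w) \<Longrightarrow> z = w"
  shows "(\<Sum>z\<in>gresidues. f (h z)) = sum f gresidues"
proof -
  define r where "r z = GInt (re z mod int p) (im z mod int p)" for z
  have r: "gcong (r z) z" for z by (simp add: r_def gcong_iff cong_def)
  have "inj_on (\<lambda>z. r (h z)) gresidues"
    by (intro inj_onI h) (metis gcong_sym gcong_trans r)+
  moreover have "(\<lambda>z. r (h z)) ` gresidues \<subseteq> gresidues" by (auto simp: r_def gresidues_def)
  ultimately have "bij_betw (\<lambda>z. r (h z)) gresidues gresidues"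
    by (simp add: bij_betw_def endo_inj_surj)
  hence "(\<Sum>z\<in>gresidues. f (r (h z))) = sum f gresidues" by (rule sum.reindex_bij_betw)
  thus ?thesis using gmodularD[OF f r] by simp
qed

end

section \<open>Character sums over the Gaussian integers for primes 3 modulo 8\<close>

locale prime_3_mod_8 = odd_prime +
  assumes p_mod_8: "p mod 8 = 3"
begin

definition j :: nat where "j = p div 8"

lemma p_j: "p = 8 * j + 3" and m_j: "m = 4 * j + 1"
  unfolding j_def m_def using p_mod_8 by presburger+

lemma chi_minus_1': "chi (-1) = -1" and chi_2': "chi 2 = -1"
  using p_mod_8 by (simp_all add: chi_minus_1 m_j chi_2)

lemma chi_4: "chi 4 = 1"
  using chi_mult[of 2 2] by (simp add: chi_2')

lemma chi_diagonal: "\<not> int p dvd b \<Longrightarrow> chi ((-1) * 2 * 4 * b ^ 6) = 1"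
  unfolding chi_mult chi_power chi_minus_1' chi_2' chi_4 by (simp add: chi_even_power)

lemma frobenius: "gcong (z ^ p) (conj z)"
proof -
  have "gi ^ p = - gi"
  proof -
    have "p mod 4 = 3" using p_mod_8 by presburger
    hence "gi ^ p = gi ^ 3" using gi_power_mod[of p] by simp
    also have "gi ^ 3 = - gi" by (simp add: gint_eq_iff eval_nat_numeral)
    finally show ?thesis .
  qed
  thus ?thesis using gcong_power_p[of z] by (simp add: gcong_iff)
qed

text \<open>
  Since \<open>-1\<close> is not a square modulo \<open>p\<close>, the Gaussian integers modulo \<open>p\<close> form a field.
\<close>

lemma gnorm_dvd_iff: "int p dvd gnorm z \<longleftrightarrow> gcong z 0"
proof
  assume "int p dvd gnorm z"
  hence 1: "[re z ^ 2 = -1 * im z ^ 2] (mod int p)" by (simp add: gnorm_def cong_iff_dvd_diff)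
  have "chi (re z) ^ 2 = chi (-1) * chi (im z) ^ 2"
    using chi_cong[OF 1] by (simp only: chi_mult chi_power)
  hence "chi (re z) = 0 \<and> chi (im z) = 0"
    using chi_range[of "re z"] chi_range[of "im z"] by (auto simp: chi_minus_1')
  thus "gcong z 0" by (simp add: gcong_iff chi_eq_0_iff cong_0_iff)
next
  assume "gcong z 0"
  thus "int p dvd gnorm z" using gnorm_cong[of z 0] by (simp add: cong_0_iff) (simp add: gnorm_def cong_0_iff)
qed

lemma gcong_mult_cancel:
  assumes "gcong (w * x) (w * y)" and "\<not> gcong w 0"
  shows "gcong x y"
proof -
  have "gcong (w * x - w * y) 0" using assms(1) by (simp add: gcong_def)
  hence "int p dvd gnorm (w * (x - y))" by (simp only: gnorm_dvd_iff right_diff_distrib)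
  hence "gcong (x - y) 0" using assms(2) by (simp add: gnorm_mult prime_dvd_mult_p gnorm_dvd_iff)
  thus ?thesis by (simp add: gcong_def)
qed

lemma sum_gresidues_scale:
  assumes f: "gmodular f" and w: "\<not> gcong w 0"
  shows "(\<Sum>z\<in>gresidues. f (w * z)) = sum f gresidues"
proof (rule sum_gresidues_reindex[OF f])
  fix x y assume "x \<in> gresidues" "y \<in> gresidues" "gcong (w * x) (w * y)"
  thus "x = y" using gcong_mult_cancel[OF _ w] gresidues_cong_eq by blast
qed

lemma gresidues_0_iff: "z \<in> gresidues \<Longrightarrow> gcong z 0 \<longleftrightarrow> z = 0"
  by (auto simp: gresidues_def gcong_iff gint_eq_iff cong_0_iff residues_dvd_iff)

lemma gcong_power_0: "gcong (w ^ k) 0 \<Longrightarrow> gcong w 0"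
  using prime_dvd_power[OF prime_int_p, of "gnorm w" k] by (simp add: gnorm_power flip: gnorm_dvd_iff)

definition sextic_term :: "gint \<Rightarrow> gint \<Rightarrow> int" where
  "sextic_term \<delta> z = chi (gnorm z) * chi (re (\<delta> * z ^ 4))"

text \<open>
  The analogue of the sums of \<open>\<chi>(x (x^4 + D))\<close>: over the field with \<open>p^2\<close> elements, the homogeneous form
  \<open>x y (d x^4 + e y^4)\<close> turns into \<open>N(z) Re(\<delta> z^4)\<close>.  Summing over all of the plane instead of the projective line
  makes multiplication by a fixed element a plain reindexing, at the price of a factor \<open>p - 1\<close>.
\<close>

definition sextic_sum :: "gint \<Rightarrow> int" where
  "sextic_sum \<delta> = (\<Sum>z\<in>gresidues. sextic_term \<delta> z)"

lemma sextic_term_cong: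
  assumes "gcong \<delta> \<epsilon>" and "gcong z w"
  shows "sextic_term \<delta> z = sextic_term \<epsilon> w"
proof -
  have "gcong (\<delta> * z ^ 4) (\<epsilon> * w ^ 4)" by (intro gcong_mult gcong_power assms)
  hence "[re (\<delta> * z ^ 4) = re (\<epsilon> * w ^ 4)] (mod int p)" unfolding gcong_iff by blast
  thus ?thesis unfolding sextic_term_def using chi_cong gnorm_cong[OF assms(2)] by metis
qed

lemma gmodular_sextic_term: "gmodular (sextic_term \<delta>)"
  by (intro gmodularI sextic_term_cong gcong_refl)

lemma gmodular_sextic_sum: "gmodular sextic_sum"
  unfolding sextic_sum_def by (intro gmodularI sum.cong refl sextic_term_cong gcong_refl)

lemma sextic_sum_power4:
  assumes w: "\<not> gcong w 0"
  shows "sextic_sum (\<delta> * w ^ 4) = chi (gnorm w) * sextic_sum \<delta>"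
proof -
  have "chi (gnorm w) * chi (gnorm w) = 1" using w chi_mult_self by (simp add: gnorm_dvd_iff)
  hence "sextic_term (\<delta> * w ^ 4) z = chi (gnorm w) * sextic_term \<delta> (w * z)" for z
    by (simp add: sextic_term_def gnorm_mult chi_mult power_mult_distrib mult.assoc[symmetric] del: re_im_simps)
  hence "sextic_sum (\<delta> * w ^ 4) = chi (gnorm w) * (\<Sum>z\<in>gresidues. sextic_term \<delta> (w * z))"
    by (simp add: sextic_sum_def sum_distrib_left)
  thus ?thesis by (simp add: sum_gresidues_scale[OF gmodular_sextic_term w] sextic_sum_def)
qed

lemma sextic_sum_of_int: "sextic_sum (of_int c * \<delta>) = chi c * sextic_sum \<delta>"
proof -
  have "re (of_int c * \<delta> * z ^ 4) = c * re (\<delta> * z ^ 4)" for z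
    by (simp add: algebra_simps)
  thus ?thesis by (simp add: sextic_sum_def sextic_term_def chi_mult sum_distrib_left mult_ac del: re_im_simps)
qed

lemma sextic_sum_conj: "sextic_sum (conj \<delta>) = sextic_sum \<delta>"
proof -
  have "sextic_term (conj \<delta>) z = sextic_term \<delta> (conj z)" for z
  proof -
    have "conj \<delta> * z ^ 4 = conj (\<delta> * conj z ^ 4)" by (simp add: conj_mult conj_power)
    thus ?thesis unfolding sextic_term_def by simp
  qed
  moreover have "(\<Sum>z\<in>gresidues. sextic_term \<delta> (conj z)) = sum (sextic_term \<delta>) gresidues"
  proof (rule sum_gresidues_reindex[OF gmodular_sextic_term])
    fix z w assume "z \<in> gresidues" "w \<in> gresidues" "gcong (conj z) (conj w)"
    thus "z = w" using gcong_conj[of "conj z" "conj w"] gresidues_cong_eq by simp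
  qed
  ultimately show ?thesis by (simp add: sextic_sum_def)
qed

lemma sextic_sum_0: "sextic_sum 0 = 0"
  by (simp add: sextic_sum_def sextic_term_def)

text \<open>
  Conjugation maps \<open>i\<close> to \<open>- i\<close>, and \<open>\<chi>(-1) = -1\<close>.
\<close>

lemma sextic_sum_gi: "sextic_sum gi = 0"
proof -
  have "conj gi = of_int (-1) * gi" by (simp add: gint_eq_iff)
  hence "sextic_sum gi = chi (-1) * sextic_sum gi" using sextic_sum_conj[of gi] sextic_sum_of_int[of "-1" gi] by simp
  thus ?thesis by (simp add: chi_minus_1')
qed

subsection \<open>The total of the squares\<close>

text \<open>
  The two characters are those of linear forms in \<open>\<delta>\<close>; they are uncorrelated unless the forms are proportional,
  which means that \<open>w\<close> is real modulo \<open>p\<close>.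
\<close>

lemma sum_chi_linear_forms:
  "(\<Sum>\<delta>\<in>gresidues. chi (re \<delta>) * chi (re (\<delta> * w))) = (if int p dvd im w then int p * (int p - 1) * chi (re w) else 0)"
proof -
  have "(\<Sum>\<delta>\<in>gresidues. chi (re \<delta>) * chi (re (\<delta> * w))) = (\<Sum>d\<in>resid. chi d * (\<Sum>e\<in>resid. chi (- im w * e + d * re w)))"
    by (simp add: sum_gresidues sum_distrib_left mult.commute)
  also have "\<dots> = (if int p dvd im w then int p * (int p - 1) * chi (re w) else 0)"
  proof (cases "int p dvd im w")
    case True
    have "chi (- im w * e + d * re w) = chi d * chi (re w)" for d e
    proof -
      have "chi (- im w * e + d * re w) = chi (d * re w)"
        by (rule chi_cong) (use True in \<open>simp add: cong_iff_dvd_diff\<close>)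
      thus ?thesis by (simp add: chi_mult)
    qed
    hence "(\<Sum>d\<in>resid. chi d * (\<Sum>e\<in>resid. chi (- im w * e + d * re w))) = (\<Sum>d\<in>resid. int p * chi (re w) * (chi d * chi d))"
      by (simp add: mult_ac)
    thus ?thesis using True by (simp add: sum_distrib_left[symmetric] sum_chi_square)
  next
    case False
    hence "\<not> int p dvd - im w" by simp
    thus ?thesis using False sum_residues_affine[OF modular_chi, of "- im w"] by (simp add: sum_chi)
  qed
  finally show ?thesis .
qed

lemma gmodular_chi_re: "gmodular (\<lambda>\<delta>. chi (re \<delta>) * chi (re (\<delta> * w)))"
proof (rule gmodularI)
  fix z v assume zv: "gcong z v"
  hence "gcong (z * w) (v * w)" by (intro gcong_mult gcong_refl)
  thus "chi (re z) * chi (re (z * w)) = chi (re v) * chi (re (v * w))"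
    using zv chi_cong unfolding gcong_iff by metis
qed

text \<open>
  The four lines through the origin on which \<open>r^4\<close> is real modulo \<open>p\<close>; they replace the fourth roots of unity.
\<close>

definition fourth_power_real :: "gint \<Rightarrow> bool" where
  "fourth_power_real r \<longleftrightarrow> int p dvd re r * im r * (re r - im r) * (re r + im r)"

lemma dvd_im_power4_iff: "int p dvd im (r ^ 4) \<longleftrightarrow> fourth_power_real r"
  unfolding re_im_power4 fourth_power_real_def using not_dvd_four by (simp add: prime_dvd_mult_p)

text \<open>
  On the diagonals \<open>N(r) = 2 b^2\<close> and \<open>r^4 = -4 b^4\<close>; the two signs \<open>\<chi>(2) = -1\<close> and \<open>\<chi>(-1) = -1\<close> cancel.
\<close>

lemma chi_fourth_power_real:
  assumes r: "\<not> gcong r 0" and real: "fourth_power_real r"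
  shows "chi (gnorm r) * chi (re (r ^ 4)) = 1"
proof -
  define a b where "a = re r" and "b = im r"
  have ab: "\<not> (int p dvd a \<and> int p dvd b)" using r by (simp add: gcong_iff cong_0_iff a_def b_def)
  define f where "f x y = (x ^ 2 + y ^ 2) * (x ^ 4 - 6 * x ^ 2 * y ^ 2 + y ^ 4)" for x y :: int
  have exp: "chi (gnorm r) * chi (re (r ^ 4)) = chi (f a b)"
    unfolding chi_mult re_im_power4 gnorm_def a_def b_def f_def ..
  have f_cong: "chi (f a b) = chi (f x y)" if "[a = x] (mod int p)" "[b = y] (mod int p)" for x y
    unfolding f_def by (intro chi_cong cong_mult cong_add cong_diff cong_pow cong_refl that)
  have "int p dvd a \<or> int p dvd b \<or> int p dvd a - b \<or> int p dvd a + b"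
    using real unfolding a_def b_def fourth_power_real_def prime_dvd_mult_p by blast
  moreover have "\<not> int p dvd b" if "int p dvd a - b" using ab that dvd_add[of "int p" "a - b" b] by auto
  moreover have "\<not> int p dvd b" if "int p dvd a + b" using ab that dvd_diff[of "int p" "a + b" b] by auto
  moreover have "[a = b] (mod int p) \<longleftrightarrow> int p dvd a - b" "[a = -b] (mod int p) \<longleftrightarrow> int p dvd a + b"
    by (simp_all add: cong_iff_dvd_diff)
  ultimately consider "int p dvd a" "\<not> int p dvd b" | "int p dvd b" "\<not> int p dvd a"
    | "[a = b] (mod int p)" "\<not> int p dvd b" | "[a = -b] (mod int p)" "\<not> int p dvd b"
    using ab by blast
  thus ?thesis
  proof cases
    case 1
    hence "chi (f a b) = chi (f 0 b)" by (intro f_cong cong_refl) (simp add: cong_0_iff)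
    thus ?thesis unfolding exp using 1 by (simp add: f_def chi_mult chi_power chi_even_power)
  next
    case 2
    hence "chi (f a b) = chi (f a 0)" by (intro f_cong cong_refl) (simp add: cong_0_iff)
    thus ?thesis unfolding exp using 2 by (simp add: f_def chi_mult chi_power chi_even_power)
  next
    case 3
    have "f b b = (-1) * 2 * 4 * b ^ 6" by (simp add: f_def eval_nat_numeral)
    thus ?thesis unfolding exp f_cong[OF 3(1) cong_refl] using chi_diagonal[OF 3(2)] by simp
  next
    case 4
    have "f (-b) b = (-1) * 2 * 4 * b ^ 6" by (simp add: f_def eval_nat_numeral)
    thus ?thesis unfolding exp f_cong[OF 4(1) cong_refl] using chi_diagonal[OF 4(2)] by simp
  qed
qed

lemma fourth_power_real_column:
  assumes a: "a \<in> resid"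
  shows "{b \<in> resid. \<not> gcong (GInt a b) 0 \<and> fourth_power_real (GInt a b)}
    = (if a = 0 then resid - {0} else {0, a, int p - a})"
proof (cases "a = 0")
  case True
  thus ?thesis by (auto simp: fourth_power_real_def gcong_iff cong_0_iff residues_dvd_iff)
next
  case False
  have small: "int p dvd x \<longleftrightarrow> x = 0" if "- int p < x" "x < int p" for x
    using that dvd_imp_le_int[of x "int p"] by (cases "x = 0") auto
  have "int p dvd a * b * (a - b) * (a + b) \<longleftrightarrow> b = 0 \<or> b = a \<or> b = int p - a" if b: "b \<in> resid" for b
  proof -
    have bounds: "0 < a" "a < int p" "0 \<le> b" "b < int p" using a b False by (auto simp: resid_def)
    have "int p dvd a + b \<longleftrightarrow> int p dvd a + b - int p"
      using dvd_add_right_iff[of "int p" "int p" "a + b - int p"] by simp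
    also have "\<dots> \<longleftrightarrow> a + b - int p = 0" using bounds by (intro small) auto
    finally have "int p dvd a + b \<longleftrightarrow> b = int p - a" by auto
    moreover have "int p dvd a - b \<longleftrightarrow> b = a" using bounds small[of "a - b"] by auto
    ultimately show ?thesis using a b False by (simp add: prime_dvd_mult_p residues_dvd_iff)
  qed
  moreover have "\<not> gcong (GInt a b) 0" for b using a False by (simp add: gcong_iff cong_0_iff residues_dvd_iff)
  ultimately have "{b \<in> resid. \<not> gcong (GInt a b) 0 \<and> fourth_power_real (GInt a b)} = {b \<in> resid. b = 0 \<or> b = a \<or> b = int p - a}"
    unfolding fourth_power_real_def by auto
  also have "\<dots> = {0, a, int p - a}" using a False by (auto simp: resid_def)
  finally show ?thesis using False by simp
qed

lemma sum_fourth_power_real: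
  "(\<Sum>r\<in>gresidues. if \<not> gcong r 0 \<and> fourth_power_real r then c else 0) = 4 * (int p - 1) * c"
proof -
  have column: "(\<Sum>b\<in>resid. if \<not> gcong (GInt a b) 0 \<and> fourth_power_real (GInt a b) then c else 0)
     = (if a = 0 then int p - 1 else 3) * c" if a: "a \<in> resid" for a
  proof -
    have "card (if a = 0 then resid - {0} else {0, a, int p - a}) = (if a = 0 then p - 1 else 3)"
    proof (cases "a = 0")
      case False
      have "a \<noteq> int p - a" using odd_p by presburger
      moreover have "int p - a \<noteq> 0" using a by (auto simp: resid_def)
      ultimately show ?thesis using False by simp
    qed (simp add: card_Diff_subset)
    thus ?thesis
      using fourth_power_real_column[OF a] p_pos by (simp add: sum.If_cases Int_def of_nat_diff split: if_splits)
  qed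
  have "(\<Sum>r\<in>gresidues. if \<not> gcong r 0 \<and> fourth_power_real r then c else 0)
      = (\<Sum>a\<in>resid. (if a = 0 then int p - 1 else 3) * c)"
    unfolding sum_gresidues by (rule sum.cong[OF refl column])
  also have "\<dots> = ((int p - 1) + 3 * (int p - 1)) * c"
    unfolding sum_distrib_right[symmetric] using p_pos
    by (subst sum.remove[of _ 0]) (simp_all add: card_Diff_subset of_nat_diff)
  finally show ?thesis by simp
qed

text \<open>
  Replacing \<open>\<delta>\<close> by \<open>\<delta> / z^4\<close> reduces the sum to the linear forms \<open>Re \<delta>\<close> and \<open>Re(\<delta> r^4)\<close>.
\<close>

lemma sextic_term_correlation:
  assumes z: "\<not> gcong z 0"
  shows "(\<Sum>\<delta>\<in>gresidues. sextic_term \<delta> z * sextic_term \<delta> (z * r))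
     = (if \<not> gcong r 0 \<and> fourth_power_real r then int p * (int p - 1) else 0)"
proof -
  have z4: "\<not> gcong (z ^ 4) 0" using z gcong_power_0 by blast
  have sq: "chi (gnorm z) * chi (gnorm z) = 1" using z chi_mult_self by (simp add: gnorm_dvd_iff)
  have "sextic_term \<delta> z * sextic_term \<delta> (z * r) = chi (gnorm r) * (chi (re (z ^ 4 * \<delta>)) * chi (re (z ^ 4 * \<delta> * r ^ 4)))" for \<delta>
  proof -
    have "sextic_term \<delta> z * sextic_term \<delta> (z * r)
        = (chi (gnorm z) * chi (gnorm z)) * (chi (gnorm r) * (chi (re (\<delta> * z ^ 4)) * chi (re (\<delta> * (z * r) ^ 4))))"
      unfolding sextic_term_def gnorm_mult chi_mult by (simp only: mult_ac)
    also have "\<delta> * (z * r) ^ 4 = z ^ 4 * \<delta> * r ^ 4" by (simp only: power_mult_distrib mult_ac)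
    also have "\<delta> * z ^ 4 = z ^ 4 * \<delta>" by (rule mult.commute)
    finally show ?thesis unfolding sq by simp
  qed
  hence "(\<Sum>\<delta>\<in>gresidues. sextic_term \<delta> z * sextic_term \<delta> (z * r))
      = chi (gnorm r) * (\<Sum>\<delta>\<in>gresidues. chi (re (z ^ 4 * \<delta>)) * chi (re (z ^ 4 * \<delta> * r ^ 4)))"
    by (simp only: sum_distrib_left)
  also have "(\<Sum>\<delta>\<in>gresidues. chi (re (z ^ 4 * \<delta>)) * chi (re (z ^ 4 * \<delta> * r ^ 4)))
      = (\<Sum>\<delta>\<in>gresidues. chi (re \<delta>) * chi (re (\<delta> * r ^ 4)))"
    by (rule sum_gresidues_scale[OF gmodular_chi_re z4])
  also have "\<dots> = (if fourth_power_real r then int p * (int p - 1) * chi (re (r ^ 4)) else 0)"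
    unfolding sum_chi_linear_forms dvd_im_power4_iff ..
  finally show ?thesis
    using chi_fourth_power_real[of r] chi_eq_0_iff gnorm_dvd_iff by (cases "gcong r 0") (auto simp: mult_ac)
qed

lemma sextic_sum_square_total:
  "(\<Sum>\<delta>\<in>gresidues. sextic_sum \<delta> ^ 2) = 4 * int p * (int p - 1) ^ 2 * (int p ^ 2 - 1)"
proof -
  have "(\<Sum>\<delta>\<in>gresidues. sextic_sum \<delta> ^ 2)
      = (\<Sum>\<delta>\<in>gresidues. \<Sum>z\<in>gresidues. \<Sum>w\<in>gresidues. sextic_term \<delta> z * sextic_term \<delta> w)"
    by (simp add: sextic_sum_def power2_eq_square sum_product)
  also have "\<dots> = (\<Sum>z\<in>gresidues. \<Sum>w\<in>gresidues. \<Sum>\<delta>\<in>gresidues. sextic_term \<delta> z * sextic_term \<delta> w)"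
    by (subst sum.swap) (intro sum.cong refl sum.swap)
  also have "\<dots> = (\<Sum>z\<in>gresidues. if z = 0 then 0 else 4 * int p * (int p - 1) ^ 2)"
  proof (rule sum.cong[OF refl])
    fix z assume z: "z \<in> gresidues"
    show "(\<Sum>w\<in>gresidues. \<Sum>\<delta>\<in>gresidues. sextic_term \<delta> z * sextic_term \<delta> w) = (if z = 0 then 0 else 4 * int p * (int p - 1) ^ 2)"
    proof (cases "z = 0")
      case True
      thus ?thesis by (simp add: sextic_term_def gnorm_def)
    next
      case False
      hence z0: "\<not> gcong z 0" using z gresidues_0_iff by blast
      have "(\<Sum>w\<in>gresidues. \<Sum>\<delta>\<in>gresidues. sextic_term \<delta> z * sextic_term \<delta> w)
          = (\<Sum>r\<in>gresidues. \<Sum>\<delta>\<in>gresidues. sextic_term \<delta> z * sextic_term \<delta> (z * r))"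
        by (rule sum_gresidues_scale[OF _ z0, symmetric])
           (intro gmodularI sum.cong refl arg_cong2[where f = "(*)"] sextic_term_cong gcong_refl)
      also have "\<dots> = 4 * (int p - 1) * (int p * (int p - 1))"
        unfolding sextic_term_correlation[OF z0] by (rule sum_fourth_power_real)
      finally show ?thesis using False by (simp add: power2_eq_square mult_ac)
    qed
  qed
  also have "\<dots> = (int p ^ 2 - 1) * (4 * int p * (int p - 1) ^ 2)"
  proof -
    have "(0 :: gint) \<in> gresidues" by (simp add: gresidues_def)
    thus ?thesis by (subst sum.remove[of _ 0]) (simp_all add: card_Diff_subset card_gresidues of_nat_diff p_pos Suc_leI)
  qed
  finally show ?thesis by (simp add: mult_ac)
qed


subsection \<open>Classes modulo fourth powers and rational scalars\<close>

text \<open>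
  Fourth powers and rational scalars leave the square of \<open>sextic_sum\<close> unchanged.  The quotient by both is
  cyclic of order 4 and generated by \<open>1 + i\<close>, whose fourth power is \<open>-4\<close>; this is the sum over the quotient.
\<close>

definition orbit_sum :: "gint \<Rightarrow> int" where
  "orbit_sum \<delta> = (\<Sum>k<4. sextic_sum (\<delta> * (1 + gi) ^ k) ^ 2)"

lemma orbit_sum_cong: "gcong \<delta> \<epsilon> \<Longrightarrow> orbit_sum \<delta> = orbit_sum \<epsilon>"
  unfolding orbit_sum_def
  by (intro sum.cong refl arg_cong[where f = "\<lambda>x. x ^ 2"] gmodularD[OF gmodular_sextic_sum] gcong_mult gcong_refl)

lemma sextic_sum_power4_square:
  "\<not> gcong w 0 \<Longrightarrow> sextic_sum (\<delta> * w ^ 4) ^ 2 = sextic_sum \<delta> ^ 2"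
  by (simp add: sextic_sum_power4 power_mult_distrib chi_square gnorm_dvd_iff)

lemma sextic_sum_of_int_square:
  "\<not> int p dvd c \<Longrightarrow> sextic_sum (of_int c * \<delta>) ^ 2 = sextic_sum \<delta> ^ 2"
  by (simp add: sextic_sum_of_int power_mult_distrib chi_square)

lemma orbit_sum_power4: "\<not> gcong w 0 \<Longrightarrow> orbit_sum (\<delta> * w ^ 4) = orbit_sum \<delta>"
  unfolding orbit_sum_def
proof (rule sum.cong[OF refl])
  fix k assume w: "\<not> gcong w 0"
  have eq: "\<delta> * w ^ 4 * (1 + gi) ^ k = \<delta> * (1 + gi) ^ k * w ^ 4" by (simp only: mult_ac)
  show "sextic_sum (\<delta> * w ^ 4 * (1 + gi) ^ k) ^ 2 = sextic_sum (\<delta> * (1 + gi) ^ k) ^ 2"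
    unfolding eq by (rule sextic_sum_power4_square[OF w])
qed

lemma orbit_sum_of_int: "\<not> int p dvd c \<Longrightarrow> orbit_sum (of_int c * \<delta>) = orbit_sum \<delta>"
  unfolding orbit_sum_def by (simp add: mult.assoc sextic_sum_of_int_square)

lemma orbit_sum_rotate: "orbit_sum (\<delta> * (1 + gi)) = orbit_sum \<delta>"
proof -
  have "(1 + gi) ^ 4 = of_int (-4)" by (simp add: gint_eq_iff eval_nat_numeral)
  hence last: "sextic_sum (\<delta> * (1 + gi) ^ 4) ^ 2 = sextic_sum \<delta> ^ 2"
    using sextic_sum_of_int_square[of "-4" \<delta>] not_dvd_four by (simp add: mult.commute)
  have "orbit_sum (\<delta> * (1 + gi)) + sextic_sum \<delta> ^ 2 = (\<Sum>k<Suc 4. sextic_sum (\<delta> * (1 + gi) ^ k) ^ 2)"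
    unfolding orbit_sum_def by (subst sum.lessThan_Suc_shift) (simp add: mult_ac)
  also have "\<dots> = orbit_sum \<delta> + sextic_sum (\<delta> * (1 + gi) ^ 4) ^ 2"
    unfolding orbit_sum_def by (rule sum.lessThan_Suc)
  finally show ?thesis unfolding last by simp
qed

text \<open>
  Put \<open>M = (p + 1) / 4\<close>, an odd number.  A suitable odd multiple of \<open>M\<close> has the form \<open>4 q + 1\<close>, so
  \<open>w = \<delta>^(4q+1)\<close> lies in the class of \<open>\<delta>\<close>.  But \<open>w^4\<close> is a power of \<open>\<delta>^(p+1) \<equiv> N(\<delta>)\<close>, hence real, so \<open>w\<close> lies on one of four
  lines, that is, in the class of a power of \<open>1 + i\<close>.
\<close>

lemma orbit_sum_const:
  assumes "\<not> gcong \<delta> 0"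
  shows "orbit_sum \<delta> = orbit_sum 1"
proof -
  obtain q where q: "(2 * j + 1) mod 4 = 1 \<and> 4 * q + 1 = 2 * j + 1 \<or> (2 * j + 1) mod 4 = 3 \<and> 4 * q + 1 = 3 * (2 * j + 1)"
  proof -
    have "(2 * j + 1) mod 4 = 1 \<and> 4 * ((2 * j + 1) div 4) + 1 = 2 * j + 1 \<or> (2 * j + 1) mod 4 = 3 \<and> 4 * ((3 * (2 * j + 1)) div 4) + 1 = 3 * (2 * j + 1)"
      by presburger
    thus ?thesis using that by blast
  qed
  have "\<exists>e. 4 * (4 * q + 1) = (p + 1) * e"
    using q
  proof (elim disjE conjE)
    assume "4 * q + 1 = 2 * j + 1"
    hence "4 * (4 * q + 1) = (p + 1) * 1" using p_j by presburger
    thus ?thesis by blast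
  next
    assume "4 * q + 1 = 3 * (2 * j + 1)"
    hence "4 * (4 * q + 1) = (p + 1) * 3" using p_j by presburger
    thus ?thesis by blast
  qed
  then obtain e where e: "4 * (4 * q + 1) = (p + 1) * e" by blast
  define w where "w = \<delta> ^ (4 * q + 1)"
  have w0: "\<not> gcong w 0" unfolding w_def using assms gcong_power_0 by blast
  have "orbit_sum w = orbit_sum (\<delta> * (\<delta> ^ q) ^ 4)"
    unfolding w_def by (simp add: power_mult[symmetric] mult.commute)
  hence orb: "orbit_sum w = orbit_sum \<delta>"
    using orbit_sum_power4[of "\<delta> ^ q" \<delta>] assms gcong_power_0 by metis
  have "gcong (w ^ 4) (of_int (gnorm \<delta> ^ e))"
  proof -
    have "w ^ 4 = \<delta> ^ (4 * (4 * q + 1))"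
      unfolding w_def power_mult[symmetric] by (simp only: mult.commute)
    also have "\<dots> = (\<delta> ^ p * \<delta>) ^ e"
      unfolding e by (simp only: power_mult power_add power_one_right)
    also have "gcong \<dots> ((conj \<delta> * \<delta>) ^ e)"
      by (intro gcong_power gcong_mult frobenius gcong_refl)
    also have "(conj \<delta> * \<delta>) ^ e = of_int (gnorm \<delta> ^ e)"
      using mult_conj[of \<delta>] by (simp add: mult.commute)
    finally show ?thesis .
  qed
  hence "[im (w ^ 4) = im (of_int (gnorm \<delta> ^ e))] (mod int p)" unfolding gcong_iff by blast
  hence "int p dvd im (w ^ 4)" by (simp add: cong_0_iff del: of_int_power)
  hence dvd: "int p dvd re w \<or> int p dvd im w \<or> int p dvd re w - im w \<or> int p dvd re w + im w"
    unfolding re_im_power4 prime_dvd_mult_p using not_dvd_four by blast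
  have nz: "\<not> (int p dvd re w \<and> int p dvd im w)" using w0 by (simp add: gcong_iff cong_0_iff)
  \<comment> \<open>Doubling \<open>w\<close> avoids halving: \<open>(1 + i)^2 = 2 i\<close> and \<open>(1 + i)^3 = -2 (1 - i)\<close>.\<close>
  have "\<exists>c k. \<not> int p dvd c \<and> gcong w (of_int c * (1 + gi) ^ k) \<or> \<not> int p dvd c \<and> gcong (of_int 2 * w) (of_int c * (1 + gi) ^ k)"
    using dvd
  proof (elim disjE)
    assume d: "int p dvd im w"
    hence "gcong w (of_int (re w) * (1 + gi) ^ 0)" by (simp add: gcong_iff cong_0_iff)
    thus ?thesis using d nz by blast
  next
    assume d: "int p dvd re w"
    hence "gcong (of_int 2 * w) (of_int (im w) * (1 + gi) ^ 2)"
      by (simp add: gcong_iff cong_0_iff power2_eq_square mult.commute)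
    thus ?thesis using d nz by blast
  next
    assume d: "int p dvd re w - im w"
    hence "gcong w (of_int (re w) * (1 + gi) ^ 1)" 
      by (simp add: gcong_iff cong_iff_dvd_diff) (metis dvd_minus_iff minus_diff_eq)
    moreover have "\<not> int p dvd re w" using d nz dvd_diff[of "int p" "re w" "re w - im w"] by auto
    ultimately show ?thesis by blast
  next
    assume d: "int p dvd re w + im w"
    have "(1 + gi) ^ 3 = GInt (-2) 2" by (simp add: gint_eq_iff eval_nat_numeral)
    moreover have "int p dvd 2 * (re w + im w)" using d by (rule dvd_mult)
    ultimately have "gcong (of_int 2 * w) (of_int (im w) * (1 + gi) ^ 3)"
      by (simp add: gcong_iff cong_iff_dvd_diff algebra_simps)
    moreover have "\<not> int p dvd im w" using d nz dvd_diff[of "int p" "re w + im w" "im w"] by auto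
    ultimately show ?thesis by blast
  qed
  then obtain c k where c: "\<not> int p dvd c" and "gcong w (of_int c * (1 + gi) ^ k) \<or> gcong (of_int 2 * w) (of_int c * (1 + gi) ^ k)"
    by blast
  hence "orbit_sum w = orbit_sum (of_int c * (1 + gi) ^ k)"
    using orbit_sum_cong orbit_sum_of_int[OF not_dvd_two, of w] by metis
  also have "\<dots> = orbit_sum ((1 + gi) ^ k)" by (rule orbit_sum_of_int[OF c])
  also have "\<dots> = orbit_sum 1"
  proof (induction k)
    case (Suc k)
    thus ?case using orbit_sum_rotate[of "(1 + gi) ^ k"] by (simp add: mult.commute)
  qed simp
  finally show ?thesis using orb by simp
qed

text \<open>
  The average over all \<open>\<delta>\<close> determines the orbit sum of 1.  In it the term at \<open>(1 + i)^2 = 2 i\<close> vanishes, and those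
  at \<open>1 + i\<close> and \<open>(1 + i)^3 = -2 (1 - i)\<close> agree by conjugation.
\<close>

lemma sextic_sum_norm_raw:
  "sextic_sum 1 ^ 2 + 2 * sextic_sum (1 + gi) ^ 2 = 16 * int p * (int p - 1) ^ 2"
proof -
  have gm: "gmodular (\<lambda>\<delta>. sextic_sum \<delta> ^ 2)"
    by (intro gmodularI arg_cong[where f = "\<lambda>x. x ^ 2"] gmodularD[OF gmodular_sextic_sum])
  have nz: "\<not> gcong ((1 + gi) ^ k) 0" for k
  proof
    assume "gcong ((1 + gi) ^ k) 0"
    hence "gcong (1 + gi) 0" by (rule gcong_power_0)
    thus False using p_gt_2 by (simp add: gcong_iff cong_0_iff)
  qed
  have zero: "(0 :: gint) \<in> gresidues" by (simp add: gresidues_def)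
  have "4 * (\<Sum>\<delta>\<in>gresidues. sextic_sum \<delta> ^ 2) = (\<Sum>k<4. \<Sum>\<delta>\<in>gresidues. sextic_sum ((1 + gi) ^ k * \<delta>) ^ 2)"
    by (simp add: sum_gresidues_scale[OF gm nz])
  also have "\<dots> = (\<Sum>\<delta>\<in>gresidues. orbit_sum \<delta>)"
    unfolding orbit_sum_def by (subst sum.swap) (simp add: mult.commute)
  also have "\<dots> = (\<Sum>\<delta>\<in>gresidues - {0}. orbit_sum 1)"
  proof (rule sum.mono_neutral_cong_right)
    show "\<forall>\<delta>\<in>gresidues - (gresidues - {0}). orbit_sum \<delta> = 0"
      by (auto simp: orbit_sum_def sextic_sum_0)
    show "orbit_sum \<delta> = orbit_sum 1" if "\<delta> \<in> gresidues - {0}" for \<delta>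
      using that by (intro orbit_sum_const) (simp add: gresidues_0_iff)
  qed auto
  also have "\<dots> = (int p ^ 2 - 1) * orbit_sum 1"
    using zero p_pos by (simp add: card_Diff_subset card_gresidues of_nat_diff Suc_leI)
  finally have "(int p ^ 2 - 1) * (16 * int p * (int p - 1) ^ 2) = (int p ^ 2 - 1) * orbit_sum 1"
    unfolding sextic_sum_square_total by (simp add: mult_ac)
  moreover have "int p ^ 2 - 1 \<noteq> 0"
  proof
    assume "int p ^ 2 - 1 = 0"
    hence "(int p - 1) * (int p + 1) = 0" by (simp add: power2_eq_square algebra_simps)
    thus False using p_gt_2 by simp
  qed
  ultimately have "orbit_sum 1 = 16 * int p * (int p - 1) ^ 2" by simp
  moreover have "orbit_sum 1 = sextic_sum 1 ^ 2 + 2 * sextic_sum (1 + gi) ^ 2"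
  proof -
    have 2: "(1 + gi) ^ 2 = of_int 2 * gi" "(1 + gi) ^ 3 = of_int (-2) * conj (1 + gi)"
      by (simp_all add: gint_eq_iff eval_nat_numeral)
    have "sextic_sum ((1 + gi) ^ 2) ^ 2 = 0"
      unfolding 2 sextic_sum_of_int sextic_sum_gi by simp
    moreover have "sextic_sum ((1 + gi) ^ 3) ^ 2 = sextic_sum (1 + gi) ^ 2"
      unfolding 2 using not_dvd_two by (subst sextic_sum_of_int_square) (simp_all add: sextic_sum_conj)
    moreover have "orbit_sum 1 = sextic_sum 1 ^ 2 + sextic_sum (1 + gi) ^ 2 + sextic_sum ((1 + gi) ^ 2) ^ 2 + sextic_sum ((1 + gi) ^ 3) ^ 2"
      unfolding orbit_sum_def by (simp add: lessThan_nat_numeral lessThan_Suc numeral_3_eq_3 numeral_2_eq_2)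
    ultimately show ?thesis by simp
  qed
  ultimately show ?thesis by simp
qed

text \<open>
  The summand is homogeneous of even degree, so it is constant along each punctured line through the origin.
\<close>

lemma sextic_sum_dvd: "\<exists>c. sextic_sum \<delta> = (int p - 1) * c"
proof -
  have hom: "sextic_term \<delta> (of_int a * z) = sextic_term \<delta> z" if "\<not> int p dvd a" for a z
  proof -
    have "sextic_term \<delta> (of_int a * z) = chi (a ^ 2) * chi (gnorm z) * (chi (a ^ 4) * chi (re (\<delta> * z ^ 4)))"
    proof -
      have "\<delta> * (of_int a * z) ^ 4 = of_int (a ^ 4) * (\<delta> * z ^ 4)" by (simp add: power_mult_distrib mult_ac)
      hence "re (\<delta> * (of_int a * z) ^ 4) = a ^ 4 * re (\<delta> * z ^ 4)" by (simp del: of_int_power)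
      thus ?thesis unfolding sextic_term_def gnorm_mult gnorm_of_int by (simp add: chi_mult)
    qed
    thus ?thesis using that by (simp add: chi_power chi_even_power sextic_term_def)
  qed
  have col: "(\<Sum>b\<in>resid. sextic_term \<delta> (GInt a b)) = (\<Sum>t\<in>resid. sextic_term \<delta> (GInt 1 t))" if a: "\<not> int p dvd a" for a
  proof -
    have "modular (\<lambda>b. sextic_term \<delta> (GInt a b))"
      by (intro modularI sextic_term_cong gcong_refl) (simp add: gcong_iff)
    from sum_residues_scale[OF this a]
    have "(\<Sum>b\<in>resid. sextic_term \<delta> (GInt a b)) = (\<Sum>t\<in>resid. sextic_term \<delta> (GInt a (a * t)))" by simp
    moreover have "GInt a (a * t) = of_int a * GInt 1 t" for t by (simp add: gint_eq_iff)
    ultimately show ?thesis by (simp add: hom[OF a])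
  qed
  have axis: "sextic_term \<delta> (GInt 0 b) = sextic_term \<delta> gi" if "\<not> int p dvd b" for b
  proof -
    have "GInt 0 b = of_int b * gi" by (simp add: gint_eq_iff)
    thus ?thesis by (simp add: hom[OF that])
  qed
  have "sextic_sum \<delta> = (\<Sum>b\<in>resid. sextic_term \<delta> (GInt 0 b)) + (\<Sum>a\<in>resid - {0}. \<Sum>b\<in>resid. sextic_term \<delta> (GInt a b))"
    unfolding sextic_sum_def sum_gresidues by (rule sum.remove) simp_all
  also have "(\<Sum>a\<in>resid - {0}. \<Sum>b\<in>resid. sextic_term \<delta> (GInt a b)) = (\<Sum>a\<in>resid - {0}. \<Sum>t\<in>resid. sextic_term \<delta> (GInt 1 t))"
    by (intro sum.cong refl col) (simp add: residues_dvd_iff)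
  also have "(\<Sum>b\<in>resid. sextic_term \<delta> (GInt 0 b)) = (\<Sum>b\<in>resid - {0}. sextic_term \<delta> gi)"
  proof (rule sum.mono_neutral_cong_right)
    have "sextic_term \<delta> (GInt 0 0) = 0" by (simp add: sextic_term_def gnorm_def)
    thus "\<forall>b\<in>resid - (resid - {0}). sextic_term \<delta> (GInt 0 b) = 0" by auto
  qed (auto simp: axis residues_dvd_iff)
  finally have "sextic_sum \<delta> = (int p - 1) * (sextic_term \<delta> gi + (\<Sum>t\<in>resid. sextic_term \<delta> (GInt 1 t)))"
    using p_pos by (simp add: card_Diff_subset of_nat_diff algebra_simps)
  thus ?thesis by blast
qed

subsection \<open>The value modulo p\<close>

text \<open>
  Power sums over the field with \<open>p^2\<close> elements.  As conjugation is the Frobenius map \<open>z \<mapsto> z^p\<close>, an exponent that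
  is at least \<open>p\<close> can be lowered by \<open>p\<close> while the other one rises by 1.
\<close>

definition mixed_sum :: "nat \<Rightarrow> nat \<Rightarrow> gint" where
  "mixed_sum \<alpha> \<beta> = (\<Sum>z\<in>gresidues. z ^ \<alpha> * conj z ^ \<beta>)"

lemma mixed_sum_reduce_left: "gcong (mixed_sum (\<alpha> + p) \<beta>) (mixed_sum \<alpha> (\<beta> + 1))"
proof -
  have "mixed_sum (\<alpha> + p) \<beta> = (\<Sum>z\<in>gresidues. z ^ \<alpha> * (z ^ p * conj z ^ \<beta>))"
    by (simp add: mixed_sum_def power_add mult_ac)
  also have "gcong \<dots> (\<Sum>z\<in>gresidues. z ^ \<alpha> * (conj z * conj z ^ \<beta>))"
    by (intro gcong_sum gcong_mult frobenius gcong_refl)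
  finally show ?thesis by (simp add: mixed_sum_def)
qed

lemma mixed_sum_reduce_right: "gcong (mixed_sum \<alpha> (\<beta> + p)) (mixed_sum (\<alpha> + 1) \<beta>)"
proof -
  have frob: "gcong (conj z ^ p) z" for z using frobenius[of "conj z"] by simp
  have "mixed_sum \<alpha> (\<beta> + p) = (\<Sum>z\<in>gresidues. z ^ \<alpha> * (conj z ^ \<beta> * conj z ^ p))"
    by (simp add: mixed_sum_def power_add)
  also have "gcong \<dots> (\<Sum>z\<in>gresidues. z ^ \<alpha> * (conj z ^ \<beta> * z))"
    by (intro gcong_sum gcong_mult frob gcong_refl)
  finally show ?thesis by (simp add: mixed_sum_def mult_ac)
qed

lemma mixed_sum_diagonal: "gcong (mixed_sum (2 * m) (2 * m)) (-1)"
proof -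
  have "mixed_sum (2 * m) (2 * m) = (\<Sum>z\<in>gresidues. of_int (gnorm z ^ (2 * m)))"
    by (simp add: mixed_sum_def mult_conj[symmetric] power_mult_distrib)
  also have "gcong \<dots> (\<Sum>z\<in>gresidues. of_int (if z = 0 then 0 else 1))"
  proof (rule gcong_sum)
    fix z assume z: "z \<in> gresidues"
    have "[gnorm z ^ (2 * m) = (if z = 0 then 0 else 1)] (mod int p)"
    proof (cases "z = 0")
      case True
      thus ?thesis using m_pos by (simp add: gnorm_def power_0_left)
    next
      case False
      hence nd: "\<not> int p dvd gnorm z" using z by (simp add: gnorm_dvd_iff gresidues_0_iff)
      have "gnorm z ^ (2 * m) = (gnorm z ^ m) ^ 2" by (simp add: mult.commute power_mult)
      also have "[\<dots> = chi (gnorm z) ^ 2] (mod int p)" by (intro cong_pow cong_sym[OF chi_cong_power])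
      finally show ?thesis using False chi_square[OF nd] by simp
    qed
    thus "gcong (of_int (gnorm z ^ (2 * m))) (of_int (if z = 0 then 0 else 1))"
      by (simp only: gcong_of_int_iff)
  qed
  also have "(\<Sum>z\<in>gresidues. of_int (if z = 0 then 0 else 1)) = (of_int (int p ^ 2 - 1) :: gint)"
  proof -
    have "(0 :: gint) \<in> gresidues" by (simp add: gresidues_def)
    hence "(\<Sum>z\<in>gresidues. if z = 0 then 0 else 1) = int p ^ 2 - 1"
      using p_pos by (subst sum.remove[of _ 0]) (simp_all add: card_Diff_subset card_gresidues of_nat_diff Suc_leI)
    thus ?thesis by (simp only: of_int_sum[symmetric])
  qed
  also have "gcong (of_int (int p ^ 2 - 1)) (of_int (-1))"
    unfolding gcong_of_int_iff by (simp add: cong_iff_dvd_diff)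
  also have "of_int (-1) = (-1 :: gint)" by simp
  finally show ?thesis .
qed

text \<open>
  A monomial \<open>a^r b^s\<close> in the expansion has a nonzero sum only if both exponents are positive multiples of
  \<open>p - 1 = 2 m\<close>, but here they add up to \<open>2 m\<close>.
\<close>

lemma mixed_sum_small:
  assumes "\<alpha> + \<beta> = 2 * m"
  shows "gcong (mixed_sum \<alpha> \<beta>) 0"
proof -
  define c :: "nat \<Rightarrow> nat \<Rightarrow> gint" where "c k l = of_nat (\<alpha> choose k) * of_nat (\<beta> choose l) * gi ^ k * (- gi) ^ l" for k l
  have expand: "z ^ \<alpha> * conj z ^ \<beta> = (\<Sum>k\<le>\<alpha>. \<Sum>l\<le>\<beta>. c k l * of_int (re z ^ (\<alpha> - k + (\<beta> - l)) * im z ^ (k + l)))" for z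
  proof -
    have z: "z = of_int (im z) * gi + of_int (re z)" and cz: "conj z = of_int (im z) * (- gi) + of_int (re z)"
      by (simp_all add: gint_eq_iff)
    have "z ^ \<alpha> * conj z ^ \<beta> = (of_int (im z) * gi + of_int (re z)) ^ \<alpha> * (of_int (im z) * (- gi) + of_int (re z)) ^ \<beta>"
      using z cz by simp
    also have "\<dots> = (\<Sum>k\<le>\<alpha>. \<Sum>l\<le>\<beta>. c k l * of_int (re z ^ (\<alpha> - k + (\<beta> - l)) * im z ^ (k + l)))"
      unfolding binomial_ring sum_product
      by (intro sum.cong refl) (simp only: c_def power_mult_distrib power_add of_int_mult of_int_power mult_ac)
    finally show ?thesis .
  qed
  have "mixed_sum \<alpha> \<beta> = (\<Sum>k\<le>\<alpha>. \<Sum>z\<in>gresidues. \<Sum>l\<le>\<beta>. c k l * of_int (re z ^ (\<alpha> - k + (\<beta> - l)) * im z ^ (k + l)))"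
    unfolding mixed_sum_def expand by (rule sum.swap)
  also have "\<dots> = (\<Sum>k\<le>\<alpha>. \<Sum>l\<le>\<beta>. \<Sum>z\<in>gresidues. c k l * of_int (re z ^ (\<alpha> - k + (\<beta> - l)) * im z ^ (k + l)))"
    by (intro sum.cong refl sum.swap)
  also have "\<dots> = (\<Sum>k\<le>\<alpha>. \<Sum>l\<le>\<beta>. c k l * of_int ((\<Sum>a\<in>resid. a ^ (\<alpha> - k + (\<beta> - l))) * (\<Sum>b\<in>resid. b ^ (k + l))))"
    by (intro sum.cong refl) (simp only: sum_distrib_left[symmetric] of_int_sum[symmetric] sum_gresidues gint.sel sum_product)
  also have "gcong \<dots> (\<Sum>k\<le>\<alpha>. \<Sum>l\<le>\<beta>. c k l * of_int 0)"
  proof (intro gcong_sum gcong_mult gcong_refl)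
    fix k l assume kl: "k \<in> {..\<alpha>}" "l \<in> {..\<beta>}"
    have "int p dvd (\<Sum>a\<in>resid. a ^ (\<alpha> - k + (\<beta> - l))) \<or> int p dvd (\<Sum>b\<in>resid. b ^ (k + l))"
    proof (cases "k + l > 0 \<and> 2 * m dvd k + l")
      case False
      thus ?thesis using power_sum_cong[of "k + l"] by (auto simp: cong_0_iff)
    next
      case True
      hence "2 * m \<le> k + l" by (auto dest: dvd_imp_le)
      hence "\<alpha> - k + (\<beta> - l) = 0" using assms kl by auto
      thus ?thesis using power_sum_cong[of "\<alpha> - k + (\<beta> - l)"] by (simp add: cong_0_iff)
    qed
    thus "gcong (of_int ((\<Sum>a\<in>resid. a ^ (\<alpha> - k + (\<beta> - l))) * (\<Sum>b\<in>resid. b ^ (k + l)))) (of_int 0)"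
      unfolding gcong_of_int_iff cong_0_iff by auto
  qed
  finally show ?thesis by simp
qed

lemma mixed_sum_medium:
  assumes "\<alpha> + \<beta> = 4 * m" and "\<alpha> \<noteq> 2 * m"
  shows "gcong (mixed_sum \<alpha> \<beta>) 0"
proof (cases "\<alpha> \<ge> p")
  case True
  then obtain \<alpha>' where \<alpha>: "\<alpha> = \<alpha>' + p" by (metis le_add_diff_inverse2)
  have "\<alpha>' + (\<beta> + 1) = 2 * m" using \<alpha> assms p_eq by linarith
  from gcong_trans[OF mixed_sum_reduce_left mixed_sum_small[OF this]] show ?thesis unfolding \<alpha> .
next
  case False
  hence "\<beta> \<ge> p" using assms p_eq by linarith
  then obtain \<beta>' where \<beta>: "\<beta> = \<beta>' + p" by (metis le_add_diff_inverse2)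
  have "\<alpha> + 1 + \<beta>' = 2 * m" using \<beta> assms p_eq by linarith
  from gcong_trans[OF mixed_sum_reduce_right mixed_sum_small[OF this]] show ?thesis unfolding \<beta> .
qed

text \<open>
  Two reductions lead from degree \<open>6 m\<close> to degree \<open>2 m\<close>, where the sum vanishes, except when the first
  reduction arrives at the pair \<open>(2 m, 2 m)\<close>, in which neither exponent reaches \<open>p\<close>.
\<close>

lemma mixed_sum_large:
  assumes "\<alpha> + \<beta> = 6 * m"
  shows "gcong (mixed_sum \<alpha> \<beta>) (if \<alpha> = 4 * m + 1 \<or> \<beta> = 4 * m + 1 then -1 else 0)"
proof (cases "\<alpha> \<ge> p")
  case True
  then obtain \<alpha>' where \<alpha>: "\<alpha> = \<alpha>' + p" by (metis le_add_diff_inverse2)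
  have sum: "\<alpha>' + (\<beta> + 1) = 4 * m" using \<alpha> assms p_eq by linarith
  have iff: "\<alpha> = 4 * m + 1 \<or> \<beta> = 4 * m + 1 \<longleftrightarrow> \<alpha>' = 2 * m" using \<alpha> assms p_eq by linarith
  have "gcong (mixed_sum \<alpha>' (\<beta> + 1)) (if \<alpha>' = 2 * m then -1 else 0)"
  proof (cases "\<alpha>' = 2 * m")
    case True
    hence "\<beta> + 1 = 2 * m" using sum by linarith
    thus ?thesis using mixed_sum_diagonal True by simp
  qed (use mixed_sum_medium[OF sum] in simp)
  thus ?thesis unfolding iff unfolding \<alpha> by (rule gcong_trans[OF mixed_sum_reduce_left])
next
  case False
  hence "\<beta> \<ge> p" using assms p_eq m_pos by linarith
  then obtain \<beta>' where \<beta>: "\<beta> = \<beta>' + p" by (metis le_add_diff_inverse2)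
  have sum: "\<alpha> + 1 + \<beta>' = 4 * m" using \<beta> assms p_eq by linarith
  have iff: "\<alpha> = 4 * m + 1 \<or> \<beta> = 4 * m + 1 \<longleftrightarrow> \<alpha> + 1 = 2 * m" using \<beta> assms p_eq False by linarith
  have "gcong (mixed_sum (\<alpha> + 1) \<beta>') (if \<alpha> + 1 = 2 * m then -1 else 0)"
  proof (cases "\<alpha> + 1 = 2 * m")
    case True
    hence "\<beta>' = 2 * m" using sum by linarith
    thus ?thesis using mixed_sum_diagonal True by simp
  qed (use mixed_sum_medium[OF sum] in simp)
  thus ?thesis unfolding iff unfolding \<beta> by (rule gcong_trans[OF mixed_sum_reduce_right])
qed

text \<open>
  By Euler's criterion the summand is \<open>(N(z) Re(z^4))^m\<close>, and \<open>2 Re(z^4) = z^4 + conj(z)^4\<close>.  In the binomial expansion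
  only \<open>k = j\<close> and \<open>k = 3 j + 1\<close> survive.
\<close>

lemma sextic_sum_cong_binomial: "[sextic_sum 1 = 2 * int (m choose j)] (mod int p)"
proof -
  have "gcong (of_int (2 ^ m * sextic_sum 1)) (of_int (\<Sum>z\<in>gresidues. (gnorm z * (2 * re (z ^ 4))) ^ m))"
  proof -
    have "[2 ^ m * sextic_sum 1 = 2 ^ m * (\<Sum>z\<in>gresidues. gnorm z ^ m * re (z ^ 4) ^ m)] (mod int p)"
      unfolding sextic_sum_def sextic_term_def mult_1_left
      by (intro cong_mult cong_sum cong_refl chi_cong_power)
    also have "2 ^ m * (\<Sum>z\<in>gresidues. gnorm z ^ m * re (z ^ 4) ^ m) = (\<Sum>z\<in>gresidues. (gnorm z * (2 * re (z ^ 4))) ^ m)"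
      unfolding sum_distrib_left by (intro sum.cong refl) (simp only: power_mult_distrib mult_ac)
    finally show ?thesis by (simp only: gcong_of_int_iff)
  qed
  also have "of_int (\<Sum>z\<in>gresidues. (gnorm z * (2 * re (z ^ 4))) ^ m) = (\<Sum>z\<in>gresidues. \<Sum>k\<le>m. of_nat (m choose k) * (z ^ (m + 4 * k) * conj z ^ (m + 4 * (m - k))))"
    unfolding of_int_sum
  proof (rule sum.cong[OF refl])
    fix z
    have "of_int ((gnorm z * (2 * re (z ^ 4))) ^ m) = ((z * conj z) * (z ^ 4 + conj z ^ 4)) ^ m"
      by (simp only: mult_conj add_conj conj_power[symmetric] of_int_mult of_int_power)
    also have "\<dots> = (z * conj z) ^ m * (\<Sum>k\<le>m. of_nat (m choose k) * (z ^ 4) ^ k * (conj z ^ 4) ^ (m - k))"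
      by (simp only: power_mult_distrib binomial_ring)
    also have "\<dots> = (\<Sum>k\<le>m. of_nat (m choose k) * (z ^ (m + 4 * k) * conj z ^ (m + 4 * (m - k))))"
      by (simp only: sum_distrib_left power_mult[symmetric] power_mult_distrib power_add mult_ac)
    finally show "of_int ((gnorm z * (2 * re (z ^ 4))) ^ m) = (\<Sum>k\<le>m. of_nat (m choose k) * (z ^ (m + 4 * k) * conj z ^ (m + 4 * (m - k))))" .
  qed
  also have "\<dots> = (\<Sum>k\<le>m. of_nat (m choose k) * mixed_sum (m + 4 * k) (m + 4 * (m - k)))"
    by (subst sum.swap) (simp add: mixed_sum_def sum_distrib_left)
  also have "gcong \<dots> (\<Sum>k\<le>m. of_nat (m choose k) * (if m + 4 * k = 4 * m + 1 \<or> m + 4 * (m - k) = 4 * m + 1 then -1 else 0))"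
    by (intro gcong_sum gcong_mult gcong_refl mixed_sum_large) auto
  also have "\<dots> = (\<Sum>k\<in>{j, 3 * j + 1}. - of_nat (m choose k))"
  proof (rule sum.mono_neutral_cong_right)
    have "m + 4 * k = 4 * m + 1 \<or> m + 4 * (m - k) = 4 * m + 1 \<longleftrightarrow> k = j \<or> k = 3 * j + 1" if "k \<le> m" for k
      using that m_j by linarith
    thus "\<forall>k\<in>{..m} - {j, 3 * j + 1}. of_nat (m choose k) * (if m + 4 * k = 4 * m + 1 \<or> m + 4 * (m - k) = 4 * m + 1 then -1 else 0) = (0 :: gint)"
      and "\<And>k. k \<in> {j, 3 * j + 1} \<Longrightarrow> of_nat (m choose k) * (if m + 4 * k = 4 * m + 1 \<or> m + 4 * (m - k) = 4 * m + 1 then -1 else 0) = (- of_nat (m choose k) :: gint)"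
      using m_j by auto
  qed (use m_j in auto)
  also have "\<dots> = of_int (- 2 * int (m choose j))"
    using binomial_symmetric[of j m] m_j by (simp add: gint_eq_iff)
  finally have "[2 ^ m * sextic_sum 1 = - 2 * int (m choose j)] (mod int p)"
    by (simp only: gcong_of_int_iff)
  moreover have "[2 ^ m * sextic_sum 1 = chi 2 * sextic_sum 1] (mod int p)"
    by (intro cong_mult cong_refl cong_sym[OF chi_cong_power])
  ultimately have "[- sextic_sum 1 = - (2 * int (m choose j))] (mod int p)"
    unfolding chi_2' by (simp add: cong_def)
  thus ?thesis by (simp only: cong_minus_minus_iff)
qed

end

section \<open>Representations by binary quadratic forms\<close>

text \<open>
  By the composition identity \<open>(x u + N v y)^2 + N (x v - u y)^2 = q^2\<close>.  The prime \<open>q\<close> divides one of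
  \<open>x v - u y\<close> and \<open>x v + u y\<close>, and a nonzero multiple of \<open>q\<close> in that place would be too large as \<open>N \<ge> 2\<close>.
\<close>

lemma prime_form_representation_unique:
  fixes q N u v x y :: int
  assumes q: "prime q" and N: "N \<ge> 2"
    and uv: "q = u ^ 2 + N * v ^ 2" and xy: "q = x ^ 2 + N * y ^ 2"
  shows "u ^ 2 = x ^ 2"
proof -
  have main: "u ^ 2 = x ^ 2" if xy': "q = x ^ 2 + N * z ^ 2" and dvd: "q dvd x * v - u * z" for z
  proof -
    define D where "D = x * v - u * z"
    have id: "(x * u + N * (z * v)) ^ 2 + N * D ^ 2 = (x ^ 2 + N * z ^ 2) * (u ^ 2 + N * v ^ 2)"
      unfolding D_def by (simp add: power2_eq_square algebra_simps)
    have "D = 0"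
    proof (rule ccontr)
      assume "D \<noteq> 0"
      hence "q \<le> \<bar>D\<bar>" using dvd_imp_le_int[of D q] dvd prime_gt_0_int[OF q] by (simp add: D_def)
      hence "q ^ 2 \<le> D ^ 2" using prime_gt_0_int[OF q] by (simp add: abs_le_square_iff[symmetric])
      moreover have "2 * D ^ 2 \<le> N * D ^ 2" using N by (intro mult_right_mono) auto
      moreover have "N * D ^ 2 \<le> q ^ 2" using id unfolding uv[symmetric] xy'[symmetric]
        by (metis add_increasing order_refl zero_le_power2 power2_eq_square)
      moreover have "q ^ 2 > 0" using prime_gt_0_int[OF q] by simp
      ultimately show False by linarith
    qed
    hence "x * v = u * z" by (simp add: D_def)
    hence "x ^ 2 * (N * v ^ 2) = u ^ 2 * (N * z ^ 2)"
      by (metis mult.left_commute power_mult_distrib)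
    moreover have "N * v ^ 2 = q - u ^ 2" "N * z ^ 2 = q - x ^ 2" using uv xy' by simp_all
    ultimately have "x ^ 2 * q = u ^ 2 * q" by (simp add: algebra_simps)
    thus ?thesis using prime_gt_0_int[OF q] by simp
  qed
  have "(x * v - u * y) * (x * v + u * y) = x ^ 2 * v ^ 2 - u ^ 2 * y ^ 2"
    by (simp add: power2_eq_square algebra_simps)
  also have "\<dots> = (q - N * y ^ 2) * v ^ 2 - (q - N * v ^ 2) * y ^ 2"
    using uv xy by (metis add_diff_cancel_right')
  also have "\<dots> = q * (v ^ 2 - y ^ 2)" by (simp add: algebra_simps)
  finally have "q dvd (x * v - u * y) * (x * v + u * y)" by simp
  hence "q dvd x * v - u * y \<or> q dvd x * v - u * (- y)" using q by (simp add: prime_dvd_mult_iff)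
  thus ?thesis using main[of y] main[of "- y"] xy by auto
qed

lemma even_form_halve:
  fixes a b n :: int
  assumes "a ^ 2 + 2 * b ^ 2 = 4 * n"
  shows "\<exists>c d. a = 2 * c \<and> b = 2 * d \<and> c ^ 2 + 2 * d ^ 2 = n"
proof -
  have "a ^ 2 = 2 * (2 * n - b ^ 2)" using assms by simp
  hence "even (a ^ 2)" by simp
  then obtain c where c: "a = 2 * c" by (auto elim: evenE)
  have "b ^ 2 = 2 * (n - c ^ 2)" using assms by (simp add: c power2_eq_square)
  hence "even (b ^ 2)" by simp
  then obtain d where d: "b = 2 * d" by (auto elim: evenE)
  have "c ^ 2 + 2 * d ^ 2 = n" using assms by (simp add: c d power2_eq_square)
  thus ?thesis using c d by blast
qed

text \<open>
  The factor 16 comes off by parity: \<open>a\<close> and \<open>b\<close> can be halved twice.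
\<close>

lemma form_quarter:
  fixes a b n :: int
  assumes "a ^ 2 + 2 * b ^ 2 = 16 * n"
  shows "\<exists>u v. a = 4 * u \<and> n = u ^ 2 + 2 * v ^ 2"
proof -
  obtain c d where 1: "a = 2 * c" "c ^ 2 + 2 * d ^ 2 = 4 * n"
    using even_form_halve[of a b "4 * n"] assms by auto
  obtain u v where "c = 2 * u" "u ^ 2 + 2 * v ^ 2 = n"
    using even_form_halve[OF 1(2)] by auto
  thus ?thesis using 1 by (intro exI[of _ u] exI[of _ v]) simp
qed

context odd_prime
begin

text \<open>
  In both cases there is a character sum \<open>a\<close> with \<open>a^2 + 2 b^2 = 16 p\<close> and \<open>a \<equiv> \<plusminus>2 C(m, p div 8)\<close>.
\<close>

lemma binomial_square_cong_minus_2: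
  assumes "p mod 8 = 1 \<or> p mod 8 = 3" and xy: "int p = x ^ 2 + 2 * y ^ 2"
  shows "[int (m choose (p div 8)) ^ 2 = 4 * x ^ 2] (mod int p)"
proof -
  define C where "C = int (m choose (p div 8))"
  obtain a b where ab: "a ^ 2 + 2 * b ^ 2 = 16 * int p" and sq: "[a ^ 2 = 4 * C ^ 2] (mod int p)"
    using assms(1)
  proof (elim disjE)
    assume p1: "p mod 8 = 1"
    have "[quintic_sum 1 ^ 2 = (- 2 * C) ^ 2] (mod int p)"
      unfolding C_def by (intro cong_pow quintic_sum_cong_binomial[OF p1])
    thus thesis using that[OF quintic_sum_norm[OF p1]] by (simp add: power_mult_distrib)
  next
    assume "p mod 8 = 3"
    then interpret prime_3_mod_8 p by unfold_locales
    obtain a b where a: "sextic_sum 1 = (int p - 1) * a" and b: "sextic_sum (1 + gi) = (int p - 1) * b"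
      using sextic_sum_dvd by metis
    have "(int p - 1) ^ 2 * (a ^ 2 + 2 * b ^ 2) = ((int p - 1) * a) ^ 2 + 2 * ((int p - 1) * b) ^ 2"
      by (simp only: power_mult_distrib distrib_left mult.left_commute)
    also have "\<dots> = (int p - 1) ^ 2 * (16 * int p)"
      unfolding a[symmetric] b[symmetric] sextic_sum_norm_raw by (simp only: mult_ac)
    finally have "(int p - 1) ^ 2 * (a ^ 2 + 2 * b ^ 2) = (int p - 1) ^ 2 * (16 * int p)" .
    hence n: "a ^ 2 + 2 * b ^ 2 = 16 * int p" using p_gt_2 by simp
    have minus: "[(int p - 1) * a = (0 - 1) * a] (mod int p)"
      by (intro cong_mult cong_diff cong_refl) (simp add: cong_0_iff)
    have "[(int p - 1) * a = 2 * C] (mod int p)"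
      using sextic_sum_cong_binomial unfolding a C_def j_def .
    from cong_trans[OF cong_sym[OF minus] this] have "[- a = 2 * C] (mod int p)" by simp
    hence "[(- a) ^ 2 = (2 * C) ^ 2] (mod int p)" by (rule cong_pow)
    thus thesis using that[OF n] by (simp add: power_mult_distrib)
  qed
  obtain u v where u: "a = 4 * u" and uv: "int p = u ^ 2 + 2 * v ^ 2" using form_quarter[OF ab] by blast
  have "u ^ 2 = x ^ 2" by (rule prime_form_representation_unique[OF prime_int_p _ uv xy]) simp
  hence "[4 * C ^ 2 = 4 * (4 * x ^ 2)] (mod int p)" using sq u by (simp add: power_mult_distrib cong_sym)
  thus ?thesis unfolding C_def[symmetric] by (rule cong_cancel1) (rule not_dvd_four)
qed

section \<open>Legendre polynomials at the square root of minus three\<close>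

text \<open>
  Completing the cube: \<open>9 (x + 1) (3 x^2 + 1) = (3 x + 1)^3 + 8\<close>.
\<close>

lemma sum_chi_cubic:
  assumes "p \<noteq> 3"
  shows "(\<Sum>x\<in>resid. chi ((x + 1) * (3 * x ^ 2 + 1))) = chi 2 * cubic_sum 1"
proof -
  have 3: "\<not> int p dvd 3" by (rule not_dvd_three[OF assms])
  have "chi ((x + 1) * (3 * x ^ 2 + 1)) = chi ((3 * x + 1) ^ 3 + 8)" for x
  proof -
    have "(3 * x + 1) ^ 3 + 8 = 3 ^ 2 * ((x + 1) * (3 * x ^ 2 + 1))"
      by (simp add: eval_nat_numeral algebra_simps)
    moreover have "chi (3 ^ 2) = 1" using chi_square[OF 3] by (simp only: chi_power)
    ultimately show ?thesis by (simp only: chi_mult mult_1_left)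
  qed
  hence "(\<Sum>x\<in>resid. chi ((x + 1) * (3 * x ^ 2 + 1))) = (\<Sum>x\<in>resid. chi ((3 * x + 1) ^ 3 + 8))" by simp
  also have "\<dots> = cubic_sum (1 * 2 ^ 3)"
    unfolding cubic_sum_def mult_1_left
    by (subst sum_residues_affine[OF _ 3, where f = "\<lambda>x. chi (x ^ 3 + 8)"]) (intro modular_chi_poly cong_add cong_pow cong_refl | simp)+
  also have "\<dots> = chi 2 * cubic_sum 1" by (rule cubic_sum_scale[OF not_dvd_two])
  finally show ?thesis .
qed

lemma multiple_in_range:
  fixes i l n :: nat
  assumes "i \<le> n" and "l \<le> n" and "n > 0"
  shows "2 * i + l > 0 \<and> 2 * n dvd 2 * i + l \<longleftrightarrow> l = 2 * n - 2 * i"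
proof (rule iffI)
  assume pos: "2 * i + l > 0 \<and> 2 * n dvd 2 * i + l"
  then obtain e where e: "2 * i + l = 2 * n * e" by (elim conjE dvdE)
  have "e \<noteq> 0" using pos e by (intro notI) simp
  moreover have "e < 2"
  proof (rule ccontr)
    assume "\<not> e < 2"
    hence "2 * n * 2 \<le> 2 * n * e" by (intro mult_left_mono) auto
    thus False using e assms by linarith
  qed
  ultimately have "e = 1" by linarith
  thus "l = 2 * n - 2 * i" using e by simp
qed (use assms in auto)

text \<open>
  The polynomial has degree \<open>3 m < 2 (p - 1)\<close>, so the power sums pick out the coefficient of \<open>x^(2m)\<close>.
\<close>

lemma sum_cubic_power_cong:
  "[(\<Sum>x\<in>resid. ((x + 1) * (3 * x ^ 2 + 1)) ^ m) = - (\<Sum>i\<le>m. int (m choose i) * 3 ^ i * int (m choose (2 * m - 2 * i)))] (mod int p)"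
proof -
  define c where "c i l = int (m choose i) * 3 ^ i * int (m choose l)" for i l
  have "((x + 1) * (3 * x ^ 2 + 1)) ^ m = (\<Sum>i\<le>m. \<Sum>l\<le>m. c i l * x ^ (2 * i + l))" for x
  proof -
    have "((x + 1) * (3 * x ^ 2 + 1)) ^ m = (3 * x ^ 2 + 1) ^ m * (x + 1) ^ m"
      by (simp only: power_mult_distrib mult.commute)
    also have "\<dots> = (\<Sum>i\<le>m. \<Sum>l\<le>m. c i l * x ^ (2 * i + l))"
      unfolding binomial_ring sum_product
      by (intro sum.cong refl) (simp only: c_def power_mult_distrib power_add power_mult[symmetric] power_one mult_1_right of_nat_id mult_ac)
    finally show ?thesis .
  qed
  hence "(\<Sum>x\<in>resid. ((x + 1) * (3 * x ^ 2 + 1)) ^ m) = (\<Sum>x\<in>resid. \<Sum>i\<le>m. \<Sum>l\<le>m. c i l * x ^ (2 * i + l))" by simp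
  also have "\<dots> = (\<Sum>i\<le>m. \<Sum>x\<in>resid. \<Sum>l\<le>m. c i l * x ^ (2 * i + l))" by (rule sum.swap)
  also have "\<dots> = (\<Sum>i\<le>m. \<Sum>l\<le>m. \<Sum>x\<in>resid. c i l * x ^ (2 * i + l))" by (intro sum.cong refl sum.swap)
  also have "\<dots> = (\<Sum>i\<le>m. \<Sum>l\<le>m. c i l * (\<Sum>x\<in>resid. x ^ (2 * i + l)))" by (simp add: sum_distrib_left)
  finally have expand: "(\<Sum>x\<in>resid. ((x + 1) * (3 * x ^ 2 + 1)) ^ m) = (\<Sum>i\<le>m. \<Sum>l\<le>m. c i l * (\<Sum>x\<in>resid. x ^ (2 * i + l)))" .
  have powers: "[(\<Sum>i\<le>m. \<Sum>l\<le>m. c i l * (\<Sum>x\<in>resid. x ^ (2 * i + l))) = (\<Sum>i\<le>m. \<Sum>l\<le>m. c i l * (if 2 * i + l > 0 \<and> 2 * m dvd 2 * i + l then -1 else 0))] (mod int p)"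
    by (intro cong_sum cong_mult cong_refl power_sum_cong)
  have select: "(\<Sum>i\<le>m. \<Sum>l\<le>m. c i l * (if 2 * i + l > 0 \<and> 2 * m dvd 2 * i + l then -1 else 0)) = (\<Sum>i\<le>m. - c i (2 * m - 2 * i))"
  proof (rule sum.cong[OF refl])
    fix i assume i: "i \<in> {..m}"
    have iff: "2 * i + l > 0 \<and> 2 * m dvd 2 * i + l \<longleftrightarrow> l = 2 * m - 2 * i" if "l \<le> m" for l
      using multiple_in_range[of i m l] i that m_pos by simp
    have "(\<Sum>l\<le>m. c i l * (if 2 * i + l > 0 \<and> 2 * m dvd 2 * i + l then -1 else 0)) = (\<Sum>l\<le>m. if l = 2 * m - 2 * i then - c i l else 0)"
    proof (rule sum.cong[OF refl])
      fix l assume "l \<in> {..m}"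
      hence "l \<le> m" by simp
      show "c i l * (if 2 * i + l > 0 \<and> 2 * m dvd 2 * i + l then -1 else 0) = (if l = 2 * m - 2 * i then - c i l else 0)"
        unfolding iff[OF \<open>l \<le> m\<close>] by simp
    qed
    also have "\<dots> = - c i (2 * m - 2 * i)"
      by (simp add: sum.delta' c_def)
    finally show "(\<Sum>l\<le>m. c i l * (if 2 * i + l > 0 \<and> 2 * m dvd 2 * i + l then -1 else 0)) = - c i (2 * m - 2 * i)" .
  qed
  show ?thesis
    using powers unfolding expand[symmetric] select by (simp add: c_def sum_negf)
qed

definition legendre_at_minus_3 :: int where
  "legendre_at_minus_3 = (\<Sum>k\<le>m div 2. (-1) ^ k * int (m choose k) * int ((2 * m - 2 * k) choose m) * (-3) ^ (m div 2 - k))"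

lemma legendre_even_part_minus_3: "legendre_even_part m (-3 :: rat) = of_int legendre_at_minus_3"
  by (simp add: legendre_even_part_def legendre_at_minus_3_def)

text \<open>
  Modulo \<open>p\<close> the coefficient \<open>C(2m-2k, m)\<close> is \<open>\<plusminus>C(m, 2k)\<close>, which makes the Legendre value the coefficient of
  \<open>x^(2m)\<close> in \<open>((x + 1) (3 x^2 + 1))^m\<close> up to a sign and a power of 3.
\<close>

lemma legendre_at_minus_3_cong:
  assumes "p \<noteq> 3"
  shows "[3 ^ (2 * (m - m div 2)) * legendre_at_minus_3 ^ 2 = cubic_sum 1 ^ 2] (mod int p)"
proof -
  define h where "h = m div 2"
  define R where "R = (\<Sum>k\<le>h. int (m choose k) * int (m choose (2 * k)) * 3 ^ (h - k))"
  have h: "2 * h \<le> m" by (simp add: h_def)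
  have "[legendre_at_minus_3 = (\<Sum>k\<le>h. (-1) ^ k * int (m choose k) * ((-1) ^ m * int (m choose (2 * k))) * (-3) ^ (h - k))] (mod int p)"
    unfolding legendre_at_minus_3_def h_def[symmetric]
  proof (intro cong_sum cong_mult cong_refl)
    fix k assume "k \<in> {..h}"
    hence k: "2 * k \<le> m" using h by simp
    have "[int ((m + (m - 2 * k)) choose (m - 2 * k)) = (-1) ^ (m - 2 * k) * int (m choose (m - 2 * k))] (mod int p)"
    proof (rule binomial_negate_cong)
      show "[int m + int m + 1 = 0] (mod int p)" using int_p_eq by (simp add: cong_0_iff)
      show "m - 2 * k < p" using p_eq by linarith
    qed
    moreover have "(2 * m - 2 * k) choose m = (m + (m - 2 * k)) choose (m - 2 * k)"
    proof -
      have e: "m + (m - 2 * k) = 2 * m - 2 * k" "2 * m - 2 * k - m = m - 2 * k" "m \<le> 2 * m - 2 * k"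
        using k by simp_all
      show ?thesis unfolding e(1) using binomial_symmetric[OF e(3)] unfolding e(2) .
    qed
    moreover have "(-1 :: int) ^ (m - 2 * k) = (-1) ^ m"
      using k by (simp add: minus_one_power_iff)
    moreover have "m choose (m - 2 * k) = m choose (2 * k)" using k by (simp add: binomial_symmetric[symmetric])
    ultimately show "[int ((2 * m - 2 * k) choose m) = (-1) ^ m * int (m choose (2 * k))] (mod int p)" by simp
  qed
  also have "(\<Sum>k\<le>h. (-1) ^ k * int (m choose k) * ((-1) ^ m * int (m choose (2 * k))) * (-3) ^ (h - k)) = (-1) ^ (m + h) * R"
    unfolding R_def sum_distrib_left
  proof (rule sum.cong[OF refl])
    fix k assume "k \<in> {..h}"
    hence "(-1 :: int) ^ h = (-1) ^ k * (-1) ^ (h - k)" by (simp flip: power_add)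
    thus "(-1) ^ k * int (m choose k) * ((-1) ^ m * int (m choose (2 * k))) * (-3) ^ (h - k) = (-1) ^ (m + h) * (int (m choose k) * int (m choose (2 * k)) * 3 ^ (h - k))"
      by (simp add: power_add power_minus[of 3])
  qed
  finally have "[legendre_at_minus_3 ^ 2 = ((-1) ^ (m + h) * R) ^ 2] (mod int p)" by (rule cong_pow)
  hence L: "[legendre_at_minus_3 ^ 2 = R ^ 2] (mod int p)"
    by (simp add: power_mult_distrib flip: power_mult)
  have "(\<Sum>i\<le>m. int (m choose i) * 3 ^ i * int (m choose (2 * m - 2 * i))) = 3 ^ (m - h) * R"
  proof -
    have "(\<Sum>i\<le>m. int (m choose i) * 3 ^ i * int (m choose (2 * m - 2 * i))) = (\<Sum>k\<le>m. int (m choose k) * 3 ^ (m - k) * int (m choose (2 * k)))"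
      by (rule sum.reindex_bij_witness[of _ "\<lambda>k. m - k" "\<lambda>k. m - k"]) (auto simp: binomial_symmetric[symmetric] diff_mult_distrib2)
    also have "\<dots> = (\<Sum>k\<le>h. int (m choose k) * 3 ^ (m - k) * int (m choose (2 * k)))"
      by (rule sum.mono_neutral_right) (auto simp: h_def binomial_eq_0)
    also have "\<dots> = 3 ^ (m - h) * R"
      unfolding R_def sum_distrib_left
    proof (rule sum.cong[OF refl])
      fix k assume "k \<in> {..h}"
      hence "(3 :: int) ^ (m - k) = 3 ^ (m - h) * 3 ^ (h - k)" using h by (simp flip: power_add)
      thus "int (m choose k) * 3 ^ (m - k) * int (m choose (2 * k)) = 3 ^ (m - h) * (int (m choose k) * int (m choose (2 * k)) * 3 ^ (h - k))"
        by simp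
    qed
    finally show ?thesis .
  qed
  hence power_sum: "[(\<Sum>x\<in>resid. ((x + 1) * (3 * x ^ 2 + 1)) ^ m) = - (3 ^ (m - h) * R)] (mod int p)"
    using sum_cubic_power_cong by simp
  have "[chi 2 * cubic_sum 1 = (\<Sum>x\<in>resid. ((x + 1) * (3 * x ^ 2 + 1)) ^ m)] (mod int p)"
    unfolding sum_chi_cubic[OF assms, symmetric] by (intro cong_sum chi_cong_power)
  from cong_trans[OF this power_sum] have "[chi 2 * cubic_sum 1 = - (3 ^ (m - h) * R)] (mod int p)" .
  hence "[(chi 2 * cubic_sum 1) ^ 2 = (- (3 ^ (m - h) * R)) ^ 2] (mod int p)" by (rule cong_pow)
  hence "[cubic_sum 1 ^ 2 = 3 ^ (2 * (m - h)) * R ^ 2] (mod int p)"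
    using chi_square[OF not_dvd_two] by (simp add: power_mult_distrib mult.commute[of 2] power_mult)
  also have "[3 ^ (2 * (m - h)) * R ^ 2 = 3 ^ (2 * (m - h)) * legendre_at_minus_3 ^ 2] (mod int p)"
    by (intro cong_mult cong_refl cong_sym[OF L])
  finally show ?thesis unfolding h_def by (rule cong_sym)
qed

text \<open>
  If \<open>w\<close> is a primitive cube root of unity, then \<open>(2 w + 1)^2 = -3\<close>.
\<close>

lemma chi_minus_3:
  assumes "p mod 3 = 1"
  shows "chi (-3) = 1"
proof -
  define M where "M = p div 3"
  have M: "2 * m = 3 * M" unfolding M_def using assms p_eq by presburger
  define w where "w = g ^ M"
  have "[w ^ 3 = 1] (mod int p)"
    unfolding w_def power_mult[symmetric] g_power_cong_1_iff M by simp
  hence "int p dvd (w - 1) * (w ^ 2 + w + 1)"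
    by (simp add: cong_iff_dvd_diff eval_nat_numeral algebra_simps)
  moreover have "\<not> int p dvd w - 1"
    using g_power_cong_1_iff[of M] M m_pos dvd_imp_le[of "2 * m" M] by (auto simp: w_def cong_iff_dvd_diff)
  ultimately have "int p dvd w ^ 2 + w + 1" by (simp add: prime_dvd_mult_p)
  moreover have "-3 - (2 * w + 1) ^ 2 = (w ^ 2 + w + 1) * (-4)"
    by (simp add: power2_eq_square algebra_simps)
  ultimately have "[-3 = (2 * w + 1) ^ 2] (mod int p)" unfolding cong_iff_dvd_diff by (metis dvd_mult2)
  hence e: "chi (-3) = chi (2 * w + 1) ^ 2" using chi_cong by (simp only: chi_power)
  have "p \<noteq> 3" using assms by auto
  hence "\<not> int p dvd -3" using not_dvd_three by simp
  hence "chi (-3) \<noteq> 0" by (simp add: chi_eq_0_iff)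
  thus ?thesis using e chi_range[of "2 * w + 1"] by auto
qed

lemma integral_sixteenth: "integral (1 / 16)"
  using integral_divide[OF integral_1, of 16] not_dvd_two_power[of 4] by simp

lemma clausen_sum_minus_1:
  "4 ^ m * clausen_sum m (-1) = ((-3) ^ (m mod 2) * of_int (legendre_at_minus_3 ^ 2) :: rat)"
  using clausen_sum_eq_square[of m "-1"] by (simp add: legendre_even_part_minus_3)

text \<open>
  The stray factors combine to \<open>(-12)^m \<equiv> \<chi>(-12) = \<chi>(-3) = 1\<close>.
\<close>

lemma clausen_sum_minus_1_cong:
  assumes "p mod 3 = 1" and xy: "int p = x ^ 2 + 3 * y ^ 2"
  shows "qcong 1 (clausen_sum m (-1)) (of_int (4 * x ^ 2))"
proof -
  have p3: "p \<noteq> 3" using assms(1) by auto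
  obtain u v where u: "cubic_sum 1 = 2 * u" and uv: "int p = u ^ 2 + 3 * v ^ 2"
    using cubic_sum_representation[OF assms(1)] by blast
  have ux: "u ^ 2 = x ^ 2" by (rule prime_form_representation_unique[OF prime_int_p _ uv xy]) simp
  define L where "L = legendre_at_minus_3 ^ 2"
  define e where "e = m mod 2"
  \<comment> \<open>The parity \<open>e\<close> of \<open>m\<close> accounts for the factor \<open>s^(m mod 2)\<close> in Clausen's identity.\<close>
  have exp: "2 * (m - m div 2) = m + e" unfolding e_def by presburger
  have L: "[3 ^ (m + e) * L = 4 * x ^ 2] (mod int p)"
    using legendre_at_minus_3_cong[OF p3] unfolding exp L_def u by (simp add: power_mult_distrib ux)
  have sgn: "(-1 :: int) ^ m = (-1) ^ e" unfolding e_def by (simp add: minus_one_power_iff)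
  have eq: "(-12 :: int) ^ m * ((-3) ^ e * L) = 4 ^ m * (3 ^ (m + e) * L)"
  proof -
    have "(-12 :: int) ^ m = (-1) ^ m * 3 ^ m * 4 ^ m" by (simp flip: power_mult_distrib)
    moreover have "(-3 :: int) ^ e = (-1) ^ e * 3 ^ e" by (simp flip: power_mult_distrib)
    moreover have "(-1 :: int) ^ e * (-1) ^ e = 1" by (simp flip: power_mult_distrib)
    ultimately show ?thesis unfolding sgn power_add by (simp add: mult_ac)
  qed
  have "[(-12) ^ m * ((-3) ^ e * L) = 4 ^ m * (4 * x ^ 2)] (mod int p)"
    unfolding eq by (intro cong_mult cong_refl L)
  moreover have "[(-12) ^ m = 1] (mod int p)"
  proof -
    have "chi (-12) = chi (2 ^ 2) * chi (-3)" by (simp flip: chi_mult)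
    also have "\<dots> = 1" unfolding chi_power chi_minus_3[OF assms(1)] using chi_square[OF not_dvd_two] by simp
    finally show ?thesis using chi_cong_power[of "-12"] by (simp add: cong_sym)
  qed
  ultimately have "[1 * ((-3) ^ e * L) = 4 ^ m * (4 * x ^ 2)] (mod int p)"
    using cong_trans[OF cong_sym[OF cong_mult[OF _ cong_refl]]] by blast
  hence "qcong 1 (of_int ((-3) ^ e * L)) (of_int (4 ^ m * (4 * x ^ 2)))"
    unfolding qcong_of_int_iff by simp
  hence "qcong 1 (of_int (4 ^ m) * clausen_sum m (-1)) (of_int (4 ^ m) * of_int (4 * x ^ 2))"
    using clausen_sum_minus_1 unfolding L_def e_def by simp
  moreover have "\<not> int p dvd 4 ^ m" using not_dvd_two_power[of "2 * m"] by (simp add: power_mult)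
  ultimately show ?thesis by (rule qcong_cancel)
qed

text \<open>
  The cubic sum is zero, so the Legendre value is divisible by \<open>p\<close> and its square by \<open>p^2\<close>.
\<close>

lemma clausen_sum_minus_1_cong_0:
  assumes "p mod 3 = 2"
  shows "qcong 2 (clausen_sum m (-1)) 0"
proof -
  have p3: "p \<noteq> 3" using assms by auto
  have "\<not> int p dvd 3 ^ (2 * (m - m div 2))"
    using not_dvd_three[OF p3] prime_int_p by (metis prime_dvd_power)
  moreover have "int p dvd 3 ^ (2 * (m - m div 2)) * legendre_at_minus_3 ^ 2"
    using legendre_at_minus_3_cong[OF p3] cubic_sum_eq_0[OF assms] by (simp add: cong_0_iff)
  ultimately have "int p dvd legendre_at_minus_3" by (simp add: prime_dvd_mult_p prime_dvd_power_p)
  hence "int p ^ 2 dvd legendre_at_minus_3 ^ 2" by (rule dvd_power_same)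
  hence "[(-3) ^ (m mod 2) * legendre_at_minus_3 ^ 2 = 0] (mod int p ^ 2)"
    by (simp add: cong_0_iff)
  hence "qcong 2 (of_int ((-3) ^ (m mod 2) * legendre_at_minus_3 ^ 2)) (of_int 0)"
    by (simp only: qcong_of_int_iff)
  hence "qcong 2 (of_int (4 ^ m) * clausen_sum m (-1)) (of_int (4 ^ m) * 0)"
    using clausen_sum_minus_1 by simp
  moreover have "\<not> int p dvd 4 ^ m" using not_dvd_two_power[of "2 * m"] by (simp add: power_mult)
  ultimately show ?thesis by (rule qcong_cancel)
qed

lemma clausen_sum_sixteenth_cong:
  "qcong 1 (clausen_sum m (-1)) (of_int (chi (-1)) * clausen_sum m (- (1 / 16)))"
proof -
  have int: "integral (clausen_sum m (- (1 / 16)))"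
    unfolding clausen_sum_def
    by (intro integral_sum integral_mult integral_power integral_of_nat integral_minus integral_sixteenth)
  have "chi (-4) = chi (2 ^ 2) * chi (-1)" by (simp flip: chi_mult)
  also have "\<dots> = chi (-1)" unfolding chi_power using chi_square[OF not_dvd_two] by simp
  finally have "[(-4) ^ m = chi (-1)] (mod int p)" using chi_cong_power[of "-4"] by (simp add: cong_sym)
  hence "qcong 1 (of_int ((-4) ^ m)) (of_int (chi (-1)))" unfolding qcong_of_int_iff by simp
  from qcong_mult[OF this qcong_refl integral_of_int int] show ?thesis
    using qcong_trans[OF clausen_sum_reversal] by simp
qed

text \<open>
  Here \<open>s = 3/4\<close>.  The reversal shows divisibility by \<open>p\<close>, and Clausen's identity lifts it to \<open>p^2\<close>.
\<close>

lemma clausen_sum_sixteenth_cong_0: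
  assumes "p mod 3 = 2"
  shows "qcong 2 (clausen_sum m (- (1 / 16))) 0"
proof -
  have "p \<noteq> 3" using assms by auto
  hence not3: "\<not> int p dvd 3" by (rule not_dvd_three)
  define F where "F = clausen_sum m (- (1 / 16) :: rat)"
  define Q where "Q = legendre_even_part m (3 / 4 :: rat)"
  define e where "e = m mod 2"
  have eq: "4 ^ m * F = (3 / 4) ^ e * Q ^ 2"
    using clausen_sum_eq_square[of m "- (1 / 16)"] by (simp add: F_def Q_def e_def)
  have i34: "integral (3 / 4)"
    using integral_divide[OF integral_numeral, of 4] not_dvd_four by simp
  have Q: "integral Q"
    unfolding Q_def legendre_even_part_def
    by (intro integral_sum integral_mult integral_power integral_of_nat integral_minus i34 integral_1)
  have "chi (-1) \<noteq> 0" by (simp add: chi_minus_1)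
  have "qcong 1 (of_int (chi (-1)) * F) (of_int (chi (-1)) * 0)"
    using qcong_trans[OF qcong_sym[OF clausen_sum_sixteenth_cong] qcong_2_imp_1[OF clausen_sum_minus_1_cong_0[OF assms]]]
    by (simp add: F_def)
  moreover have "\<not> int p dvd chi (-1)"
    using chi_range[of "-1"] \<open>chi (-1) \<noteq> 0\<close> p_gt_2 by auto
  ultimately have "qcong 1 F 0" by (rule qcong_cancel)
  hence "qcong 1 (of_int (4 ^ e * 4 ^ m) * F) (of_int (4 ^ e * 4 ^ m) * 0)"
    by (rule qcong_mult_left) (rule integral_of_int)
  also have "of_int (4 ^ e * 4 ^ m) * F = of_int (3 ^ e) * Q ^ 2"
  proof -
    have "of_int (4 ^ e * 4 ^ m) * F = 4 ^ e * (4 ^ m * F)" by simp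
    also have "\<dots> = of_int (3 ^ e) * Q ^ 2" unfolding eq by (simp add: power_divide)
    finally show ?thesis .
  qed
  finally have "qcong 1 (of_int (3 ^ e) * Q ^ 2) (of_int (3 ^ e) * 0)" by simp
  moreover have "\<not> int p dvd 3 ^ e" using not3 prime_int_p by (metis prime_dvd_power)
  ultimately have "qcong 1 (Q ^ 2) 0" by (rule qcong_cancel)
  hence "qcong 2 (Q ^ 2) 0" using qcong_square_0D[OF Q] qcong_square_0 by blast
  hence "qcong 2 ((3 / 4) ^ e * Q ^ 2) ((3 / 4) ^ e * 0)" by (rule qcong_mult_left) (intro integral_power i34)
  hence "qcong 2 (of_int (4 ^ m) * F) (of_int (4 ^ m) * 0)" using eq by simp
  moreover have "\<not> int p dvd 4 ^ m" using not_dvd_two_power[of "2 * m"] by (simp add: power_mult)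
  ultimately show ?thesis unfolding F_def by (rule qcong_cancel)
qed

section \<open>The congruences for Apery sums\<close>

lemma sum_to_p: "(\<Sum>k=0..p-1. f k) = (\<Sum>k<p. f k)"
  using p_pos by (intro sum.cong) auto

lemma minus_2p_cong: "qcong 1 (of_int a) (of_int (a - 2 * int p))"
  unfolding qcong_of_int_iff by (simp add: cong_iff_dvd_diff)

lemma apery_sum_cong_representation:
  assumes "p mod 8 = 1 \<or> p mod 8 = 3" and "int p = x ^ 2 + 2 * y ^ 2"
  shows "qcong 1 (\<Sum>k<p. apery_number k) (of_int (4 * x ^ 2 - 2 * int p))"
proof -
  have "qcong 1 (of_int (int (m choose (p div 8)) ^ 2)) (of_int (4 * x ^ 2))"
    unfolding qcong_of_int_iff using binomial_square_cong_minus_2[OF assms] by simp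
  from qcong_trans[OF apery_sum_cong_binomial_square[OF assms(1)] qcong_trans[OF this minus_2p_cong]]
  show ?thesis .
qed

lemma alternating_sums_cong:
  assumes "qcong r (clausen_sum m (-1)) (of_int (chi (-1)) * clausen_sum m (- (1 / 16)))" and "r = 1 \<or> r = 2"
  shows "qcong r (\<Sum>k<p. (-1) ^ k * apery_number k) (of_int (chi (-1)) * (\<Sum>k<p. (-1) ^ k * apery_poly k (1 / 16)))"
proof -
  have lower: "qcong r a b" if "qcong 2 a b" for a b using that assms(2) qcong_2_imp_1 by blast
  have "qcong r (\<Sum>k<p. (-1) ^ k * apery_number k) (clausen_sum m (-1))"
    unfolding apery_number_def using lower[OF alternating_apery_sum_cong[OF integral_1]] .
  also note assms(1)
  also have "qcong r (of_int (chi (-1)) * clausen_sum m (- (1 / 16))) (of_int (chi (-1)) * (\<Sum>k<p. (-1) ^ k * apery_poly k (1 / 16)))"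
    by (intro qcong_mult_left integral_of_int qcong_sym[OF lower[OF alternating_apery_sum_cong[OF integral_sixteenth]]])
  finally show ?thesis .
qed

end

theorem corollary1p2:
  fixes p :: nat
  assumes "prime p" and "odd p"
  shows
    "(\<forall>x y :: int. (p mod 8 = 1 \<or> p mod 8 = 3) \<and> int p = x ^ 2 + 2 * y ^ 2 \<longrightarrow>
        rat_cong_prime_power p 1 (\<Sum>k=0..p-1. apery_number k) (of_int (4 * x ^ 2 - 2 * int p)))
   \<and> (Legendre (-2) (int p) = -1 \<longleftrightarrow> p mod 8 = 5 \<or> p mod 8 = 7)
   \<and> (Legendre (-2) (int p) = -1 \<longrightarrow>
        rat_cong_prime_power p 1 (\<Sum>k=0..p-1. apery_number k) 0)
   \<and> (\<forall>x y :: int. p mod 3 = 1 \<and> int p = x ^ 2 + 3 * y ^ 2 \<longrightarrow>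
        rat_cong_prime_power p 1
          (\<Sum>k=0..p-1. (-1) ^ k * apery_number k)
          (of_int (Legendre (-1) (int p)) * (\<Sum>k=0..p-1. (-1) ^ k * apery_poly k (1/16)))
      \<and> rat_cong_prime_power p 1
          (of_int (Legendre (-1) (int p)) * (\<Sum>k=0..p-1. (-1) ^ k * apery_poly k (1/16)))
          (of_int (4 * x ^ 2 - 2 * int p)))
   \<and> (p mod 3 = 2 \<longrightarrow>
        rat_cong_prime_power p 2
          (\<Sum>k=0..p-1. (-1) ^ k * apery_number k)
          (of_int (Legendre (-1) (int p)) * (\<Sum>k=0..p-1. (-1) ^ k * apery_poly k (1/16)))
      \<and> rat_cong_prime_power p 2
          (of_int (Legendre (-1) (int p)) * (\<Sum>k=0..p-1. (-1) ^ k * apery_poly k (1/16)))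
          0)"
proof -
  interpret odd_prime p using assms by unfold_locales
  define A B where "A = (\<Sum>k<p. (-1) ^ k * apery_number k)"
    and "B = of_int (chi (-1)) * (\<Sum>k<p. (-1) ^ k * apery_poly k (1 / 16))"
  have A: "qcong 2 A (clausen_sum m (-1))"
    unfolding A_def apery_number_def by (rule alternating_apery_sum_cong) (rule integral_1)
  have split: "qcong 1 A B \<and> qcong 1 B (of_int (4 * x ^ 2 - 2 * int p))"
    if "p mod 3 = 1" "int p = x ^ 2 + 3 * y ^ 2" for x y :: int
  proof
    show AB: "qcong 1 A B" unfolding A_def B_def
      by (rule alternating_sums_cong) (use clausen_sum_sixteenth_cong in simp_all)
    have "qcong 1 A (of_int (4 * x ^ 2 - 2 * int p))"
      using qcong_trans[OF qcong_2_imp_1[OF A] qcong_trans[OF clausen_sum_minus_1_cong[OF that] minus_2p_cong]] .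
    thus "qcong 1 B (of_int (4 * x ^ 2 - 2 * int p))" using qcong_trans[OF qcong_sym[OF AB]] by blast
  qed
  have inert: "qcong 2 A B \<and> qcong 2 B 0" if "p mod 3 = 2"
  proof
    have C: "qcong 2 (of_int (chi (-1)) * clausen_sum m (- (1 / 16))) 0"
      using qcong_mult_left[OF clausen_sum_sixteenth_cong_0[OF that], of "of_int (chi (-1))"] by simp
    show AB: "qcong 2 A B" unfolding A_def B_def
      by (rule alternating_sums_cong[OF qcong_trans[OF clausen_sum_minus_1_cong_0[OF that] qcong_sym[OF C]]]) simp
    have "qcong 2 A 0" using qcong_trans[OF A clausen_sum_minus_1_cong_0[OF that]] .
    thus "qcong 2 B 0" using qcong_trans[OF qcong_sym[OF AB]] by blast
  qed
  show ?thesis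
    unfolding sum_to_p chi_def[of "-1", symmetric] A_def[symmetric] B_def[symmetric]
    using apery_sum_cong_representation Legendre_minus_2 apery_sum_cong_0 split inert by blast
qed

end
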